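(* Let $(A,B)$ be a pair of real random variables and let $\alpha>0$. Suppose that (1) $\mathbb{P}(A<0)>0$ and $\mathbb{E}\log|A|<0$; (2) $\mathbb{E}|A|^{\alpha}=1$ and $\rho:=\mathbb{E}[|A|^{\alpha}\log|A|]<\infty$; (3) the conditional law of $\log|A|$ given $|A|>0$ is non-arithmetic; (4) there exists $\varepsilon>0$ such that $\mathbb{E}|A|^{\alpha+\varepsilon}<\infty$; (5) for a slowly varying function $L$ and constants $p,q\ge0$ with $p+q=1$, $\mathbb{P}(B>t)\sim p\,t^{-\alpha}L(t)$ and $\mathbb{P}(B<-t)\sim q\,t^{-\alpha}L(t)$ as $t\to\infty$; (6) $\mathbb{E}|B|^{\alpha}=\infty$. Let $R$ be the (unique in law) solution of $R\stackrel{d}{=}AR+B$ with $R$ and $(A,B)$ independent, and let $\widetilde L(x)=\int_0^x\frac{L(t)}{t}\,dt$. Then, as $x\to\infty$, $$x^{\alpha}\,\mathbb{P}(R>x)\sim\frac{\widetilde L(x)}{2\rho},\qquad x^{\alpha}\,\mathbb{P}(R<-x)\sim\frac{\widetilde L(x)}{2\rho}.$$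
   Context: $f(x)\sim g(x)$ means $\lim_{x\to\infty}f(x)/g(x)=1$; $f\sim c\,g$ with $c=0$ means $f(x)/g(x)\to0$. A measurable $L:(0,\infty)\to(0,\infty)$ is slowly varying if $L(\lambda x)/L(x)\to1$ as $x\to\infty$ for every $\lambda>0$; $L$ is taken such that $L(t)/t$ is integrable on $(0,x)$ for every $x>0$, so that $\widetilde L$ is finite (for instance $L(t)=t^{\alpha}\mathbb{P}(|B|>t)$). A law on $\mathbb{R}$ is arithmetic if it is supported in $d\mathbb{Z}$ for some $d>0$, and non-arithmetic otherwise. The convention $0^\alpha\log0=0$ is used. Since $\mathbb{E}\log|A|<0$ and $\mathbb{E}\log^+|B|<\infty$, the solution $R$ exists and is unique in law. *)

theory Defs
  imports "HOL-Probability.Probability" "HOL-Library.Landau_Symbols"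
begin

text \<open>
  The convention for \<open>f \<sim> c g\<close> allows \<open>c = 0\<close>, in which case it
  means that \<open>f x / g x\<close> tends to \<open>0\<close>.
\<close>

definition asymp_equiv_const :: "(real \<Rightarrow> real) \<Rightarrow> real \<Rightarrow> (real \<Rightarrow> real) \<Rightarrow> bool" where
  "asymp_equiv_const f c g \<longleftrightarrow>
     (if c = 0 then ((\<lambda>x. f x / g x) \<longlongrightarrow> 0) at_top
      else f \<sim>[at_top] (\<lambda>x. c * g x))"

text \<open>
  A slowly varying function is a function from \<open>(0, \<infinity>)\<close> to itself, so the values
  of \<open>L\<close> on the non-positive reals are irrelevant.
\<close>

definition slowly_varying :: "(real \<Rightarrow> real) \<Rightarrow> bool" where
  "slowly_varying L \<longleftrightarrow>
     L \<in> borel_measurable (restrict_space borel {0<..}) \<and>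
     (\<forall>x>0. L x > 0) \<and>
     (\<forall>l>0. ((\<lambda>x. L (l * x) / L x) \<longlongrightarrow> 1) at_top)"

definition Ltilde :: "(real \<Rightarrow> real) \<Rightarrow> real \<Rightarrow> real" where
  "Ltilde L x = (LINT t:{0<..<x}|lborel. L t / t)"

definition arithmetic_law :: "real measure \<Rightarrow> bool" where
  "arithmetic_law \<mu> \<longleftrightarrow> (\<exists>d>0. AE x in \<mu>. \<exists>k::int. x = d * of_int k)"

text \<open>
  The logarithm with \<open>log 0 = -\<infinity>\<close>; \<open>ln 0 = 0\<close> would give
  the wrong value to \<open>E log |A|\<close> when \<open>A\<close> has an atom at \<open>0\<close>.
\<close>

definition elog :: "real \<Rightarrow> ereal" where
  "elog x = (if x = 0 then -\<infinity> else ereal (ln x))"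

text \<open>
  The expectation of an extended real random variable, as the integral of the positive part
  minus that of the negative part (\<open>e2ennreal\<close> sends negative values to \<open>0\<close>).
  If both are infinite the expectation does not exist; the value is then \<open>\<infinity> - \<infinity> = \<infinity>\<close>
  in \<open>ereal\<close>, so that an upper bound on it excludes this case.
\<close>

definition ext_expectation :: "'a measure \<Rightarrow> ('a \<Rightarrow> ereal) \<Rightarrow> ereal" where
  "ext_expectation M X =
     enn2ereal (\<integral>\<^sup>+ \<omega>. e2ennreal (X \<omega>) \<partial>M) - enn2ereal (\<integral>\<^sup>+ \<omega>. e2ennreal (- X \<omega>) \<partial>M)"

text \<open>
  Independence of two random variables whose value types differ, which the library's
  \<open>indep_var\<close> does not allow.
\<close>

definition indep_rvs ::
    "'a measure \<Rightarrow> ('a \<Rightarrow> 'b::topological_space) \<Rightarrow> ('a \<Rightarrow> 'c::topological_space) \<Rightarrow> bool" where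
  "indep_rvs M X Y \<longleftrightarrow>
     X \<in> borel_measurable M \<and> Y \<in> borel_measurable M \<and>
     prob_space.indep_set M
       {X -` S \<inter> space M | S. S \<in> sets borel} {Y -` S \<inter> space M | S. S \<in> sets borel}"

definition solves_affine_equation ::
    "'a measure \<Rightarrow> ('a \<Rightarrow> real) \<Rightarrow> ('a \<Rightarrow> real) \<Rightarrow> ('a \<Rightarrow> real) \<Rightarrow> bool" where
  "solves_affine_equation M A B R \<longleftrightarrow>
     indep_rvs M R (\<lambda>\<omega>. (A \<omega>, B \<omega>)) \<and>
     distr M borel R = distr M borel (\<lambda>\<omega>. A \<omega> * R \<omega> + B \<omega>)"

end

(*
  Tilting the law of A by |A|^alpha makes ln |A| a random variable with mean rho > 0 and turns the
  equation for R into a renewal equation for the truncated moments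
  V_b(s) = E min((+-R)^+, e^s)^alpha, where the sign index b in {False, True} changes whenever A < 0.
  The inhomogeneous term equals E min((+-B)^+, e^s)^alpha up to a bounded error, by the inequality
  |phi(x + y) - phi(x) - phi(y)| <= C (|x|^t |y|^(alpha - t) + |x|^(alpha - t) |y|^t) for the truncated
  power phi; the moment of order alpha + epsilon makes the right-hand side integrable at x = A R, y = B.
  Hence the inhomogeneous term grows like l(s) = 1 + E min(|B|, e^s)^alpha, a multiple of Ltilde(e^s),
  and l(s + h) / l(s) -> 1.

  No renewal theorem is needed. By Helly's theorem the increments of V_b around s, divided by l(s),
  converge along subsequences. The increments of a limit are bounded harmonic functions of the random
  walk (sign, ln |A|), hence constant by the Choquet-Deny theorem, so the limit is linear and its slope
  is read off from the renewal equation. That V_b grows at most like l is shown in the same way,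
  normalising by the solution itself at near-maximal points of w(s) exp(-d s) / l(s), d -> 0.
  The tail of R is recovered from V_b by monotonicity.
*)
theory Submission
  imports Defs
begin

section \<open>Harmonic functions of a random walk with signs\<close>

text \<open>Since \<open>E |B| powr \<alpha>\<close> is infinite, the inhomogeneous term is
  unbounded and the key renewal theorem does not apply; what can converge are increments of
  \<open>V b\<close>, divided by a normalisation that is asymptotically invariant under shifts.
  Truncated moments replace tails because they are monotone and continuous in \<open>s\<close>,
  while \<open>\<alpha> * w b s\<close> plays the part of the derivative of \<open>V b\<close>. The
  factor 2 comes from the signs: a step with \<open>A < 0\<close> has positive probability, so the
  limit slope is the same for both signs, and the two renewal equations added up read
  \<open>2 * slope * \<rho> = 1\<close>. Dividing the slope by \<alpha> gives
  \<open>w ~ l / (2 * \<alpha> * \<rho>)\<close>; the truncated moment of \<open>B\<close> is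
  asymptotic to \<open>\<alpha> * Ltilde\<close>, so \<alpha> cancels. The cross terms are delicate
  because only moments of order below \<alpha> are available for \<open>R\<close> and
  \<open>B\<close>: the total degree \<alpha> is split between them, and the extra moment of
  \<open>A\<close> pays for its possible dependence on \<open>B\<close>.\<close>

text \<open>The assumptions make \<open>H\<close> an additive subgroup of the reals. If its positive
  elements stay away from 0, their infimum is attained and generates \<open>H\<close> by division
  with remainder.\<close>

lemma difference_closed_cases:
  fixes H :: "real set"
  assumes zero: "0 \<in> H" and diff: "\<And>x y. x \<in> H \<Longrightarrow> y \<in> H \<Longrightarrow> x - y \<in> H"
  shows "(\<exists>d>0. \<forall>x\<in>H. \<exists>k::int. x = d * of_int k) \<or> (\<forall>e>0. \<exists>p\<in>H. 0 < p \<and> p < e)"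
proof (rule disjCI)
  assume "\<not> (\<forall>e>0. \<exists>p\<in>H. 0 < p \<and> p < e)"
  then obtain e where e: "e > 0" "\<And>p. p \<in> H \<Longrightarrow> 0 < p \<Longrightarrow> e \<le> p"
    by (meson not_le)
  have neg: "- x \<in> H" if "x \<in> H" for x
    using diff[OF zero that] by simp
  have add: "x + y \<in> H" if "x \<in> H" "y \<in> H" for x y
    using diff[OF that(1) neg[OF that(2)]] by simp
  show "\<exists>d>0. \<forall>x\<in>H. \<exists>k::int. x = d * of_int k"
  proof (cases "\<exists>p\<in>H. p > 0")
    case False
    then have "x = 0" if "x \<in> H" for x
      using neg[OF that] that by (metis neg_0_less_iff_less not_less_iff_gr_or_eq)
    then show ?thesis by (intro exI[of _ 1]) force
  next
    case True
    define d where "d = Inf {p \<in> H. p > 0}"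
    have bdd: "bdd_below {p \<in> H. p > 0}"
      by (intro bdd_belowI[of _ e]) (use e in auto)
    have d_e: "e \<le> d"
      unfolding d_def using True e by (intro cInf_greatest) auto
    have d_le: "d \<le> p" if "p \<in> H" "p > 0" for p
      unfolding d_def using that bdd by (intro cInf_lower) auto
    obtain p where p: "p \<in> H" "p > 0" "p < 2 * d"
    proof -
      have "d < 2 * d" using d_e e(1) by simp
      then obtain p where "p \<in> {p \<in> H. p > 0}" "p < 2 * d"
        using cInf_lessD[of "{p \<in> H. p > 0}" "2 * d"] True unfolding d_def[symmetric] by auto
      with that show thesis by auto
    qed
    \<comment> \<open>If the infimum were not attained, there would be two elements
      \<open>p' < p\<close> strictly between \<open>d\<close> and \<open>2 * d\<close>, and their
      difference would be a positive element below \<open>d\<close>.\<close>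
    have dH: "d \<in> H"
    proof (rule ccontr)
      assume "d \<notin> H"
      then have "d < p" using d_le[OF p(1,2)] p(1) by (cases "d = p") auto
      then obtain p' where p': "p' \<in> {p \<in> H. p > 0}" "p' < p"
        using cInf_lessD[of "{p \<in> H. p > 0}" p] True unfolding d_def[symmetric] by auto
      have "p - p' \<in> H" using diff p p' by auto
      with d_le[of "p - p'"] p' have "d \<le> p - p'" by auto
      moreover have "d \<le> p'" using d_le p' by auto
      ultimately show False using p(3) by simp
    qed
    have mult_nat: "d * of_nat n \<in> H" for n :: nat
      by (induction n) (auto simp: zero algebra_simps intro: add dH)
    have mult: "d * of_int k \<in> H" for k :: int
      by (cases k rule: int_cases2) (use mult_nat neg in auto)
    have "x = d * of_int \<lfloor>x / d\<rfloor>" if "x \<in> H" for x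
    proof (rule ccontr)
      define y where "y = x - d * of_int \<lfloor>x / d\<rfloor>"
      have "d > 0" using d_e e by simp
      assume "x \<noteq> d * of_int \<lfloor>x / d\<rfloor>"
      moreover have "y = d * frac (x / d)"
        using \<open>d > 0\<close> by (simp add: y_def frac_def field_simps)
      ultimately have "y > 0" "y < d"
        using \<open>d > 0\<close> frac_ge_0[of "x / d"] frac_lt_1[of "x / d"]
        by (auto simp: y_def less_le zero_le_mult_iff)
      moreover have "y \<in> H" unfolding y_def by (intro diff that mult)
      ultimately show False using d_le[of y] by simp
    qed
    then show ?thesis using d_e e by (intro exI[of _ d]) auto
  qed
qed

text \<open>Shifting \<open>v\<close> by a multiple of a small period \<open>p\<close> lands in the
  interval from 0 to \<open>p\<close>, where continuity at 0 applies.\<close>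

lemma continuous_small_periods_imp_const:
  fixes f :: "real \<Rightarrow> real"
  assumes cont: "continuous_on UNIV f"
    and per: "\<And>e. e > 0 \<Longrightarrow> \<exists>p. 0 < p \<and> p < e \<and> (\<forall>v k. f (v + of_int k * p) = f v)"
  shows "f v = f 0"
proof -
  have "isCont f 0" using cont by (simp add: continuous_on_eq_continuous_at)
  have "dist (f v) (f 0) < e" if "e > 0" for e
  proof -
    from \<open>isCont f 0\<close> that obtain d where d: "d > 0" "\<And>x. dist x 0 < d \<Longrightarrow> dist (f x) (f 0) < e"
      unfolding continuous_at_eps_delta by blast
    obtain p where p: "0 < p" "p < d" "\<And>v k. f (v + of_int k * p) = f v" using per[OF d(1)] by blast
    have eq: "v + of_int (- \<lfloor>v / p\<rfloor>) * p = p * frac (v / p)"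
      using p by (simp add: frac_def field_simps)
    have "0 \<le> p * frac (v / p)" using p by (simp add: frac_ge_0)
    moreover have "p * frac (v / p) < p"
      using mult_strict_left_mono[OF frac_lt_1[of "v / p"] p(1)] by (simp only: mult_1_right)
    ultimately have "dist (v + of_int (- \<lfloor>v / p\<rfloor>) * p) 0 < d" unfolding eq dist_real_def using p by linarith
    from d(2)[OF this] show ?thesis unfolding p(3) .
  qed
  then show ?thesis by (metis dist_self less_irrefl zero_less_dist_iff)
qed

lemma measurable_shift_flip:
  fixes f :: "bool \<Rightarrow> real \<Rightarrow> real"
  assumes [measurable]: "\<And>b. f b \<in> borel_measurable borel" "X \<in> borel_measurable M" "Measurable.pred M B"
  shows "(\<lambda>\<omega>. f (B \<omega>) (X \<omega>)) \<in> borel_measurable M"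
proof -
  have "(\<lambda>\<omega>. f (B \<omega>) (X \<omega>)) = (\<lambda>\<omega>. if B \<omega> then f True (X \<omega>) else f False (X \<omega>))"
    by auto
  also have "\<dots> \<in> borel_measurable M" by measurable
  finally show ?thesis .
qed

context prob_space
begin

text \<open>The walk lives on the abelian group of signs times reals. Commutativity lets two
  independent steps be exchanged, which compares the increment of \<open>f\<close> over one step
  before and after another step. The exceptional null set may depend on \<open>v\<close>;
  \<open>Choquet_Deny_signed\<close> removes this dependence.\<close>

lemma harmonic_invariant_AE:
  fixes f :: "bool \<Rightarrow> real \<Rightarrow> real" and X :: "'a \<Rightarrow> real" and S :: "'a \<Rightarrow> bool"
  assumes [measurable]: "X \<in> borel_measurable M" "Measurable.pred M S" "\<And>b. f b \<in> borel_measurable borel"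
    and bound: "\<And>b v. \<bar>f b v\<bar> \<le> C"
    and harm: "\<And>b v. f b v = (\<integral>\<omega>. f (b \<noteq> S \<omega>) (v - X \<omega>) \<partial>M)"
  shows "AE \<omega> in M. f (b \<noteq> S \<omega>) (v - X \<omega>) = f b v"
proof -
  let ?F = "\<lambda>b v \<omega>. f (b \<noteq> S \<omega>) (v - X \<omega>)"
  interpret P: pair_prob_space M M ..
  have C: "C \<ge> 0" using bound[of True 0] by linarith
  have sq_bound: "(f b v)\<^sup>2 \<le> C\<^sup>2" for b v
    using power_mono[OF bound[of b v], of 2] by simp
  have meas [measurable]: "(\<lambda>\<omega>. ?F b v \<omega>) \<in> borel_measurable M" for b v
    by (rule measurable_shift_flip[of f, OF assms(3)]; measurable)
  have meas2 [measurable]: "(\<lambda>x. f ((b \<noteq> S (fst x)) \<noteq> S (snd x)) (v - X (fst x) - X (snd x))) \<in> borel_measurable (M \<Otimes>\<^sub>M M)" for b v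
    by (rule measurable_shift_flip[of f, OF assms(3)]; measurable)
  have int: "integrable M (\<lambda>\<omega>. ?F b v \<omega>)" for b v
    by (rule integrable_const_bound[where B=C]) (use bound in auto)
  have int2: "integrable M (\<lambda>\<omega>. (?F b v \<omega>)\<^sup>2)" for b v
    by (rule integrable_const_bound[where B="C\<^sup>2"]) (use sq_bound in auto)
  define q where "q b v = (\<integral>\<omega>. (?F b v \<omega> - f b v)\<^sup>2 \<partial>M)" for b v
  have diff_bound: "(f b v - f b' v')\<^sup>2 \<le> (2 * C)\<^sup>2" for b v b' v'
  proof -
    have "\<bar>f b v - f b' v'\<bar> \<le> \<bar>2 * C\<bar>" using bound[of b v] bound[of b' v'] C by linarith
    then show ?thesis by (rule abs_le_square_iff[THEN iffD1])
  qed
  have intq: "integrable M (\<lambda>\<omega>. (?F b v \<omega> - f b v)\<^sup>2)" for b v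
    by (rule integrable_const_bound[where B="(2 * C)\<^sup>2"]) (use diff_bound in auto)
  have q_eq: "q b v = (\<integral>\<omega>. (?F b v \<omega>)\<^sup>2 \<partial>M) - (f b v)\<^sup>2" for b v
  proof -
    have "q b v = (\<integral>\<omega>. ((?F b v \<omega>)\<^sup>2 - 2 * f b v * ?F b v \<omega>) + (f b v)\<^sup>2 \<partial>M)"
      unfolding q_def by (intro Bochner_Integration.integral_cong) (auto simp: power2_eq_square algebra_simps)
    also have "\<dots> = (\<integral>\<omega>. (?F b v \<omega>)\<^sup>2 \<partial>M) - 2 * f b v * (\<integral>\<omega>. ?F b v \<omega> \<partial>M) + (f b v)\<^sup>2"
      using int int2 by (simp add: prob_space)
    also have "\<dots> = (\<integral>\<omega>. (?F b v \<omega>)\<^sup>2 \<partial>M) - (f b v)\<^sup>2"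
      unfolding harm[of b v, symmetric] by (simp add: power2_eq_square)
    finally show ?thesis .
  qed
  have q_meas_pair: "(\<lambda>x. (f ((b \<noteq> S (fst x)) \<noteq> S (snd x)) (v - X (fst x) - X (snd x)) - f (b \<noteq> S (fst x)) (v - X (fst x)))\<^sup>2) \<in> borel_measurable (M \<Otimes>\<^sub>M M)" for b v
    by measurable
  have int_pair: "integrable (M \<Otimes>\<^sub>M M) (\<lambda>(x, y). (f ((b \<noteq> S x) \<noteq> S y) (v - X x - X y) - f (b \<noteq> S x) (v - X x))\<^sup>2)" for b v
    using q_meas_pair[of b v] diff_bound
    by (intro P.integrable_const_bound[where B="(2 * C)\<^sup>2"]) (auto simp: case_prod_unfold)
  have q_meas: "(\<lambda>x. q (b \<noteq> S x) (v - X x)) \<in> borel_measurable M" for b v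
    unfolding q_def using int_pair[of b v] by (intro borel_measurable_lebesgue_integral) auto
  have q_nonneg: "0 \<le> q b v" for b v unfolding q_def by simp
  have q_le: "q b v \<le> (2 * C)\<^sup>2" for b v
    unfolding q_def
    using integral_mono[OF intq[of b v], of "\<lambda>_. (2 * C)\<^sup>2"] diff_bound by (simp add: prob_space)
  have q_int: "integrable M (\<lambda>\<omega>. q (b \<noteq> S \<omega>) (v - X \<omega>))" for b v
    by (rule integrable_const_bound[where B="(2*C)\<^sup>2"]) (use q_meas q_le q_nonneg in auto)
  \<comment> \<open>Averaging \<open>?g x y\<close> over the first step \<open>x\<close> gives, by
    \<open>comm\<close> and harmonicity, the increment of \<open>f\<close> over the step
    \<open>y\<close> taken from \<open>(b, v)\<close>. Its square is at most the average of the
    squares; Fubini then exchanges the two steps.\<close>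
  have q_sub: "q b v \<le> (\<integral>\<omega>. q (b \<noteq> S \<omega>) (v - X \<omega>) \<partial>M)" for b v
  proof -
    let ?g = "\<lambda>x y. f ((b \<noteq> S x) \<noteq> S y) (v - X x - X y) - f (b \<noteq> S x) (v - X x)"
    have g_meas: "(\<lambda>(x, y). ?g x y) \<in> borel_measurable (M \<Otimes>\<^sub>M M)"
      unfolding case_prod_unfold by measurable
    have comm: "f ((b \<noteq> S x) \<noteq> S y) (v - X x - X y) = f ((b \<noteq> S y) \<noteq> S x) ((v - X y) - X x)" for x y
      by (rule arg_cong2[where f=f]) auto
    have step: "(f (b \<noteq> S y) (v - X y) - f b v)\<^sup>2 \<le> (\<integral>x. (?g x y)\<^sup>2 \<partial>M)" if "y \<in> space M" for y
    proof -
      have "(\<integral>x. f ((b \<noteq> S x) \<noteq> S y) (v - X x - X y) \<partial>M)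
          = (\<integral>x. f ((b \<noteq> S y) \<noteq> S x) ((v - X y) - X x) \<partial>M)"
        by (intro Bochner_Integration.integral_cong refl comm)
      also have "\<dots> = f (b \<noteq> S y) (v - X y)" by (rule harm[symmetric])
      finally have e1: "(\<integral>x. f ((b \<noteq> S x) \<noteq> S y) (v - X x - X y) \<partial>M) = f (b \<noteq> S y) (v - X y)" .
      have i1: "integrable M (\<lambda>x. f ((b \<noteq> S x) \<noteq> S y) (v - X x - X y))"
        by (subst Bochner_Integration.integrable_cong[OF refl comm]) (rule int)
      have e2: "(\<integral>x. ?g x y \<partial>M) = f (b \<noteq> S y) (v - X y) - f b v"
        using i1 int e1 harm[of b v] by simp
      have ig: "integrable M (\<lambda>x. ?g x y)" using i1 int by simp
      have "integrable M (\<lambda>x. (?g x y)\<^sup>2)"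
        by (rule integrable_const_bound[where B="(2*C)\<^sup>2"])
           (use diff_bound ig in \<open>auto intro!: borel_measurable_power borel_measurable_integrable\<close>)
      then have "0 \<le> (\<integral>x. (?g x y)\<^sup>2 \<partial>M) - (\<integral>x. ?g x y \<partial>M)\<^sup>2"
        using variance_eq[OF ig] variance_positive[of "\<lambda>x. ?g x y"] by simp
      then show ?thesis unfolding e2 by simp
    qed
    have int_pair': "integrable (M \<Otimes>\<^sub>M M) (\<lambda>(x, y). (?g x y)\<^sup>2)" by (rule int_pair)
    have "q b v \<le> (\<integral>y. (\<integral>x. (?g x y)\<^sup>2 \<partial>M) \<partial>M)"
      unfolding q_def
      by (intro integral_mono intq step P.integrable_snd int_pair') auto
    also have "\<dots> = (\<integral>x. (\<integral>y. (?g x y)\<^sup>2 \<partial>M) \<partial>M)"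
      by (rule P.Fubini_integral[OF int_pair'])
    finally show ?thesis unfolding q_def .
  qed
  \<comment> \<open>The variance \<open>q\<close> of one step is the drift of \<open>f\<^sup>2\<close> and is itself subharmonic, because the
    group is abelian. Applying the transition operator \<open>N\<close> times adds up \<open>N\<close> copies of \<open>q\<close> below \<open>C\<^sup>2\<close>.\<close>
  have key: "(f b v)\<^sup>2 + real N * q b v \<le> C\<^sup>2" for N b v
  proof (induction N arbitrary: b v)
    case 0
    show ?case using sq_bound by simp
  next
    case (Suc N)
    have "(\<integral>\<omega>. (?F b v \<omega>)\<^sup>2 + real N * q (b \<noteq> S \<omega>) (v - X \<omega>) \<partial>M) \<le> (\<integral>\<omega>. C\<^sup>2 \<partial>M)"
      by (intro integral_mono) (use Suc int2 q_int in auto)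
    then have "(\<integral>\<omega>. (?F b v \<omega>)\<^sup>2 \<partial>M) + real N * (\<integral>\<omega>. q (b \<noteq> S \<omega>) (v - X \<omega>) \<partial>M) \<le> C\<^sup>2"
      using int2 q_int by (simp add: prob_space)
    moreover have "real N * q b v \<le> real N * (\<integral>\<omega>. q (b \<noteq> S \<omega>) (v - X \<omega>) \<partial>M)"
      by (intro mult_left_mono q_sub) auto
    moreover have "real (Suc N) * q b v = real N * q b v + q b v" by (simp add: algebra_simps)
    ultimately show ?case using q_eq[of b v] by linarith
  qed
  have "q b v = 0"
  proof (rule ccontr)
    assume "q b v \<noteq> 0"
    then have "q b v > 0" using q_nonneg[of b v] by simp
    then obtain N :: nat where "C\<^sup>2 < real N * q b v"
      using ex_less_of_nat_mult by blast
    with key[of b v N] show False using zero_le_power2[of "f b v"] by linarith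
  qed
  then have "AE \<omega> in M. (?F b v \<omega> - f b v)\<^sup>2 = 0"
    unfolding q_def using integral_nonneg_eq_0_iff_AE[OF intq[of b v]] by simp
  then show ?thesis by simp
qed

text \<open>Almost every step preserves \<open>f\<close>. Repeating the same step restores the sign,
  so \<open>2 * X\<close> is a period. If the group of periods were discrete, \<open>X\<close> would
  live on a lattice of half the span; hence there are arbitrarily small periods and each
  \<open>f b\<close> is constant. One step with \<open>S\<close> true then identifies the two
  constants.\<close>

theorem Choquet_Deny_signed:
  fixes f :: "bool \<Rightarrow> real \<Rightarrow> real" and X :: "'a \<Rightarrow> real" and S :: "'a \<Rightarrow> bool"
  assumes X [measurable]: "X \<in> borel_measurable M" and S [measurable]: "Measurable.pred M S"
    and cont: "\<And>b. continuous_on UNIV (f b)"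
    and bound: "\<And>b v. \<bar>f b v\<bar> \<le> C"
    and harm: "\<And>b v. f b v = (\<integral>\<omega>. f (b \<noteq> S \<omega>) (v - X \<omega>) \<partial>M)"
    and nonarith: "\<And>d. d > 0 \<Longrightarrow> \<not> (AE \<omega> in M. \<exists>k::int. X \<omega> = d * of_int k)"
    and flip: "\<not> (AE \<omega> in M. \<not> S \<omega>)"
  shows "f b v = f b' v'"
proof -
  have [measurable]: "f b \<in> borel_measurable borel" for b
    using cont by (intro borel_measurable_continuous_onI)
  \<comment> \<open>Rational arguments first, so that one null set serves them all; continuity
    extends the identity to every real \<open>v\<close>.\<close>
  have "AE \<omega> in M. \<forall>r\<in>\<rat>. f (b \<noteq> S \<omega>) (r - X \<omega>) = f b r" for b
    using harmonic_invariant_AE[OF X S _ bound harm] by (simp add: AE_ball_countable countable_rat)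
  then have "AE \<omega> in M. \<forall>b. \<forall>r\<in>\<rat>. f (b \<noteq> S \<omega>) (r - X \<omega>) = f b r"
    by (simp add: AE_all_countable)
  then have inv: "AE \<omega> in M. \<forall>b v. f (b \<noteq> S \<omega>) (v - X \<omega>) = f b v"
  proof eventually_elim
    case (elim \<omega>)
    show ?case
    proof (intro allI)
      fix b v
      have "f (b \<noteq> S \<omega>) (v - X \<omega>) - f b v = 0"
      proof (rule continuous_constant_on_closure[where S="\<rat>" and f="\<lambda>v. f (b \<noteq> S \<omega>) (v - X \<omega>) - f b v"])
        show "continuous_on (closure \<rat>) (\<lambda>v. f (b \<noteq> S \<omega>) (v - X \<omega>) - f b v)"
          by (intro continuous_intros continuous_on_compose2[OF cont]
              continuous_on_subset[OF cont]) auto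
        show "v \<in> closure \<rat>" by (simp add: Rats_closure_real)
      qed (use elim in auto)
      then show "f (b \<noteq> S \<omega>) (v - X \<omega>) = f b v" by simp
    qed
  qed
  define H where "H = {p. \<forall>b v. f b (v + p) = f b v}"
  have H0: "0 \<in> H" by (simp add: H_def)
  have Hd: "x - y \<in> H" if "x \<in> H" "y \<in> H" for x y
  proof -
    have "f b (v + (x - y)) = f b v" for b v
    proof -
      have "f b ((v - y) + y) = f b (v - y)" using that(2) unfolding H_def by blast
      moreover have "f b ((v - y) + x) = f b (v - y)" using that(1) unfolding H_def by blast
      ultimately show ?thesis by (simp add: algebra_simps)
    qed
    then show ?thesis by (simp add: H_def)
  qed
  have Hn: "- x \<in> H" if "x \<in> H" for x using Hd[OF H0 that] by simp
  have XH: "AE \<omega> in M. 2 * X \<omega> \<in> H"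
    using inv
  proof eventually_elim
    case (elim \<omega>)
    have "f b (v - 2 * X \<omega>) = f b v" for b v
    proof -
      have "f ((b \<noteq> S \<omega>) \<noteq> S \<omega>) ((v - X \<omega>) - X \<omega>) = f b v"
        using elim[rule_format, of "b \<noteq> S \<omega>" "v - X \<omega>"] elim[rule_format, of b v] by (rule trans)
      moreover have "((b \<noteq> S \<omega>) \<noteq> S \<omega>) = b" by auto
      ultimately show ?thesis by (simp add: algebra_simps)
    qed
    then have "- (2 * X \<omega>) \<in> H" by (simp add: H_def)
    from Hn[OF this] show ?case by simp
  qed
  have small: "\<forall>e>0. \<exists>p\<in>H. 0 < p \<and> p < e"
  proof (rule ccontr)
    assume "\<not> ?thesis"
    with difference_closed_cases[OF H0 Hd] obtain d where
      d: "d > 0" "\<And>x. x \<in> H \<Longrightarrow> \<exists>k::int. x = d * of_int k" by blast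
    have "AE \<omega> in M. \<exists>k::int. X \<omega> = (d / 2) * of_int k"
      using XH
    proof eventually_elim
      case (elim \<omega>)
      from d(2)[OF this] obtain k :: int where "2 * X \<omega> = d * of_int k" by blast
      then have "X \<omega> = d / 2 * of_int k" by (simp add: field_simps)
      then show ?case by blast
    qed
    then show False using nonarith[of "d / 2"] d(1) by simp
  qed
  have const: "f b v = f b 0" for b v
  proof (rule continuous_small_periods_imp_const[OF cont])
    fix e :: real assume "e > 0"
    then obtain p where p: "p \<in> H" "0 < p" "p < e" using small by blast
    have nat: "of_nat n * p \<in> H" for n
    proof (induction n)
      case (Suc n)
      from Hd[OF Suc Hn[OF p(1)]] show ?case by (simp add: distrib_right add.commute)
    qed (simp add: H0)
    have "of_int k * p \<in> H" for k :: int
      by (cases k rule: int_cases2) (use nat Hn in auto)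
    then show "\<exists>p. 0 < p \<and> p < e \<and> (\<forall>v k. f b (v + of_int k * p) = f b v)"
      using p(2,3) by (auto simp: H_def)
  qed
  have "f (\<not> b) 0 = f b 0" for b
  proof -
    have "\<exists>\<omega>. S \<omega> \<and> (\<forall>b v. f (b \<noteq> S \<omega>) (v - X \<omega>) = f b v)"
    proof (rule ccontr)
      assume "\<not> ?thesis"
      then have "\<forall>b v. f (b \<noteq> S \<omega>) (v - X \<omega>) = f b v \<Longrightarrow> \<not> S \<omega>" for \<omega> by blast
      from eventually_mono[OF inv this] have "AE \<omega> in M. \<not> S \<omega>" .
      with flip show False by blast
    qed
    then obtain \<omega> where \<omega>: "S \<omega>" "\<And>b v. f (b \<noteq> S \<omega>) (v - X \<omega>) = f b v" by blast
    from \<omega>(2)[of b 0] \<omega>(1) have "f (\<not> b) (- X \<omega>) = f b 0" by simp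
    with const[of "\<not> b" "- X \<omega>"] show ?thesis by simp
  qed
  from this[of True] have "f False 0 = f True 0" by simp
  then have "f b 0 = f b' 0" by (cases b; cases b') auto
  with const[of b v] const[of b' v'] show ?thesis by simp
qed

end

section \<open>The renewal equation with signs\<close>

text \<open>Helly's theorem asks for a uniform bound, so it is applied to \<open>arctan\<close> of
  the functions. It yields convergence at continuity points of the limit; the modulus
  \<open>m\<close>, which is independent of the location, carries convergence to all points.\<close>

lemma monotone_functions_convergent_subseq:
  fixes g :: "nat \<Rightarrow> real \<Rightarrow> real"
  assumes mono: "\<And>n. mono (g n)" and cont: "\<And>n. continuous_on UNIV (g n)"
    and bound: "\<And>n v. \<bar>g n v\<bar> \<le> K v"
    and equi: "\<And>u v. u \<le> v \<Longrightarrow> eventually (\<lambda>n. g n v - g n u \<le> m (v - u)) sequentially"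
    and m: "(m \<longlongrightarrow> 0) (at_right 0)"
  shows "\<exists>r. strict_mono (r :: nat \<Rightarrow> nat) \<and> (\<forall>v. convergent (\<lambda>n. g (r n) v))"
proof -
  have cont': "continuous (at_right x) (\<lambda>x. arctan (g n x))" for n x
    using cont[of n] by (intro continuous_intros)
      (auto simp: continuous_on_eq_continuous_within intro: continuous_within_subset)
  have mono': "mono (\<lambda>x. arctan (g n x))" for n
    using mono[of n] by (auto simp: mono_def arctan_le_iff)
  have bdd: "\<bar>arctan (g n x)\<bar> \<le> pi / 2" for n x
    using arctan_bounded[of "g n x"] by auto
  obtain r F where r: "strict_mono r" and F: "mono F"
    "\<And>x. continuous (at x) F \<Longrightarrow> (\<lambda>n. arctan (g (r n) x)) \<longlonglongrightarrow> F x"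
    using Helly_selection[of "\<lambda>n x. arctan (g n x)" "pi/2", OF cont' mono' bdd] by blast
  have conv_at_cont: "convergent (\<lambda>n. g (r n) x)" if "continuous (at x) F" for x
  proof -
    have lim: "(\<lambda>n. arctan (g (r n) x)) \<longlonglongrightarrow> F x" by (rule F(2)[OF that])
    \<comment> \<open>The pointwise bound \<open>K\<close> keeps the limit strictly inside the range
      of \<open>arctan\<close>, where \<open>tan\<close> is continuous and undoes it.\<close>
    have 1: "arctan (g n x) \<le> arctan (K x)" for n
      using bound[of n x] unfolding arctan_le_iff by linarith
    have 2: "- arctan (K x) \<le> arctan (g n x)" for n
      using bound[of n x] arctan_minus[of "K x"] arctan_le_iff[of "- K x" "g n x"] by linarith
    have "F x \<le> arctan (K x)" by (rule LIMSEQ_le_const2[OF lim]) (use 1 in auto)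
    moreover have "- arctan (K x) \<le> F x" by (rule LIMSEQ_le_const[OF lim]) (use 2 in auto)
    ultimately have "- (pi / 2) < F x" "F x < pi / 2"
      using arctan_bounded[of "K x"] by auto
    then have "cos (F x) \<noteq> 0" using cos_gt_zero_pi[of "F x"] by simp
    from isCont_tendsto_compose[OF isCont_tan[OF this] lim] show ?thesis
      by (simp add: tan_arctan convergent_def) blast
  qed
  have "Cauchy (\<lambda>n. g (r n) v)" for v
  proof (rule metric_CauchyI)
    fix e :: real assume e: "e > 0"
    have "eventually (\<lambda>h. m h < e / 3) (at_right 0)"
      by (rule order_tendstoD(2)[OF m]) (use e in simp)
    then obtain d where d: "d > 0" "\<And>h. 0 < h \<Longrightarrow> h < d \<Longrightarrow> m h < e / 3"
      by (auto simp: eventually_at_right_field)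
    \<comment> \<open>A monotone \<open>F\<close> has countably many discontinuities, so a
      continuity point lies just to the left of \<open>v\<close>; for large \<open>n\<close> the
      modulus bounds the change from \<open>u\<close> to \<open>v\<close>.\<close>
    obtain u where u: "v - d < u" "u < v" "isCont F u"
      using open_minus_countable[OF mono_ctble_discont[OF F(1)], of "{v - d<..<v}"] d(1) by auto
    have ev: "eventually (\<lambda>n. g (r n) v - g (r n) u \<le> m (v - u)) sequentially"
      using equi[of u v] u r by (auto intro: eventually_subseq)
    have "Cauchy (\<lambda>n. g (r n) u)" using conv_at_cont[OF u(3)] by (rule convergent_Cauchy)
    then obtain M where M: "\<And>n k. n \<ge> M \<Longrightarrow> k \<ge> M \<Longrightarrow> dist (g (r n) u) (g (r k) u) < e / 3"
      using e by (metis metric_CauchyD divide_pos_pos zero_less_numeral)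
    obtain M' where M': "\<And>n. n \<ge> M' \<Longrightarrow> g (r n) v - g (r n) u < e / 3"
      using ev d(2)[of "v - u"] u unfolding eventually_sequentially by force
    have "dist (g (r n) v) (g (r k) v) < e" if "n \<ge> max M M'" "k \<ge> max M M'" for n k
    proof -
      have "g (r n) u \<le> g (r n) v" "g (r k) u \<le> g (r k) v" using mono u(2) by (auto simp: mono_def)
      moreover have "dist (g (r n) u) (g (r k) u) < e / 3" using that by (intro M) auto
      moreover have "g (r n) v - g (r n) u < e / 3" "g (r k) v - g (r k) u < e / 3"
        using M'[of n] M'[of k] that by simp_all
      ultimately show ?thesis unfolding dist_real_def by linarith
    qed
    then show "\<exists>M. \<forall>n\<ge>M. \<forall>k\<ge>M. dist (g (r n) v) (g (r k) v) < e" by blast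
  qed
  then show ?thesis using r Cauchy_convergent by blast
qed

text \<open>Both \<open>n * f x\<close> and \<open>n * (f 1 * x)\<close> lie between consecutive
  integer multiples of \<open>f 1\<close>, so they differ by at most \<open>f 1\<close> for every
  \<open>n\<close>.\<close>

lemma mono_additive_linear:
  fixes f :: "real \<Rightarrow> real"
  assumes mono: "mono f" and add: "\<And>x y. f (x + y) = f x + f y"
  shows "f x = f 1 * x"
proof -
  have f0: "f 0 = 0" using add[of 0 0] by simp
  have nat: "f (of_nat n * y) = of_nat n * f y" for n y
    by (induction n) (auto simp: f0 algebra_simps add)
  have neg: "f (- y) = - f y" for y using add[of y "- y"] f0 by simp
  have int: "f (of_int k) = of_int k * f 1" for k :: int
    by (cases k rule: int_cases2) (use nat[of _ 1] neg in auto)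
  have f1: "f 1 \<ge> 0" using monoD[OF mono, of 0 1] f0 by simp
  have "of_nat n * \<bar>f x - f 1 * x\<bar> \<le> f 1" for n
  proof -
    let ?k = "\<lfloor>of_nat n * x\<rfloor>"
    have "f (of_int ?k) \<le> f (of_nat n * x)" by (rule monoD[OF mono]) simp
    then have 1: "of_int ?k * f 1 \<le> of_nat n * f x" unfolding nat int .
    have "f (of_nat n * x) \<le> f (of_int (?k + 1))" by (rule monoD[OF mono]) linarith
    then have 2: "of_nat n * f x \<le> of_int ?k * f 1 + f 1" unfolding nat int by (simp add: algebra_simps)
    have 3: "of_int ?k * f 1 \<le> of_nat n * x * f 1" by (intro mult_right_mono f1) simp
    have "of_nat n * x * f 1 \<le> (of_int ?k + 1) * f 1" by (intro mult_right_mono f1) linarith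
    then have 4: "of_nat n * x * f 1 \<le> of_int ?k * f 1 + f 1" by (simp add: algebra_simps)
    have "\<bar>of_nat n * f x - of_nat n * x * f 1\<bar> \<le> f 1" using 1 2 3 4 by linarith
    moreover have "of_nat n * f x - of_nat n * x * f 1 = of_nat n * (f x - f 1 * x)" by (simp add: algebra_simps)
    ultimately show ?thesis by (simp add: abs_mult)
  qed
  then have "\<not> \<bar>f x - f 1 * x\<bar> > 0"
    using ex_less_of_nat_mult[of "\<bar>f x - f 1 * x\<bar>" "f 1"] by (meson not_le)
  then show ?thesis by simp
qed

section \<open>Limits of normalised increments\<close>

text \<open>\<open>V_ge\<close> and \<open>V_le\<close> are the integrated form of
  \<open>V' = \<alpha> * w\<close> with \<open>exp (- \<alpha> * s) * w b s\<close> nonincreasing,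
  as for a tail probability, so that \<open>w\<close> controls the increments of \<open>V\<close>
  from both sides. The locale is instantiated with the tilted measure, \<open>X = ln |A|\<close> and
  \<open>S\<close> the event \<open>A < 0\<close>.\<close>

locale signed_renewal = prob_space M for M :: "'a measure" +
  fixes X :: "'a \<Rightarrow> real" and S :: "'a \<Rightarrow> bool" and V w G :: "bool \<Rightarrow> real \<Rightarrow> real"
    and \<alpha> \<delta> \<rho> :: real
  assumes X_meas [measurable]: "X \<in> borel_measurable M"
    and S_meas [measurable]: "Measurable.pred M S"
    and nonarith: "\<And>d. d > 0 \<Longrightarrow> \<not> (AE \<omega> in M. \<exists>k::int. X \<omega> = d * of_int k)"
    and flip: "\<not> (AE \<omega> in M. \<not> S \<omega>)"
    and \<alpha>_pos: "\<alpha> > 0" and \<delta>_pos: "\<delta> > 0" and \<rho>_pos: "\<rho> > 0"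
    and exp_int: "integrable M (\<lambda>\<omega>. exp (\<delta> * \<bar>X \<omega>\<bar>))"
    and drift: "(\<integral>\<omega>. X \<omega> \<partial>M) = \<rho>"
    and V_ge: "\<And>b s t. s \<le> t \<Longrightarrow> w b t * (1 - exp (- (\<alpha> * (t - s)))) \<le> V b t - V b s"
    and V_le: "\<And>b s t. s \<le> t \<Longrightarrow> V b t - V b s \<le> w b s * (exp (\<alpha> * (t - s)) - 1)"
    and w_nonneg: "\<And>b s. 0 \<le> w b s"
    and V_int: "\<And>b s. integrable M (\<lambda>\<omega>. V (b \<noteq> S \<omega>) (s - X \<omega>))"
    and renewal: "\<And>b s. V b s = (\<integral>\<omega>. V (b \<noteq> S \<omega>) (s - X \<omega>) \<partial>M) + G b s"
begin

lemma V_mono: "mono (V b)"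
proof (rule monoI)
  fix s t :: real assume st: "s \<le> t"
  have "0 \<le> w b t * (1 - exp (- (\<alpha> * (t - s))))"
    using st \<alpha>_pos by (intro mult_nonneg_nonneg w_nonneg) simp
  with V_ge[OF st, of b] show "V b s \<le> V b t" by linarith
qed

text \<open>A single use of \<open>V_le\<close> would cost \<open>exp (\<alpha> * (t - s))\<close>,
  which the exponential moment of order \<delta> in \<open>exp_int\<close> need not control. Cutting
  the interval into pieces of length at most 1 makes the cost linear in the length.\<close>

lemma V_increment_le:
  assumes K: "\<And>u. s \<le> u \<Longrightarrow> u \<le> t \<Longrightarrow> w b u \<le> K" and "K \<ge> 0" and st: "s \<le> t"
  shows "V b t - V b s \<le> K * (t - s + 1) * (exp \<alpha> - 1)"
proof -
  have e: "exp \<alpha> - 1 \<ge> 0" using \<alpha>_pos by simp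
  have unit: "V b v - V b u \<le> K * (exp \<alpha> - 1)" if "s \<le> u" "u \<le> v" "v \<le> t" "v \<le> u + 1" for u v
  proof -
    have "V b v - V b u \<le> w b u * (exp (\<alpha> * (v - u)) - 1)" by (rule V_le) fact
    also have "\<dots> \<le> K * (exp \<alpha> - 1)"
      using that \<alpha>_pos assms(2) w_nonneg K[of u] by (intro mult_mono) auto
    finally show ?thesis .
  qed
  have *: "V b v - V b s \<le> real n * (K * (exp \<alpha> - 1))" if "s \<le> v" "v \<le> t" "v \<le> s + real n" for n v
    using that
  proof (induction n arbitrary: v)
    case 0
    then have "v = s" by simp
    then show ?case by simp
  next
    case (Suc n)
    define u where "u = max s (v - 1)"
    have "V b v - V b u \<le> K * (exp \<alpha> - 1)" using Suc.prems by (intro unit) (auto simp: u_def)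
    moreover have "V b u - V b s \<le> real n * (K * (exp \<alpha> - 1))"
      using Suc.prems by (intro Suc.IH) (auto simp: u_def)
    ultimately show ?case by (simp add: algebra_simps)
  qed
  have "V b t - V b s \<le> real (nat \<lceil>t - s\<rceil>) * (K * (exp \<alpha> - 1))"
    by (rule *) (use st in \<open>linarith+\<close>)
  also have "\<dots> \<le> (t - s + 1) * (K * (exp \<alpha> - 1))"
    using st e assms(2) by (intro mult_right_mono) (linarith, simp)
  finally show ?thesis by (simp add: algebra_simps)
qed

text \<open>
  The normalisation \<open>N\<close> is free because the lemma serves twice: with \<open>c = 0\<close> and \<open>N\<close> the solution
  itself to bound its growth, and with \<open>c = 1\<close> and \<open>N\<close> the growth of \<open>G\<close> to find the limit.
\<close>

lemma convergent_increments:
  fixes s N :: "nat \<Rightarrow> real"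
  assumes N: "\<And>n. N n > 0"
    and \<beta>: "0 < \<beta>" "\<beta> < \<delta>"
    and w_bound: "\<And>n b v. w b (s n + v) \<le> N n * C * exp (\<beta> * \<bar>v\<bar>)"
    and w_ev: "\<And>b v. eventually (\<lambda>n. w b (s n + v) \<le> D * N n) sequentially"
    and G_diff: "\<And>b v. (\<lambda>n. (G b (s n + v) - G b (s n)) / N n) \<longlonglongrightarrow> 0"
    and G_sum: "(\<lambda>n. (G True (s n) + G False (s n)) / N n) \<longlonglongrightarrow> c"
  shows "\<exists>r. strict_mono (r :: nat \<Rightarrow> nat) \<and>
    (\<forall>b v. (\<lambda>n. (V b (s (r n) + v) - V b (s (r n))) / N (r n)) \<longlonglongrightarrow> c * v / (2 * \<rho>))"
proof -
  define g where "g b n v = (V b (s n + v) - V b (s n)) / N n" for b n v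
  have e: "exp \<alpha> - 1 \<ge> 0" using \<alpha>_pos by simp
  have C: "C \<ge> 0"
  proof -
    have "0 \<le> N 0 * C * exp (\<beta> * \<bar>0\<bar>)" using w_bound[of True 0 0] w_nonneg[of True "s 0 + 0"] by linarith
    then show ?thesis using N[of 0] by (simp add: zero_le_mult_iff)
  qed
  have g_mono: "mono (g b n)" for b n
    using V_mono[of b] N[of n] by (auto simp: g_def mono_def intro!: divide_right_mono)
  have g0: "g b n 0 = 0" for b n by (simp add: g_def)
  have g_le: "g b n v - g b n u \<le> w b (s n + u) / N n * (exp (\<alpha> * (v - u)) - 1)" if "u \<le> v" for b n u v
  proof -
    have "g b n v - g b n u = (V b (s n + v) - V b (s n + u)) / N n"
      by (simp add: g_def diff_divide_distrib)
    also have "\<dots> \<le> (w b (s n + u) * (exp (\<alpha> * ((s n + v) - (s n + u))) - 1)) / N n"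
      using that N[of n] by (intro divide_right_mono V_le) auto
    finally show ?thesis by simp
  qed
  have cont: "continuous_on UNIV (g b n)" for b n
  proof -
    have local: "\<bar>g b n v - g b n u\<bar> \<le> C * exp (\<beta> * (\<bar>u\<bar> + 1)) * (exp (\<alpha> * \<bar>v - u\<bar>) - 1)" if "\<bar>v - u\<bar> \<le> 1" for u v
    proof -
      have 1: "g b n y - g b n x \<le> C * exp (\<beta> * (\<bar>u\<bar> + 1)) * (exp (\<alpha> * (y - x)) - 1)"
        if "x \<le> y" "\<bar>x - u\<bar> \<le> 1" for x y
      proof -
        have "g b n y - g b n x \<le> w b (s n + x) / N n * (exp (\<alpha> * (y - x)) - 1)" by (rule g_le) fact
        also have "\<dots> \<le> C * exp (\<beta> * (\<bar>u\<bar> + 1)) * (exp (\<alpha> * (y - x)) - 1)"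
        proof (intro mult_right_mono)
          have "w b (s n + x) / N n \<le> C * exp (\<beta> * \<bar>x\<bar>)"
            using w_bound[of b n x] N[of n] by (simp add: field_simps)
          also have "\<dots> \<le> C * exp (\<beta> * (\<bar>u\<bar> + 1))"
            using that C \<beta> by (intro mult_left_mono) auto
          finally show "w b (s n + x) / N n \<le> C * exp (\<beta> * (\<bar>u\<bar> + 1))" .
        qed (use that \<alpha>_pos in auto)
        finally show ?thesis .
      qed
      show ?thesis
      proof (cases "u \<le> v")
        case True
        then show ?thesis using 1[of u v] that monoD[OF g_mono, of u v b n] by auto
      next
        case False
        then show ?thesis using 1[of v u] that monoD[OF g_mono, of v u b n] by auto
      qed
    qed
    have "isCont (g b n) u" for u
    proof -
      have "((\<lambda>v. C * exp (\<beta> * (\<bar>u\<bar> + 1)) * (exp (\<alpha> * \<bar>v - u\<bar>) - 1)) \<longlongrightarrow> C * exp (\<beta> * (\<bar>u\<bar> + 1)) * (exp (\<alpha> * \<bar>u - u\<bar>) - 1)) (at u)"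
        by (intro tendsto_intros)
      then have "((\<lambda>v. C * exp (\<beta> * (\<bar>u\<bar> + 1)) * (exp (\<alpha> * \<bar>v - u\<bar>) - 1)) \<longlongrightarrow> 0) (at u)" by simp
      moreover have "eventually (\<lambda>v. norm (g b n v - g b n u) \<le> C * exp (\<beta> * (\<bar>u\<bar> + 1)) * (exp (\<alpha> * \<bar>v - u\<bar>) - 1)) (at u)"
        unfolding eventually_at by (intro exI[of _ 1]) (use local in \<open>auto simp: dist_real_def\<close>)
      ultimately have "((\<lambda>v. g b n v - g b n u) \<longlongrightarrow> 0) (at u)" by (rule Lim_null_comparison[rotated])
      then show ?thesis by (simp add: isCont_def LIM_zero_iff)
    qed
    then show ?thesis by (simp add: continuous_on_eq_continuous_at)
  qed
  \<comment> \<open>The term \<open>1 / (\<delta> - \<beta>) + 1\<close> absorbs the linear factor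
    of \<open>V_increment_le\<close> into \<open>exp ((\<delta> - \<beta>) * |v|)\<close>. This
    raises the rate from \<beta> to \<delta>, for which \<open>exp_int\<close> supplies an
    integrable majorant.\<close>
  define K where "K = C * (exp \<alpha> - 1) * (1 / (\<delta> - \<beta>) + 1)"
  have K: "K \<ge> 0" using C e \<beta> by (simp add: K_def)
  have g_bound: "\<bar>g b n v\<bar> \<le> K * exp (\<delta> * \<bar>v\<bar>)" for b n v
  proof -
    have a: "V b (s n + max 0 v) - V b (s n + min 0 v) \<le> N n * C * exp (\<beta> * \<bar>v\<bar>) * ((s n + max 0 v) - (s n + min 0 v) + 1) * (exp \<alpha> - 1)"
    proof (rule V_increment_le)
      fix u assume u: "s n + min 0 v \<le> u" "u \<le> s n + max 0 v"
      have "w b u \<le> N n * C * exp (\<beta> * \<bar>u - s n\<bar>)" using w_bound[of b n "u - s n"] by simp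
      also have "\<dots> \<le> N n * C * exp (\<beta> * \<bar>v\<bar>)"
      proof (intro mult_left_mono)
        have "\<bar>u - s n\<bar> \<le> \<bar>v\<bar>" using u by linarith
        then show "exp (\<beta> * \<bar>u - s n\<bar>) \<le> exp (\<beta> * \<bar>v\<bar>)" using \<beta> by simp
      qed (use N[of n] C in auto)
      finally show "w b u \<le> N n * C * exp (\<beta> * \<bar>v\<bar>)" .
    qed (use N[of n] C in auto)
    have "\<bar>g b n v\<bar> = (V b (s n + max 0 v) - V b (s n + min 0 v)) / N n"
      using monoD[OF V_mono, of "s n" "s n + v" b] monoD[OF V_mono, of "s n + v" "s n" b] N[of n]
      by (cases "v \<ge> 0") (auto simp: g_def max_def min_def abs_if field_simps)
    also have "\<dots> \<le> (N n * C * exp (\<beta> * \<bar>v\<bar>) * ((s n + max 0 v) - (s n + min 0 v) + 1) * (exp \<alpha> - 1)) / N n"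
      using a N[of n] by (intro divide_right_mono) auto
    also have "\<dots> = C * (exp \<alpha> - 1) * exp (\<beta> * \<bar>v\<bar>) * ((s n + max 0 v) - (s n + min 0 v) + 1)"
      using N[of n] by simp
    also have "(s n + max 0 v) - (s n + min 0 v) = \<bar>v\<bar>" by auto
    also have "C * (exp \<alpha> - 1) * exp (\<beta> * \<bar>v\<bar>) * (\<bar>v\<bar> + 1) \<le> C * (exp \<alpha> - 1) * exp (\<beta> * \<bar>v\<bar>) * ((1 / (\<delta> - \<beta>) + 1) * exp ((\<delta> - \<beta>) * \<bar>v\<bar>))"
    proof (intro mult_left_mono)
      have "(\<delta> - \<beta>) * \<bar>v\<bar> \<le> exp ((\<delta> - \<beta>) * \<bar>v\<bar>)" using exp_ge_add_one_self[of "(\<delta> - \<beta>) * \<bar>v\<bar>"] by linarith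
      then have "\<bar>v\<bar> \<le> 1 / (\<delta> - \<beta>) * exp ((\<delta> - \<beta>) * \<bar>v\<bar>)" using \<beta> by (simp add: field_simps)
      moreover have "1 \<le> exp ((\<delta> - \<beta>) * \<bar>v\<bar>)" using \<beta> by simp
      ultimately show "\<bar>v\<bar> + 1 \<le> (1 / (\<delta> - \<beta>) + 1) * exp ((\<delta> - \<beta>) * \<bar>v\<bar>)"
        unfolding distrib_right by linarith
    qed (use C e in auto)
    also have "\<dots> = K * (exp (\<beta> * \<bar>v\<bar>) * exp ((\<delta> - \<beta>) * \<bar>v\<bar>))" by (simp add: K_def)
    also have "exp (\<beta> * \<bar>v\<bar>) * exp ((\<delta> - \<beta>) * \<bar>v\<bar>) = exp (\<delta> * \<bar>v\<bar>)"
      by (simp add: exp_add[symmetric] algebra_simps)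
    finally show ?thesis .
  qed
  \<comment> \<open>The bound \<open>w_bound\<close> degrades with the distance from
    \<open>s n\<close>, so the modulus comes from \<open>w_ev\<close>: its constant \<open>D\<close>
    is the same at all positions, although the index from which it holds is not. It also makes
    increments of the limit bounded.\<close>
  have equi: "eventually (\<lambda>n. g b n v - g b n u \<le> D * (exp (\<alpha> * (v - u)) - 1)) sequentially" if "u \<le> v" for b u v
    using w_ev[of b u]
  proof eventually_elim
    case (elim n)
    have "g b n v - g b n u \<le> w b (s n + u) / N n * (exp (\<alpha> * (v - u)) - 1)" by (rule g_le) fact
    also have "\<dots> \<le> D * (exp (\<alpha> * (v - u)) - 1)"
      using elim N[of n] that \<alpha>_pos by (intro mult_right_mono) (auto simp: field_simps)
    finally show ?case .
  qed
  have m: "((\<lambda>h. D * (exp (\<alpha> * h) - 1)) \<longlongrightarrow> 0) (at_right 0)"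
  proof -
    have "((\<lambda>h. D * (exp (\<alpha> * h) - 1)) \<longlongrightarrow> D * (exp (\<alpha> * 0) - 1)) (at_right 0)" by (intro tendsto_intros)
    then show ?thesis by simp
  qed
  obtain r1 where r1: "strict_mono r1" "\<And>v. convergent (\<lambda>n. g True (r1 n) v)"
    using monotone_functions_convergent_subseq[where g="g True" and m="\<lambda>h. D * (exp (\<alpha> * h) - 1)",
        OF g_mono cont g_bound equi m] by blast
  obtain r2 where r2: "strict_mono r2" "\<And>v. convergent (\<lambda>n. g False (r1 (r2 n)) v)"
    using monotone_functions_convergent_subseq[where g="\<lambda>n. g False (r1 n)" and m="\<lambda>h. D * (exp (\<alpha> * h) - 1)",
        OF g_mono cont g_bound eventually_subseq[OF r1(1) equi] m] by blast
  define r where "r = (\<lambda>n. r1 (r2 n))"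
  have r: "strict_mono r" using r1(1) r2(1) by (simp add: r_def strict_mono_def)
  have "convergent (\<lambda>n. g b (r n) v)" for b v
  proof (cases b)
    case True
    have "convergent ((\<lambda>n. g True (r1 n) v) \<circ> r2)" by (rule convergent_subseq_convergent[OF r1(2) r2(1)])
    then show ?thesis using True by (simp add: r_def o_def)
  qed (use r2(2) in \<open>simp add: r_def\<close>)
  then obtain \<Delta> where lim: "(\<lambda>n. g b (r n) v) \<longlonglongrightarrow> \<Delta> b v" for b v
    unfolding convergent_def by metis
  have \<Delta>0: "\<Delta> b 0 = 0" for b
    using lim[of b 0] by (simp add: g0 LIMSEQ_const_iff)
  have \<Delta>_mono: "mono (\<Delta> b)" for b
  proof (rule monoI)
    fix u v :: real assume "u \<le> v"
    then have "g b (r n) u \<le> g b (r n) v" for n by (rule monoD[OF g_mono])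
    then show "\<Delta> b u \<le> \<Delta> b v" by (intro LIMSEQ_le[OF lim lim]) auto
  qed
  have \<Delta>_meas [measurable]: "\<Delta> b \<in> borel_measurable borel" for b
    by (rule borel_measurable_mono[OF \<Delta>_mono])
  have \<Delta>_le: "\<Delta> b v - \<Delta> b u \<le> D * (exp (\<alpha> * (v - u)) - 1)" if "u \<le> v" for b u v
    using tendsto_diff[OF lim[of b v] lim[of b u]] eventually_subseq[OF r equi[OF that, of b]]
    by (intro tendsto_le[OF _ tendsto_const]) auto
  have g_meas [measurable]: "g b n \<in> borel_measurable borel" for b n
    by (rule borel_measurable_mono[OF g_mono])
  let ?g = "\<lambda>b n v \<omega>. g (b \<noteq> S \<omega>) n (v - X \<omega>)"
  let ?D = "\<lambda>b v \<omega>. \<Delta> (b \<noteq> S \<omega>) (v - X \<omega>)"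
  let ?d = "\<lambda>v \<omega>. K * exp (\<delta> * \<bar>v\<bar>) * exp (\<delta> * \<bar>X \<omega>\<bar>)"
  have dom: "\<bar>?g b n v \<omega>\<bar> \<le> ?d v \<omega>" for b n v \<omega>
  proof -
    have "\<bar>?g b n v \<omega>\<bar> \<le> K * exp (\<delta> * \<bar>v - X \<omega>\<bar>)" by (rule g_bound)
    also have "\<dots> \<le> K * exp (\<delta> * \<bar>v\<bar> + \<delta> * \<bar>X \<omega>\<bar>)"
    proof (intro mult_left_mono K)
      have "\<delta> * \<bar>v - X \<omega>\<bar> \<le> \<delta> * (\<bar>v\<bar> + \<bar>X \<omega>\<bar>)" using \<delta>_pos by (intro mult_left_mono) auto
      then show "exp (\<delta> * \<bar>v - X \<omega>\<bar>) \<le> exp (\<delta> * \<bar>v\<bar> + \<delta> * \<bar>X \<omega>\<bar>)" by (simp add: algebra_simps)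
    qed
    finally show ?thesis by (simp add: exp_add)
  qed
  have m1 [measurable]: "(\<lambda>\<omega>. ?g b n v \<omega>) \<in> borel_measurable M" for b n v
    by (rule measurable_shift_flip[of "\<lambda>b. g b n", OF g_meas]; measurable)
  have m2 [measurable]: "(\<lambda>\<omega>. ?D b v \<omega>) \<in> borel_measurable M" for b v
    by (rule measurable_shift_flip[of \<Delta>, OF \<Delta>_meas]; measurable)
  have dom_int: "integrable M (\<lambda>\<omega>. ?d v \<omega>)" for v
    using exp_int by simp
  have g_int: "integrable M (\<lambda>\<omega>. ?g b n v \<omega>)" for b n v
    by (rule Bochner_Integration.integrable_bound[OF dom_int[of v] m1]) (unfold real_norm_def, rule AE_I2, rule order_trans[OF dom abs_ge_self])
  have \<Delta>_int: "integrable M (\<lambda>\<omega>. ?D b v \<omega>)" for b v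
    by (rule integrable_dominated_convergence[where w="\<lambda>\<omega>. ?d v \<omega>"
          and s="\<lambda>n \<omega>. ?g b (r n) v \<omega>"])
      (use lim dom dom_int in auto)
  have int_lim: "(\<lambda>n. \<integral>\<omega>. ?g b (r n) v \<omega> \<partial>M) \<longlonglongrightarrow> (\<integral>\<omega>. ?D b v \<omega> \<partial>M)" for b v
    by (rule integral_dominated_convergence[where w="\<lambda>\<omega>. ?d v \<omega>"])
      (use lim dom dom_int in auto)
  have g_int_eq: "(\<integral>\<omega>. ?g b n v \<omega> \<partial>M)
      = ((\<integral>\<omega>. V (b \<noteq> S \<omega>) (s n + v - X \<omega>) \<partial>M) - (\<integral>\<omega>. V (b \<noteq> S \<omega>) (s n) \<partial>M)) / N n" 
    and Vc_int: "integrable M (\<lambda>\<omega>. V (b \<noteq> S \<omega>) (s n))" for b n v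
  proof -
    show Vc: "integrable M (\<lambda>\<omega>. V (b \<noteq> S \<omega>) (s n))"
    proof (rule integrable_const_bound)
      show "AE \<omega> in M. norm (V (b \<noteq> S \<omega>) (s n)) \<le> max \<bar>V True (s n)\<bar> \<bar>V False (s n)\<bar>"
      proof (rule AE_I2)
        fix \<omega> show "norm (V (b \<noteq> S \<omega>) (s n)) \<le> max \<bar>V True (s n)\<bar> \<bar>V False (s n)\<bar>"
          by (cases "b \<noteq> S \<omega>") auto
      qed
    qed (rule measurable_shift_flip[of V, OF borel_measurable_mono[OF V_mono]]; measurable)
    have "(\<integral>\<omega>. ?g b n v \<omega> \<partial>M)
      = (\<integral>\<omega>. (V (b \<noteq> S \<omega>) (s n + v - X \<omega>) - V (b \<noteq> S \<omega>) (s n)) / N n \<partial>M)"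
      by (intro Bochner_Integration.integral_cong refl) (simp add: g_def algebra_simps)
    then show "(\<integral>\<omega>. ?g b n v \<omega> \<partial>M)
      = ((\<integral>\<omega>. V (b \<noteq> S \<omega>) (s n + v - X \<omega>) \<partial>M) - (\<integral>\<omega>. V (b \<noteq> S \<omega>) (s n) \<partial>M)) / N n"
      using V_int Vc by simp
  qed
  \<comment> \<open>Increments are measured from 0 for each sign separately, so
    \<open>\<Delta> b\<close> is harmonic only up to an additive constant depending on
    \<open>b\<close>. The constant cancels in
    \<open>\<Delta> b (v + h) - \<Delta> b v\<close>.\<close>
  have \<Delta>_eq: "\<Delta> b v = (\<integral>\<omega>. ?D b v \<omega> \<partial>M) - (\<integral>\<omega>. ?D b 0 \<omega> \<partial>M)" for b v
  proof -
    have eq: "g b n v = (\<integral>\<omega>. ?g b n v \<omega> \<partial>M) - (\<integral>\<omega>. ?g b n 0 \<omega> \<partial>M)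
        + (G b (s n + v) - G b (s n)) / N n" for n
      unfolding g_int_eq using renewal[of b "s n + v"] renewal[of b "s n"] N[of n]
      by (simp add: g_def field_simps)
    have "(\<lambda>n. g b (r n) v) \<longlonglongrightarrow> (\<integral>\<omega>. ?D b v \<omega> \<partial>M) - (\<integral>\<omega>. ?D b 0 \<omega> \<partial>M) + 0"
      unfolding eq
      using LIMSEQ_subseq_LIMSEQ[OF G_diff[of b v] r]
      by (intro tendsto_add tendsto_diff int_lim) (simp add: o_def)
    then show ?thesis using LIMSEQ_unique[OF lim] by simp
  qed
  have const: "\<Delta> b (v + h) - \<Delta> b v = \<Delta> b' (v' + h) - \<Delta> b' v'" if h: "h \<ge> 0" for h b v b' v'
  proof (rule Choquet_Deny_signed[OF X_meas S_meas _ _ _ nonarith flip, where f="\<lambda>b v. \<Delta> b (v + h) - \<Delta> b v"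
        and C="D * (exp (\<alpha> * h) - 1)"])
    have cont: "continuous_on UNIV (\<Delta> b)" for b
    proof -
      have "isCont (\<Delta> b) u" for u
      proof -
        have "((\<lambda>v. D * (exp (\<alpha> * \<bar>v - u\<bar>) - 1)) \<longlongrightarrow> D * (exp (\<alpha> * \<bar>u - u\<bar>) - 1)) (at u)"
          by (intro tendsto_intros)
        then have "((\<lambda>v. D * (exp (\<alpha> * \<bar>v - u\<bar>) - 1)) \<longlongrightarrow> 0) (at u)" by simp
        moreover have "norm (\<Delta> b v - \<Delta> b u) \<le> D * (exp (\<alpha> * \<bar>v - u\<bar>) - 1)" for v
          using \<Delta>_le[of u v b] \<Delta>_le[of v u b] monoD[OF \<Delta>_mono, of u v b] monoD[OF \<Delta>_mono, of v u b]
          by (cases "u \<le> v") auto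
        then have "eventually (\<lambda>v. norm (\<Delta> b v - \<Delta> b u) \<le> D * (exp (\<alpha> * \<bar>v - u\<bar>) - 1)) (at u)" by simp
        ultimately have "((\<lambda>v. \<Delta> b v - \<Delta> b u) \<longlongrightarrow> 0) (at u)" by (rule Lim_null_comparison[rotated])
        then show ?thesis by (simp add: isCont_def LIM_zero_iff)
      qed
      then show ?thesis by (simp add: continuous_on_eq_continuous_at)
    qed
    show "continuous_on UNIV (\<lambda>v. \<Delta> b (v + h) - \<Delta> b v)" for b
      by (intro continuous_intros continuous_on_compose2[OF cont]) auto
    show "\<bar>\<Delta> b (v + h) - \<Delta> b v\<bar> \<le> D * (exp (\<alpha> * h) - 1)" for b v
      using \<Delta>_le[of v "v + h" b] h monoD[OF \<Delta>_mono, of v "v + h" b] by simp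
    show "\<Delta> b (v + h) - \<Delta> b v = (\<integral>\<omega>. \<Delta> (b \<noteq> S \<omega>) (v - X \<omega> + h) - ?D b v \<omega> \<partial>M)" for b v
    proof -
      have eqf: "v - x + h = (v + h) - x" for x by simp
      show ?thesis unfolding eqf Bochner_Integration.integral_diff[OF \<Delta>_int \<Delta>_int]
        using \<Delta>_eq[of b "v + h"] \<Delta>_eq[of b v] by linarith
    qed
  qed
  have \<Delta>_add: "\<Delta> b (x + y) = \<Delta> b x + \<Delta> b y" for b x y
  proof (cases "y \<ge> 0")
    case True
    from const[OF this, of b x b 0] show ?thesis by (simp add: \<Delta>0)
  next
    case False
    then have "- y \<ge> 0" by simp
    from const[OF this, of b "x + y" b y] show ?thesis by (simp add: \<Delta>0)
  qed
  define \<kappa> where "\<kappa> = \<Delta> True 1"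
  have \<Delta>_lin: "\<Delta> b v = \<kappa> * v" for b v
  proof -
    have "\<Delta> b 1 = \<kappa>" using const[of 1 b 0 True 0] by (simp add: \<kappa>_def \<Delta>0)
    then show ?thesis using mono_additive_linear[OF \<Delta>_mono \<Delta>_add, of b v] by simp
  qed
  \<comment> \<open>Adding the equations of both signs removes the values \<open>V b (s n)\<close>,
    because a sign flip only permutes them (\<open>sum\<close>). What remains equates the sum of the
    \<open>G\<close> terms with minus the mean of \<open>?g\<close> at \<open>v = 0\<close> over
    both signs; the limit of \<open>?g\<close> there is \<open>- \<kappa> * X\<close>, of mean
    \<open>- \<kappa> * \<rho>\<close>.\<close>
  have "2 * \<kappa> * \<rho> = c"
  proof -
    have sum: "(\<integral>\<omega>. V (True \<noteq> S \<omega>) (s n) \<partial>M) + (\<integral>\<omega>. V (False \<noteq> S \<omega>) (s n) \<partial>M) = V True (s n) + V False (s n)" for n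
    proof -
      have "(\<integral>\<omega>. V (True \<noteq> S \<omega>) (s n) \<partial>M) + (\<integral>\<omega>. V (False \<noteq> S \<omega>) (s n) \<partial>M)
        = (\<integral>\<omega>. V (True \<noteq> S \<omega>) (s n) + V (False \<noteq> S \<omega>) (s n) \<partial>M)"
        by (rule Bochner_Integration.integral_add[symmetric]; rule Vc_int)
      also have "\<dots> = (\<integral>\<omega>. V True (s n) + V False (s n) \<partial>M)"
      proof (intro Bochner_Integration.integral_cong refl)
        fix \<omega> show "V (True \<noteq> S \<omega>) (s n) + V (False \<noteq> S \<omega>) (s n) = V True (s n) + V False (s n)"
          by (cases "S \<omega>") auto
      qed
      finally show ?thesis by (simp add: prob_space)
    qed
    have "(G True (s n) + G False (s n)) / N n = - ((\<integral>\<omega>. ?g True n 0 \<omega> \<partial>M) + (\<integral>\<omega>. ?g False n 0 \<omega> \<partial>M))" for n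
    proof -
      have "(\<integral>\<omega>. ?g True n 0 \<omega> \<partial>M) + (\<integral>\<omega>. ?g False n 0 \<omega> \<partial>M)
        = ((\<integral>\<omega>. V (True \<noteq> S \<omega>) (s n + 0 - X \<omega>) \<partial>M) + (\<integral>\<omega>. V (False \<noteq> S \<omega>) (s n + 0 - X \<omega>) \<partial>M)
          - ((\<integral>\<omega>. V (True \<noteq> S \<omega>) (s n) \<partial>M) + (\<integral>\<omega>. V (False \<noteq> S \<omega>) (s n) \<partial>M))) / N n"
        unfolding g_int_eq add_divide_distrib[symmetric] by (simp add: algebra_simps)
      also have "\<dots> = - ((G True (s n) + G False (s n)) / N n)"
      proof -
        have add0: "s n + 0 - x = s n - x" for x by simp
        show ?thesis
          unfolding sum add0 minus_divide_left using renewal[of True "s n"] renewal[of False "s n"]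
          by (intro arg_cong2[where f="(/)"] refl) linarith
      qed
      finally show ?thesis by linarith
    qed
    then have "(\<lambda>n. (G True (s (r n)) + G False (s (r n))) / N (r n)) \<longlonglongrightarrow>
       - ((\<integral>\<omega>. ?D True 0 \<omega> \<partial>M) + (\<integral>\<omega>. ?D False 0 \<omega> \<partial>M))"
      by (simp only:) (intro tendsto_intros int_lim)
    moreover have "(\<lambda>n. (G True (s (r n)) + G False (s (r n))) / N (r n)) \<longlonglongrightarrow> c"
      using LIMSEQ_subseq_LIMSEQ[OF G_sum r] by (simp add: o_def)
    ultimately have "c = - ((\<integral>\<omega>. ?D True 0 \<omega> \<partial>M) + (\<integral>\<omega>. ?D False 0 \<omega> \<partial>M))"
      by (rule LIMSEQ_unique[rotated])
    then show ?thesis unfolding \<Delta>_lin using drift by simp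
  qed
  then have "\<kappa> * v = c * v / (2 * \<rho>)" for v
    using \<rho>_pos by (simp add: field_simps)
  then have "\<forall>b v. (\<lambda>n. (V b (s (r n) + v) - V b (s (r n))) / N (r n)) \<longlonglongrightarrow> c * v / (2 * \<rho>)"
    using lim unfolding g_def \<Delta>_lin by simp
  then show ?thesis using r by blast
qed

end

section \<open>Growth bound and asymptotics under slowly varying forcing\<close>

lemma exists_near_maximizer:
  fixes q :: "'b \<Rightarrow> real"
  assumes "\<And>y. q y \<le> B" and "q x0 > 0"
  shows "\<exists>x. q x > 0 \<and> (\<forall>y. q y \<le> 2 * q x)"
proof -
  define T where "T = (SUP y. q y)"
  have bdd: "bdd_above (range q)" using assms(1) by (auto simp: bdd_above_def)
  have le: "q y \<le> T" for y unfolding T_def by (rule cSUP_upper[OF _ bdd]) simp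
  have "T / 2 < T" using le[of x0] assms(2) by simp
  then obtain x where x: "T / 2 < q x"
    using less_cSUP_iff[OF UNIV_not_empty bdd, of "T / 2"] unfolding T_def by blast
  have "q x > 0" using x le[of x0] assms(2) by simp
  moreover have "q y \<le> 2 * q x" for y using le[of y] x by simp
  ultimately show ?thesis by blast
qed

text \<open>
  \<open>K\<close> bounds the deviation of \<open>G\<close> from a monotone function. The two growth bounds on \<open>w\<close> make
  \<open>w s * exp (- d * s)\<close> bounded for every small \<open>d > 0\<close>, so that it has near-maximisers.
\<close>

locale signed_renewal_slow = signed_renewal +
  fixes m :: "bool \<Rightarrow> real \<Rightarrow> real" and K :: real
  assumes m_mono: "\<And>b. mono (m b)" and m_nonneg: "\<And>b s. 0 \<le> m b s"
    and G_m: "\<And>b s. \<bar>G b s - m b s\<bar> \<le> K"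
    and l_slow: "\<And>h. h \<ge> 0 \<Longrightarrow>
      ((\<lambda>s. (1 + m True (s + h) + m False (s + h)) / (1 + m True s + m False s)) \<longlongrightarrow> 1) at_top"
    and l_inf: "filterlim (\<lambda>s. 1 + m True s + m False s) at_top at_top"
    and w_le: "\<And>b s. w b s \<le> exp (\<alpha> * s)"
    and w_small: "\<And>\<beta>. 0 < \<beta> \<Longrightarrow> \<beta> < \<alpha> \<Longrightarrow> \<exists>C. \<forall>b s. w b s \<le> C * exp (\<beta> * s)"
begin

definition l :: "real \<Rightarrow> real" where "l s = 1 + m True s + m False s"

lemma l_ge_1: "l s \<ge> 1"
  using m_nonneg[of True s] m_nonneg[of False s] by (simp add: l_def)

lemma l_pos [simp]: "l s > 0" using l_ge_1[of s] by simp

lemma l_neq_0 [simp]: "l s \<noteq> 0" using l_pos[of s] by linarith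

lemma l_mono: "s \<le> t \<Longrightarrow> l s \<le> l t"
  using monoD[OF m_mono, of s t] by (simp add: l_def add_mono)

lemma l_shift: "((\<lambda>s. l (s + v) / l s) \<longlongrightarrow> 1) at_top"
proof (cases "v \<ge> 0")
  case True
  from l_slow[OF this] show ?thesis by (simp add: l_def)
next
  case False
  then have "((\<lambda>s. l (s + (- v)) / l s) \<longlongrightarrow> 1) at_top"
    using l_slow[of "- v"] by (simp add: l_def)
  moreover have "filterlim (\<lambda>s. s + v) at_top at_top"
    unfolding filterlim_at_top
  proof
    fix Z :: real
    show "eventually (\<lambda>s. Z \<le> s + v) at_top"
      using eventually_ge_at_top[of "Z - v"] by eventually_elim simp
  qed
  ultimately have "((\<lambda>s. l ((s + v) + (- v)) / l (s + v)) \<longlongrightarrow> 1) at_top"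
    by (rule filterlim_compose)
  from tendsto_inverse[OF this] show ?thesis by simp
qed

text \<open>A Potter bound: the ratio over a unit shift is eventually below
  \<open>exp \<beta>\<close> and is iterated. Monotonicity of \<open>l\<close> handles fractional
  and negative shifts, and rounding \<open>|v|\<close> up costs the factor
  \<open>exp \<beta>\<close>.\<close>

lemma l_Potter:
  assumes "\<beta> > 0"
  shows "\<exists>s0. \<forall>s\<ge>s0. \<forall>v. l (s + v) \<le> exp \<beta> * exp (\<beta> * \<bar>v\<bar>) * l s"
proof -
  have "eventually (\<lambda>s. l (s + 1) / l s < exp \<beta>) at_top"
    by (rule order_tendstoD(2)[OF l_shift]) (use assms in simp)
  then obtain s0 where s0: "\<And>s. s \<ge> s0 \<Longrightarrow> l (s + 1) / l s < exp \<beta>"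
    by (auto simp: eventually_at_top_linorder)
  have nat: "l (s + real n) \<le> exp (\<beta> * real n) * l s" if "s \<ge> s0" for s n
  proof (induction n)
    case (Suc n)
    have "l (s + real n + 1) / l (s + real n) < exp \<beta>" using that by (intro s0) simp
    then have "l (s + real n + 1) \<le> exp \<beta> * l (s + real n)" by (simp add: field_simps)
    also have "\<dots> \<le> exp \<beta> * (exp (\<beta> * real n) * l s)" using Suc by (intro mult_left_mono) auto
    finally show ?case by (simp add: exp_add algebra_simps)
  qed simp
  have "l (s + v) \<le> exp \<beta> * exp (\<beta> * \<bar>v\<bar>) * l s" if "s \<ge> s0" for s v
  proof -
    define n where "n = nat \<lceil>\<bar>v\<bar>\<rceil>"
    have n: "\<bar>v\<bar> \<le> real n" "real n \<le> \<bar>v\<bar> + 1" unfolding n_def by linarith+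
    have "l (s + v) \<le> l (s + real n)" using n by (intro l_mono) linarith
    also have "\<dots> \<le> exp (\<beta> * real n) * l s" by (rule nat) fact
    also have "\<dots> \<le> exp (\<beta> * (\<bar>v\<bar> + 1)) * l s"
      using n assms by (intro mult_right_mono) (auto simp: less_imp_le)
    also have "exp (\<beta> * (\<bar>v\<bar> + 1)) = exp \<beta> * exp (\<beta> * \<bar>v\<bar>)" by (simp add: exp_add algebra_simps)
    finally show ?thesis .
  qed
  then show ?thesis by blast
qed

lemma inverse_l_tendsto_0: "((\<lambda>s. C / l s) \<longlongrightarrow> 0) at_top"
  using l_inf unfolding l_def[symmetric]
  by (intro tendsto_divide_0[OF tendsto_const] filterlim_at_top_imp_at_infinity)

text \<open>Both summands of \<open>l\<close> move in the same direction, so the increment of either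
  is at most that of \<open>l\<close>; the error \<open>K\<close> is negligible because
  \<open>l\<close> tends to infinity.\<close>

lemma G_increment_tendsto_0: "((\<lambda>s. (G b (s + v) - G b s) / l s) \<longlongrightarrow> 0) at_top"
proof (rule Lim_null_comparison)
  have "((\<lambda>s. (2 * K) / l s + \<bar>l (s + v) / l s - 1\<bar>) \<longlongrightarrow> 0 + \<bar>1 - 1\<bar>) at_top"
    by (intro tendsto_intros inverse_l_tendsto_0 l_shift)
  then show "((\<lambda>s. (2 * K) / l s + \<bar>l (s + v) / l s - 1\<bar>) \<longlongrightarrow> 0) at_top" by simp
  have "\<bar>(G b (s + v) - G b s) / l s\<bar> \<le> (2 * K) / l s + \<bar>l (s + v) / l s - 1\<bar>" for s
  proof -
    have "\<bar>m b (s + v) - m b s\<bar> \<le> \<bar>l (s + v) - l s\<bar>"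
    proof -
      have "m b' s \<le> m b' (s + v)" if "v \<ge> 0" for b' using that by (intro monoD[OF m_mono]) simp
      moreover have "m b' (s + v) \<le> m b' s" if "\<not> v \<ge> 0" for b' using that by (intro monoD[OF m_mono]) simp
      moreover have "b = True \<or> b = False" by simp
      ultimately show ?thesis unfolding l_def by (smt (verit, ccfv_threshold))
    qed
    then have "\<bar>G b (s + v) - G b s\<bar> \<le> 2 * K + \<bar>l (s + v) - l s\<bar>"
      using G_m[of b s] G_m[of b "s + v"] by linarith
    then have "\<bar>G b (s + v) - G b s\<bar> / l s \<le> (2 * K + \<bar>l (s + v) - l s\<bar>) / l s"
      by (intro divide_right_mono) (auto simp: less_imp_le)
    also have "\<dots> = 2 * K / l s + \<bar>(l (s + v) - l s) / l s\<bar>"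
      by (simp add: add_divide_distrib abs_divide abs_of_pos)
    also have "(l (s + v) - l s) / l s = l (s + v) / l s - 1"
      by (simp add: diff_divide_distrib)
    finally show ?thesis by (simp add: abs_divide abs_of_pos)
  qed
  then show "eventually (\<lambda>s. norm ((G b (s + v) - G b s) / l s) \<le> (2 * K) / l s + \<bar>l (s + v) / l s - 1\<bar>) at_top"
    by simp
qed

lemma G_sum_tendsto_1: "((\<lambda>s. (G True s + G False s) / l s) \<longlongrightarrow> 1) at_top"
proof -
  have "((\<lambda>s. (G True s + G False s) / l s - 1) \<longlongrightarrow> 0) at_top"
  proof (rule Lim_null_comparison)
    show "((\<lambda>s. (2 * K + 1) / l s) \<longlongrightarrow> 0) at_top" by (rule inverse_l_tendsto_0)
    have "\<bar>(G True s + G False s) / l s - 1\<bar> \<le> (2 * K + 1) / l s" for s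
    proof -
      have "\<bar>G True s + G False s - l s\<bar> \<le> 2 * K + 1"
        using G_m[of True s] G_m[of False s] unfolding l_def by linarith
      then have "\<bar>G True s + G False s - l s\<bar> / l s \<le> (2 * K + 1) / l s"
        by (intro divide_right_mono) (auto simp: less_imp_le)
      moreover have "(G True s + G False s) / l s - 1 = (G True s + G False s - l s) / l s"
        by (simp add: diff_divide_distrib)
      ultimately show ?thesis by (simp add: abs_divide abs_of_pos)
    qed
    then show "eventually (\<lambda>s. norm ((G True s + G False s) / l s - 1) \<le> (2 * K + 1) / l s) at_top" by simp
  qed
  then show ?thesis by (simp add: LIM_zero_iff)
qed

lemma w_le_l: "\<exists>C. \<forall>b s. w b s \<le> C * l s"
proof (rule ccontr)
  assume neg: "\<not> ?thesis"
  define W where "W s = w True s + w False s" for s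
  have w_W: "w b s \<le> W s" for b s
    using w_nonneg[of True s] w_nonneg[of False s] by (cases b) (auto simp: W_def)
  have W0: "0 \<le> W s" for s using w_nonneg[of True s] w_nonneg[of False s] by (simp add: W_def)
  have unb: "\<exists>s. W s / l s > C" for C
  proof -
    obtain b s where "w b s > C * l s" using neg by (meson not_le)
    then have "W s > C * l s" using w_W[of b s] by simp
    then show ?thesis by (auto simp: field_simps)
  qed
  \<comment> \<open>One \<beta> pays for the exponential tilt \<open>d n \<le> \<beta>\<close>,
    another for the Potter bound of \<open>l\<close>; \<open>convergent_increments\<close> then runs
    at the rate \<open>2 * \<beta> < \<delta>\<close>. The bound \<open>\<beta> < \<alpha>\<close>
    makes \<open>w_small\<close> applicable to \<open>d n\<close>.\<close>
  define \<beta> where "\<beta> = min \<alpha> \<delta> / 4"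
  have \<beta>: "0 < \<beta>" "\<beta> < \<alpha>" "2 * \<beta> < \<delta>" using \<alpha>_pos \<delta>_pos by (auto simp: \<beta>_def)
  define d where "d n = \<beta> / real (Suc n)" for n
  have d: "0 < d n" "d n \<le> \<beta>" for n using \<beta> by (auto simp: d_def field_simps)
  have d_lim: "d \<longlonglongrightarrow> 0"
    unfolding d_def using LIMSEQ_Suc[OF lim_const_over_n[of \<beta>]] by simp
  \<comment> \<open>If \<open>W / l\<close> is unbounded, near-maximisers of \<open>q n\<close> escape to infinity, and \<open>W\<close> normalised there has
    a bounded limit that solves the homogeneous equation. Its increments vanish by \<open>convergent_increments\<close>, yet they are
    bounded below by \<open>V_ge\<close>.\<close>
  define q where "q n s = W s * exp (- (d n * s)) / l s" for n s
  have "\<exists>x. q n x > 0 \<and> (\<forall>y. q n y \<le> 2 * q n x)" for n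
  proof -
    obtain C where C: "\<And>b s. w b s \<le> C * exp (d n * s)"
      using w_small[of "d n"] d[of n] \<beta> by auto
    obtain s where s: "W s / l s > 0" using unb by blast
    have "q n y \<le> 2 * C" for y
    proof -
      have "W y \<le> 2 * C * exp (d n * y)" using C[of True y] C[of False y] by (simp add: W_def)
      then have "W y * exp (- (d n * y)) \<le> 2 * C * exp (d n * y) * exp (- (d n * y))"
        by (intro mult_right_mono) auto
      then have le: "W y * exp (- (d n * y)) \<le> 2 * C" by (simp add: exp_minus field_simps)
      have "q n y \<le> W y * exp (- (d n * y)) / 1"
        unfolding q_def using l_ge_1[of y] W0[of y] by (intro divide_left_mono) auto
      with le show ?thesis by simp
    qed
    moreover have "q n s > 0" using s W0[of s] by (auto simp: q_def zero_less_divide_iff zero_less_mult_iff)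
    ultimately show ?thesis by (rule exists_near_maximizer)
  qed
  then obtain x where x: "\<And>n. q n (x n) > 0" "\<And>n y. q n y \<le> 2 * q n (x n)" by metis
  \<comment> \<open>At a fixed \<open>s\<close> the tilt fades as \<open>n\<close> grows, so
    \<open>q n s\<close> approaches \<open>W s / l s\<close>, which can be chosen as large as
    desired; near-maximality passes this on to \<open>x n\<close>.\<close>
  have q_inf: "filterlim (\<lambda>n. q n (x n)) at_top sequentially"
    unfolding filterlim_at_top
  proof
    fix Z :: real
    obtain s where s: "W s / l s > 2 * Z" using unb by blast
    have "(\<lambda>n. q n s) \<longlonglongrightarrow> W s * exp (- (0 * s)) / l s"
      unfolding q_def by (intro tendsto_intros d_lim) auto
    then have "(\<lambda>n. q n s) \<longlonglongrightarrow> W s / l s" by simp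
    from order_tendstoD(1)[OF this s]
    show "eventually (\<lambda>n. Z \<le> q n (x n)) sequentially"
    proof eventually_elim
      case (elim n)
      then show ?case using x(2)[of n s] by linarith
    qed
  qed
  have x_inf: "filterlim x at_top sequentially"
    unfolding filterlim_at_top
  proof
    fix Z :: real
    \<comment> \<open>The crude bound \<open>w_le\<close> controls \<open>q n\<close> to the left of
      \<open>Z\<close> uniformly in \<open>n\<close>, so the large values \<open>q n (x n)\<close>
      must be attained to the right.\<close>
    have "q n s \<le> 2 * exp (\<alpha> * max 0 Z)" if "s \<le> Z" for n s
    proof -
      have "W s * exp (- (d n * s)) \<le> 2 * exp (\<alpha> * s) * exp (- (d n * s))"
        using w_le[of True s] w_le[of False s] by (intro mult_right_mono) (auto simp: W_def)
      also have "\<dots> = 2 * exp ((\<alpha> - d n) * s)" by (simp add: exp_add[symmetric] algebra_simps)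
      also have "\<dots> \<le> 2 * exp (\<alpha> * max 0 Z)"
      proof -
        have "(\<alpha> - d n) * s \<le> (\<alpha> - d n) * max 0 Z"
          using that d[of n] \<beta> by (intro mult_left_mono) auto
        also have "\<dots> \<le> \<alpha> * max 0 Z" using d[of n] by (intro mult_right_mono) auto
        finally show ?thesis by simp
      qed
      finally have le: "W s * exp (- (d n * s)) \<le> 2 * exp (\<alpha> * max 0 Z)" .
      have "q n s \<le> W s * exp (- (d n * s)) / 1"
        unfolding q_def using l_ge_1[of s] W0[of s] by (intro divide_left_mono) auto
      with le show ?thesis by simp
    qed
    then have imp: "q n (x n) > 2 * exp (\<alpha> * max 0 Z) \<Longrightarrow> Z \<le> x n" for n
      by (meson linear not_le)
    have "eventually (\<lambda>n. q n (x n) > 2 * exp (\<alpha> * max 0 Z)) sequentially"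
      using q_inf by (simp add: filterlim_at_top_dense)
    then show "eventually (\<lambda>n. Z \<le> x n) sequentially" by eventually_elim (rule imp)
  qed
  obtain s0 where s0: "\<And>s v. s \<ge> s0 \<Longrightarrow> l (s + v) \<le> exp \<beta> * exp (\<beta> * \<bar>v\<bar>) * l s"
    using l_Potter[OF \<beta>(1)] by blast
  \<comment> \<open>Dropping the first \<open>n0\<close> indices makes \<open>s n \<ge> 0\<close>,
    so that \<open>exp (- (e n * s n)) \<le> 1\<close> in \<open>lW\<close>, and
    \<open>s n \<ge> s0\<close>, so that the Potter bound applies for every
    \<open>n\<close>.\<close>
  have "eventually (\<lambda>n. max 0 s0 \<le> x n) sequentially"
    using x_inf unfolding filterlim_at_top by blast
  then obtain n0 where n0: "\<And>n. n \<ge> n0 \<Longrightarrow> max 0 s0 \<le> x n" by (auto simp: eventually_sequentially)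
  define s where "s n = x (n + n0)" for n
  have s_inf: "filterlim s at_top sequentially"
    unfolding s_def by (rule filterlim_compose[OF x_inf filterlim_add_const_nat_at_top])
  have s_ge: "max 0 s0 \<le> s n" for n unfolding s_def by (rule n0) simp
  define e where "e n = d (n + n0)" for n
  have e: "0 < e n" "e n \<le> \<beta>" for n using d by (auto simp: e_def)
  have e_lim: "e \<longlonglongrightarrow> 0" unfolding e_def using d_lim by (rule LIMSEQ_ignore_initial_segment)
  have near: "W y * exp (- (e n * y)) / l y \<le> 2 * (W (s n) * exp (- (e n * s n)) / l (s n))" for n y
    using x(2)[of "n + n0" y] by (simp add: q_def s_def e_def)
  have Wpos: "W (s n) > 0" for n
  proof (rule ccontr)
    assume "\<not> W (s n) > 0"
    with W0[of "s n"] have "W (s n) = 0" by simp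
    then show False using x(1)[of "n + n0"] by (simp add: q_def s_def)
  qed
  have rel: "W (s n + v) \<le> 2 * W (s n) * (exp (e n * v) * (l (s n + v) / l (s n)))" for n v
  proof -
    have id: "W y = W y * exp (- (e n * y)) / l y * (exp (e n * y) * l y)" for y
      by (simp add: exp_minus)
    have ex: "exp (e n * (s n + v)) = exp (e n * s n) * exp (e n * v)"
      by (simp add: distrib_left exp_add)
    have "W (s n + v) = W (s n + v) * exp (- (e n * (s n + v))) / l (s n + v) * (exp (e n * (s n + v)) * l (s n + v))"
      by (rule id)
    also have "\<dots> \<le> 2 * (W (s n) * exp (- (e n * s n)) / l (s n)) * (exp (e n * (s n + v)) * l (s n + v))"
      by (intro mult_right_mono near) (auto simp: less_imp_le)
    also have "\<dots> = 2 * W (s n) * (exp (e n * v) * (l (s n + v) / l (s n)))"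
      unfolding ex by (simp add: exp_minus)
    finally show ?thesis .
  qed
  have lW: "(\<lambda>n. l (s n) / W (s n)) \<longlonglongrightarrow> 0"
  proof -
    have "filterlim (\<lambda>n. W (s n) / l (s n)) at_top sequentially"
    proof (rule filterlim_at_top_mono)
      show "filterlim (\<lambda>n. q (n + n0) (x (n + n0))) at_top sequentially"
        by (rule filterlim_compose[OF q_inf filterlim_add_const_nat_at_top])
      have "q (n + n0) (x (n + n0)) \<le> W (s n) / l (s n)" for n
        unfolding q_def s_def[symmetric] using s_ge[of n] d[of "n + n0"] W0[of "s n"] l_pos[of "s n"]
        by (intro divide_right_mono mult_left_le) (auto simp: less_imp_le)
      then show "eventually (\<lambda>n. q (n + n0) (x (n + n0)) \<le> W (s n) / l (s n)) sequentially" by simp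
    qed
    from tendsto_inverse_0_at_top[OF this] show ?thesis by simp
  qed
  \<comment> \<open>Along \<open>s\<close> the normalisation \<open>W\<close> dominates
    \<open>l\<close>, so whatever is of the order of \<open>l\<close> disappears; this is how
    \<open>G\<close> drops out and the slope becomes 0.\<close>
  have transfer: "(\<lambda>n. f (s n) / W (s n)) \<longlonglongrightarrow> 0" if "((\<lambda>s. f s / l s) \<longlongrightarrow> c) at_top" for f c
  proof -
    have "(\<lambda>n. f (s n) / l (s n)) \<longlonglongrightarrow> c" by (rule filterlim_compose[OF that s_inf])
    from tendsto_mult[OF this lW] show ?thesis
      by simp
  qed
  have "\<exists>r. strict_mono (r :: nat \<Rightarrow> nat) \<and>
    (\<forall>b v. (\<lambda>n. (V b (s (r n) + v) - V b (s (r n))) / W (s (r n))) \<longlonglongrightarrow> 0 * v / (2 * \<rho>))"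
  proof (rule convergent_increments[where \<beta>="2 * \<beta>" and C="2 * exp \<beta>" and D=3])
    show "w b (s n + v) \<le> W (s n) * (2 * exp \<beta>) * exp (2 * \<beta> * \<bar>v\<bar>)" for n b v
    proof -
      have "w b (s n + v) \<le> 2 * W (s n) * (exp (e n * v) * (l (s n + v) / l (s n)))"
        using w_W[of b "s n + v"] rel[of n v] by linarith
      also have "\<dots> \<le> 2 * W (s n) * (exp (\<beta> * \<bar>v\<bar>) * (exp \<beta> * exp (\<beta> * \<bar>v\<bar>)))"
      proof (intro mult_left_mono mult_mono)
        have "e n * v \<le> e n * \<bar>v\<bar>" using e[of n] by (intro mult_left_mono) auto
        also have "\<dots> \<le> \<beta> * \<bar>v\<bar>" using e[of n] by (intro mult_right_mono) auto
        finally show "exp (e n * v) \<le> exp (\<beta> * \<bar>v\<bar>)" by simp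
        show "l (s n + v) / l (s n) \<le> exp \<beta> * exp (\<beta> * \<bar>v\<bar>)"
          using s0[of "s n" v] s_ge[of n] by (simp add: field_simps)
      qed (use W0[of "s n"] in \<open>auto intro!: divide_nonneg_pos simp: less_imp_le\<close>)
      also have "\<dots> = W (s n) * (2 * exp \<beta>) * exp (2 * \<beta> * \<bar>v\<bar>)"
        by (simp add: exp_add[symmetric] algebra_simps)
      finally show ?thesis .
    qed
    \<comment> \<open>In \<open>rel\<close> the factor 2 of near-maximality multiplies a quantity
      tending to 1; the threshold \<open>3 / 2\<close> for that quantity gives 3.\<close>
    show "eventually (\<lambda>n. w b (s n + v) \<le> 3 * W (s n)) sequentially" for b v
    proof -
      have "(\<lambda>n. exp (e n * v) * (l (s n + v) / l (s n))) \<longlonglongrightarrow> exp (0 * v) * 1"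
        by (intro tendsto_intros e_lim filterlim_compose[OF l_shift s_inf])
      then have "eventually (\<lambda>n. exp (e n * v) * (l (s n + v) / l (s n)) < 3 / 2) sequentially"
        by (rule order_tendstoD) simp
      then show ?thesis
      proof eventually_elim
        case (elim n)
        have "2 * W (s n) * (exp (e n * v) * (l (s n + v) / l (s n))) \<le> 2 * W (s n) * (3 / 2)"
          using elim W0[of "s n"] by (intro mult_left_mono) auto
        then show ?case using rel[of n v] w_W[of b "s n + v"] by linarith
      qed
    qed
    show "(\<lambda>n. (G b (s n + v) - G b (s n)) / W (s n)) \<longlonglongrightarrow> 0" for b v
      by (rule transfer[OF G_increment_tendsto_0])
    show "(\<lambda>n. (G True (s n) + G False (s n)) / W (s n)) \<longlonglongrightarrow> 0"
      by (rule transfer[OF G_sum_tendsto_1])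
  qed (use Wpos \<beta> in auto)
  then obtain r :: "nat \<Rightarrow> nat" where
    r: "\<And>b v. (\<lambda>n. (V b (s (r n) + v) - V b (s (r n))) / W (s (r n))) \<longlonglongrightarrow> 0"
    by auto
  \<comment> \<open>Backward increments are used because \<open>V_ge\<close> bounds them by
    \<open>w\<close> at the right endpoint \<open>s (r n)\<close>, where the sum over the signs is
    exactly the normalisation \<open>W\<close>.\<close>
  let ?v = "\<lambda>b n. (V b (s (r n) + (-1)) - V b (s (r n))) / W (s (r n))"
  have "(\<lambda>n. - (?v True n)
       - ?v False n) \<longlonglongrightarrow> - 0 - 0"
    by (intro tendsto_intros r)
  moreover have "1 - exp (- \<alpha>) \<le> - (?v True n)
       - ?v False n" for n
  proof -
    have "W (s (r n)) * (1 - exp (- \<alpha>)) \<le> (V True (s (r n)) - V True (s (r n) + (-1))) + (V False (s (r n)) - V False (s (r n) + (-1)))"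
      using V_ge[of "s (r n) + (-1)" "s (r n)" True] V_ge[of "s (r n) + (-1)" "s (r n)" False]
      by (simp add: W_def algebra_simps)
    then have "(1 - exp (- \<alpha>)) \<le> ((V True (s (r n)) - V True (s (r n) + (-1))) + (V False (s (r n)) - V False (s (r n) + (-1)))) / W (s (r n))"
      using Wpos[of "r n"] by (simp add: field_simps)
    then show ?thesis by (simp add: add_divide_distrib diff_divide_distrib)
  qed
  ultimately have "1 - exp (- \<alpha>) \<le> - 0 - 0"
    by (intro LIMSEQ_le_const) auto
  then show False using \<alpha>_pos by simp
qed

text \<open>If the limit failed, some sequence tending to infinity would keep a fixed distance from
  it; by \<open>w_le_l\<close> the function \<open>l\<close> is an admissible normalisation in
  \<open>convergent_increments\<close>, which extracts a subsequence that converges to it.\<close>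

lemma V_increment_asymp: "((\<lambda>s. (V b (s + h) - V b s) / l s) \<longlongrightarrow> h / (2 * \<rho>)) at_top"
proof (rule ccontr)
  assume "\<not> ?thesis"
  then obtain \<epsilon> where \<epsilon>: "\<epsilon> > 0" "\<not> eventually (\<lambda>s. dist ((V b (s + h) - V b s) / l s) (h / (2 * \<rho>)) < \<epsilon>) at_top"
    by (auto simp: tendsto_iff)
  obtain C where C: "\<And>b s. w b s \<le> C * l s" using w_le_l by blast
  define \<beta> where "\<beta> = \<delta> / 2"
  have \<beta>: "0 < \<beta>" "\<beta> < \<delta>" using \<delta>_pos by (auto simp: \<beta>_def)
  obtain s0 where s0: "\<And>s v. s \<ge> s0 \<Longrightarrow> l (s + v) \<le> exp \<beta> * exp (\<beta> * \<bar>v\<bar>) * l s"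
    using l_Potter[OF \<beta>(1)] by blast
  have "\<exists>s\<ge>max s0 (real n). \<not> dist ((V b (s + h) - V b s) / l s) (h / (2 * \<rho>)) < \<epsilon>" for n
    using \<epsilon>(2) unfolding eventually_at_top_linorder by blast
  then obtain s where s: "\<And>n. s n \<ge> max s0 (real n)"
    "\<And>n. \<not> dist ((V b (s n + h) - V b (s n)) / l (s n)) (h / (2 * \<rho>)) < \<epsilon>" by metis
  have s_inf: "filterlim s at_top sequentially"
    by (rule filterlim_at_top_mono[OF filterlim_real_sequentially]) (use s(1) in auto)
  have C0: "C \<ge> 0"
    using C[of True 0] w_nonneg[of True 0] l_pos[of 0] by (smt (verit) mult_neg_pos)
  have "\<exists>r. strict_mono (r :: nat \<Rightarrow> nat) \<and>
    (\<forall>b v. (\<lambda>n. (V b (s (r n) + v) - V b (s (r n))) / l (s (r n))) \<longlonglongrightarrow> 1 * v / (2 * \<rho>))"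
  proof (rule convergent_increments[where C="C * exp \<beta>" and D="C * 2"])
    show "w b (s n + v) \<le> l (s n) * (C * exp \<beta>) * exp (\<beta> * \<bar>v\<bar>)" for n b v
    proof -
      have "w b (s n + v) \<le> C * l (s n + v)" by (rule C)
      also have "\<dots> \<le> C * (exp \<beta> * exp (\<beta> * \<bar>v\<bar>) * l (s n))"
        using s(1)[of n] by (intro mult_left_mono s0 C0) auto
      finally show ?thesis by (simp add: algebra_simps)
    qed
    show "eventually (\<lambda>n. w b (s n + v) \<le> C * 2 * l (s n)) sequentially" for b v
    proof -
      have "eventually (\<lambda>n. l (s n + v) / l (s n) < 2) sequentially"
        by (rule order_tendstoD(2)[OF filterlim_compose[OF l_shift s_inf]]) simp
      then show ?thesis
      proof eventually_elim
        case (elim n)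
        have "w b (s n + v) \<le> C * l (s n + v)" by (rule C)
        also have "\<dots> \<le> C * (2 * l (s n))"
          using elim by (intro mult_left_mono C0) (simp add: field_simps)
        finally show ?case by simp
      qed
    qed
    show "(\<lambda>n. (G b (s n + v) - G b (s n)) / l (s n)) \<longlonglongrightarrow> 0" for b v
      by (rule filterlim_compose[OF G_increment_tendsto_0 s_inf])
    show "(\<lambda>n. (G True (s n) + G False (s n)) / l (s n)) \<longlonglongrightarrow> 1"
      by (rule filterlim_compose[OF G_sum_tendsto_1 s_inf])
  qed (use \<beta> in auto)
  then obtain r :: "nat \<Rightarrow> nat" where
    "(\<lambda>n. (V b (s (r n) + h) - V b (s (r n))) / l (s (r n))) \<longlonglongrightarrow> h / (2 * \<rho>)"
    by auto
  then have "eventually (\<lambda>n. dist ((V b (s (r n) + h) - V b (s (r n))) / l (s (r n))) (h / (2 * \<rho>)) < \<epsilon>) sequentially"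
    using \<epsilon>(1) by (rule tendstoD)
  then show False using s(2) by simp
qed

text \<open>By \<open>V_le\<close> and \<open>V_ge\<close>, \<open>w b s\<close> lies between
  multiples of the increments of \<open>V\<close> over the intervals of length \<open>h\<close> to
  the right and to the left of \<open>s\<close>. Their limits after division by \<open>l\<close> are
  within the factors \<open>1 - \<alpha> * h\<close> and \<open>1 + \<alpha> * h\<close> of
  \<kappa>, and \<open>h\<close> is arbitrary.\<close>

theorem w_asymp: "((\<lambda>s. w b s / l s) \<longlongrightarrow> 1 / (2 * \<alpha> * \<rho>)) at_top"
proof -
  define \<kappa> where "\<kappa> = 1 / (2 * \<alpha> * \<rho>)"
  have \<kappa>: "\<kappa> > 0" using \<alpha>_pos \<rho>_pos by (simp add: \<kappa>_def)
  have up: "eventually (\<lambda>s. w b s / l s < \<kappa> * (1 + \<alpha> * h) + \<epsilon>) at_top" if h: "h > 0" and \<epsilon>: "\<epsilon> > 0" for h \<epsilon>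
  proof -
    let ?v = "\<lambda>s. V b (s + - h) - V b s"
    define z where "z = 1 - exp (- (\<alpha> * h))"
    have z: "z > 0" using h \<alpha>_pos by (simp add: z_def)
    have "h / (2 * \<rho>) / z \<le> \<kappa> * (1 + \<alpha> * h)"
    proof -
      have "exp (- (\<alpha> * h)) \<le> 1 / (1 + \<alpha> * h)"
        unfolding exp_minus inverse_eq_divide
        using exp_ge_add_one_self[of "\<alpha> * h"] h \<alpha>_pos
        by (intro divide_left_mono) (auto intro!: mult_pos_pos add_pos_pos)
      moreover have "1 + \<alpha> * h > 0" using h \<alpha>_pos by (simp add: add_pos_pos)
      ultimately have "exp (- (\<alpha> * h)) * (1 + \<alpha> * h) \<le> 1" by (simp add: pos_le_divide_eq)
      then have "\<alpha> * h \<le> z * (1 + \<alpha> * h)" by (simp add: z_def algebra_simps)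
      then have "h \<le> z * (1 + \<alpha> * h) / \<alpha>" using \<alpha>_pos by (simp add: field_simps)
      then have "h / (2 * \<rho>) / z \<le> z * (1 + \<alpha> * h) / \<alpha> / (2 * \<rho>) / z"
        using \<rho>_pos z by (intro divide_right_mono) auto
      also have "\<dots> = \<kappa> * (1 + \<alpha> * h)" using z \<alpha>_pos \<rho>_pos by (simp add: \<kappa>_def field_simps)
      finally show ?thesis .
    qed
    moreover have "((\<lambda>s. - (?v s / l s) / z) \<longlongrightarrow> - ((- h) / (2 * \<rho>)) / z) at_top"
      using z by (intro tendsto_intros V_increment_asymp) auto
    ultimately have "eventually (\<lambda>s. - (?v s / l s) / z < \<kappa> * (1 + \<alpha> * h) + \<epsilon>) at_top"
      using \<epsilon> by (intro order_tendstoD(2)) auto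
    then show ?thesis
    proof eventually_elim
      case (elim s)
      have "w b s * z \<le> - ?v s"
        using V_ge[of "s + - h" s b] h by (simp add: z_def)
      then have "w b s \<le> - (?v s) / z" using z by (simp add: field_simps)
      then have "w b s / l s \<le> - (?v s) / z / l s"
        by (intro divide_right_mono) (auto simp: less_imp_le)
      also have "\<dots> = - (?v s / l s) / z"
        unfolding minus_divide_left by (simp only: divide_divide_eq_left mult.commute)
      finally show ?case using elim by linarith
    qed
  qed
  have low: "eventually (\<lambda>s. w b s / l s > \<kappa> * (1 - \<alpha> * h) - \<epsilon>) at_top" if h: "h > 0" and \<epsilon>: "\<epsilon> > 0" for h \<epsilon>
  proof -
    let ?v = "\<lambda>s. (V b (s + h) - V b s)"
    define z where "z = exp (\<alpha> * h) - 1"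
    have z: "z > 0" using h \<alpha>_pos by (simp add: z_def)
    have "\<kappa> * (1 - \<alpha> * h) \<le> h / (2 * \<rho>) / z"
    proof -
      have "(1 - \<alpha> * h) * exp (\<alpha> * h) \<le> exp (- (\<alpha> * h)) * exp (\<alpha> * h)"
        using exp_ge_add_one_self[of "- (\<alpha> * h)"] by (intro mult_right_mono) auto
      then have "(1 - \<alpha> * h) * (z + 1) \<le> 1" by (simp add: z_def exp_add[symmetric])
      then have "(1 - \<alpha> * h) * z \<le> \<alpha> * h" by (simp add: algebra_simps)
      then have "\<kappa> * ((1 - \<alpha> * h) * z) \<le> \<kappa> * (\<alpha> * h)" using \<kappa> by (intro mult_left_mono) auto
      also have "\<kappa> * (\<alpha> * h) = h / (2 * \<rho>)" using \<alpha>_pos \<rho>_pos by (simp add: \<kappa>_def field_simps)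
      finally show ?thesis using pos_le_divide_eq[OF z] by (simp only: mult.assoc)
    qed
    moreover have "((\<lambda>s. (?v s / l s) / z) \<longlongrightarrow> h / (2 * \<rho>) / z) at_top"
      using z by (intro tendsto_intros V_increment_asymp) auto
    ultimately have "eventually (\<lambda>s. (?v s / l s) / z > \<kappa> * (1 - \<alpha> * h) - \<epsilon>) at_top"
      using \<epsilon> by (intro order_tendstoD(1)) auto
    then show ?thesis
    proof eventually_elim
      case (elim s)
      have "V b (s + h) - V b s \<le> w b s * z"
        using V_le[of s "s + h" b] h by (simp add: z_def)
      then have "?v s / z \<le> w b s" using z by (simp add: field_simps)
      then have "?v s / z / l s \<le> w b s / l s"
        by (intro divide_right_mono) (auto simp: less_imp_le)
      moreover have "?v s / z / l s = (?v s / l s) / z"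
        by (simp only: divide_divide_eq_left mult.commute)
      ultimately show ?case using elim by linarith
    qed
  qed
  have "((\<lambda>s. w b s / l s) \<longlongrightarrow> \<kappa>) at_top"
  proof (rule tendstoI)
    fix \<epsilon> :: real assume \<epsilon>: "\<epsilon> > 0"
    \<comment> \<open>Makes the bias \<open>\<kappa> * \<alpha> * h\<close> equal to
      \<open>\<epsilon> / 2\<close>; the other half is the tolerance in \<open>up\<close> and
      \<open>low\<close>.\<close>
    define h where "h = \<epsilon> / (2 * \<alpha> * \<kappa>)"
    have h: "h > 0" using \<epsilon> \<alpha>_pos \<kappa> by (simp add: h_def)
    have h2: "\<kappa> * (\<alpha> * h) = \<epsilon> / 2" using \<alpha>_pos \<kappa> by (simp add: h_def)
    have "\<epsilon> / 2 > 0" using \<epsilon> by simp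
    from up[OF h this] low[OF h this] show "eventually (\<lambda>s. dist (w b s / l s) \<kappa> < \<epsilon>) at_top"
    proof eventually_elim
      case (elim s)
      then show ?case using h2 unfolding dist_real_def distrib_left right_diff_distrib
        by (simp add: abs_less_iff)
    qed
  qed
  then show ?thesis by (simp add: \<kappa>_def)
qed

end

section \<open>Truncated powers\<close>

text \<open>Apply \<open>ln z \<le> z - 1\<close> to \<open>y powr (1 - p)\<close> and
  \<open>y powr (- p)\<close> with weights \<open>p\<close> and \<open>1 - p\<close>, for which the
  logarithms cancel. This form also exposes the case of equality.\<close>

lemma powr_le_tangent:
  fixes p y :: real
  assumes "0 < p" "p \<le> 1" "0 \<le> y"
  shows "y powr p \<le> 1 + p * (y - 1)"
proof (cases "y = 0")
  case False
  with assms have y: "y > 0" by simp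
  have "p * ln (y powr (1 - p)) + (1 - p) * ln (y powr (- p)) = 0"
    using y by (simp add: ln_powr algebra_simps)
  moreover have "p * ln (y powr (1 - p)) \<le> p * (y powr (1 - p) - 1)"
    using y assms by (intro mult_left_mono ln_le_minus_one) auto
  moreover have "(1 - p) * ln (y powr (- p)) \<le> (1 - p) * (y powr (- p) - 1)"
    using y assms by (intro mult_left_mono ln_le_minus_one) auto
  ultimately have "1 \<le> p * y powr (1 - p) + (1 - p) * y powr (- p)" by (simp add: algebra_simps)
  then have "y powr p * 1 \<le> y powr p * (p * y powr (1 - p) + (1 - p) * y powr (- p))"
    by (intro mult_left_mono) auto
  also have "\<dots> = p * (y powr p * y powr (1 - p)) + (1 - p) * (y powr p * y powr (- p))" by (simp add: algebra_simps)
  also have "\<dots> = 1 + p * (y - 1)" using y by (simp add: powr_add[symmetric] algebra_simps)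
  finally show ?thesis by simp
qed (use assms in auto)

text \<open>Equality forces \<open>ln z = z - 1\<close> at \<open>z = y powr (- p)\<close>, hence
  \<open>z = 1\<close>. This supplies the strictness in \<open>A_moment_less_1\<close>.\<close>

lemma powr_eq_tangent_imp:
  fixes p y :: real
  assumes "0 < p" "p < 1" "0 \<le> y" and eq: "y powr p = 1 + p * (y - 1)"
  shows "y = 1"
proof (cases "y = 0")
  case True
  then show ?thesis using assms by simp
next
  case False
  with assms have y: "y > 0" by simp
  have zero: "p * ln (y powr (1 - p)) + (1 - p) * ln (y powr (- p)) = 0"
    using y by (simp add: ln_powr algebra_simps)
  have le1: "p * ln (y powr (1 - p)) \<le> p * (y powr (1 - p) - 1)"
    using y assms by (intro mult_left_mono ln_le_minus_one) auto
  have le2: "(1 - p) * ln (y powr (- p)) \<le> (1 - p) * (y powr (- p) - 1)"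
    using y assms by (intro mult_left_mono ln_le_minus_one) auto
  have "y powr p * (p * y powr (1 - p) + (1 - p) * y powr (- p))
    = p * (y powr p * y powr (1 - p)) + (1 - p) * (y powr p * y powr (- p))" by (simp add: algebra_simps)
  also have "\<dots> = y powr p * 1" using y eq by (simp add: powr_add[symmetric] algebra_simps)
  finally have "p * y powr (1 - p) + (1 - p) * y powr (- p) = 1" using y by simp
  then have "p * (y powr (1 - p) - 1) + (1 - p) * (y powr (- p) - 1) = 0" by (simp add: algebra_simps)
  with zero le1 le2 have "(1 - p) * ln (y powr (- p)) = (1 - p) * (y powr (- p) - 1)" by linarith
  then have "ln (y powr (- p)) = y powr (- p) - 1" using assms(2) unfolding mult_cancel_left by auto
  then have "y powr (- p) = 1" using y by (intro ln_eq_minus_one) auto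
  then have "ln (y powr (- p)) = 0" by simp
  then show ?thesis using y assms by (simp add: ln_powr)
qed

text \<open>After scaling to \<open>v = 1\<close> and \<open>t = u / v\<close>, the difference is at
  most \<open>max 1 \<alpha> * (1 - t)\<close>: by the tangent bound with exponent
  \<open>1 / \<alpha>\<close> if \<open>\<alpha> \<ge> 1\<close>, and by
  \<open>t \<le> t powr \<alpha>\<close> otherwise. Weakening \<open>1 - t\<close> to its power
  \<theta> moves degree from the difference to \<open>v\<close>.\<close>

lemma powr_diff_le:
  fixes u v \<alpha> \<theta> :: real
  assumes uv: "0 \<le> u" "u \<le> v" and \<theta>: "0 < \<theta>" "\<theta> \<le> 1" and \<alpha>: "\<alpha> > 0"
  shows "v powr \<alpha> - u powr \<alpha> \<le> max 1 \<alpha> * (v powr (\<alpha> - \<theta>) * (v - u) powr \<theta>)"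
proof (cases "v = 0")
  case True
  then show ?thesis using uv by simp
next
  case False
  with uv have v: "v > 0" by simp
  define t where "t = u / v"
  have t: "0 \<le> t" "t \<le> 1" using uv v by (auto simp: t_def)
  have "1 - t powr \<alpha> \<le> max 1 \<alpha> * (1 - t)"
  proof (cases "\<alpha> \<ge> 1")
    case True
    have "(t powr \<alpha>) powr (1 / \<alpha>) \<le> 1 + 1 / \<alpha> * (t powr \<alpha> - 1)"
      using True by (intro powr_le_tangent) auto
    moreover have "(t powr \<alpha>) powr (1 / \<alpha>) = t" using True t by (simp add: powr_powr)
    ultimately have "\<alpha> * t \<le> \<alpha> * (1 + 1 / \<alpha> * (t powr \<alpha> - 1))"
      using \<alpha> by (intro mult_left_mono) auto
    also have "\<dots> = \<alpha> + (t powr \<alpha> - 1)" using \<alpha> by (simp add: algebra_simps)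
    finally show ?thesis using True by (simp add: max_absorb2 algebra_simps)
  next
    case False
    have "t \<le> t powr \<alpha>"
      using powr_mono'[of \<alpha> 1 t] False t by simp
    then show ?thesis using False by simp
  qed
  also have "\<dots> \<le> max 1 \<alpha> * (1 - t) powr \<theta>"
    using powr_mono'[of \<theta> 1 "1 - t"] t \<theta> by (intro mult_left_mono) auto
  finally have "v powr \<alpha> * (1 - t powr \<alpha>) \<le> v powr \<alpha> * (max 1 \<alpha> * (1 - t) powr \<theta>)"
    by (intro mult_left_mono) auto
  also have "\<dots> = max 1 \<alpha> * (v powr (\<alpha> - \<theta>) * (v powr \<theta> * (1 - t) powr \<theta>))"
    using v by (simp add: powr_diff)
  also have "v powr \<theta> * (1 - t) powr \<theta> = (v * (1 - t)) powr \<theta>"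
    using v t by (simp add: powr_mult)
  also have "v * (1 - t) = v - u" using v by (simp add: t_def field_simps)
  finally have "v powr \<alpha> * (1 - t powr \<alpha>) \<le> max 1 \<alpha> * (v powr (\<alpha> - \<theta>) * (v - u) powr \<theta>)" .
  moreover have "v powr \<alpha> * t powr \<alpha> = u powr \<alpha>"
    using v uv by (simp add: t_def powr_divide)
  ultimately show ?thesis by (simp add: right_diff_distrib)
qed

text \<open>Capping at \<open>x\<close> instead of discarding the values above \<open>x\<close>
  keeps the function monotone and continuous in \<open>x\<close>. Its derivative in
  \<open>x > 0\<close> is \<open>\<alpha> * x powr (\<alpha> - 1)\<close> on \<open>y > x\<close>
  and 0 on \<open>y < x\<close>, so expectations of increments compare with tail
  probabilities.\<close>

definition trunc_powr :: "real \<Rightarrow> real \<Rightarrow> real \<Rightarrow> real" where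
  "trunc_powr \<alpha> x y = min (max 0 y) x powr \<alpha>"

lemma trunc_powr_measurable [measurable]: "trunc_powr \<alpha> x \<in> borel_measurable borel"
  unfolding trunc_powr_def by measurable

lemma trunc_powr_nonneg: "0 \<le> trunc_powr \<alpha> x y"
  by (simp add: trunc_powr_def)

lemma trunc_powr_le: "\<alpha> > 0 \<Longrightarrow> x > 0 \<Longrightarrow> trunc_powr \<alpha> x y \<le> x powr \<alpha>"
  by (auto simp: trunc_powr_def intro!: powr_mono2)

lemma trunc_powr_abs: "\<alpha> > 0 \<Longrightarrow> x > 0 \<Longrightarrow> trunc_powr \<alpha> x y + trunc_powr \<alpha> x (- y) = min \<bar>y\<bar> x powr \<alpha>"
  by (cases "y \<ge> 0") (auto simp: trunc_powr_def max_def min_def)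

text \<open>Homogeneity of degree \<alpha>: the factor \<open>a powr \<alpha>\<close> becomes the
  density of the tilted measure, and dividing the cap by \<open>a\<close> becomes a shift by
  \<open>ln a\<close>.\<close>

lemma trunc_powr_scale:
  assumes "a > 0" "x > 0"
  shows "trunc_powr \<alpha> x (a * y) = a powr \<alpha> * trunc_powr \<alpha> (x / a) y"
proof -
  have "min (max 0 (a * y)) x = a * min (max 0 y) (x / a)"
    using assms by (auto simp: min_def max_def field_simps zero_le_mult_iff)
  then show ?thesis using assms by (simp add: trunc_powr_def powr_mult)
qed

lemma trunc_powr_increment:
  assumes "\<alpha> > 0" "0 < x" "x \<le> x'"
  shows "trunc_powr \<alpha> x' y - trunc_powr \<alpha> x y \<le> indicator {x<..} y * (x' powr \<alpha> - x powr \<alpha>)"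
    and "indicator {x'<..} y * (x' powr \<alpha> - x powr \<alpha>) \<le> trunc_powr \<alpha> x' y - trunc_powr \<alpha> x y"
    and "trunc_powr \<alpha> x y \<le> trunc_powr \<alpha> x' y"
  using assms by (auto simp: trunc_powr_def indicator_def min_def max_def intro!: powr_mono2)

text \<open>By symmetry let \<open>|b| \<le> |a|\<close>. Then the change from \<open>a\<close> to
  \<open>a + b\<close> is bounded by \<open>powr_diff_le\<close> with \<open>v \<le> 2 * |a|\<close>
  and \<open>v - u \<le> |b|\<close>, and the term at \<open>b\<close> by
  \<open>|b| powr \<alpha>\<close>. The bound does not depend on the cap \<open>x\<close>.\<close>

lemma trunc_powr_add:
  assumes \<theta>: "0 < \<theta>" "\<theta> \<le> 1" "\<theta> < \<alpha>" and x: "x > 0"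
  shows "\<bar>trunc_powr \<alpha> x (a + b) - trunc_powr \<alpha> x a - trunc_powr \<alpha> x b\<bar>
    \<le> (max 1 \<alpha> * 2 powr \<alpha> + 1) * (\<bar>a\<bar> powr \<theta> * \<bar>b\<bar> powr (\<alpha> - \<theta>) + \<bar>a\<bar> powr (\<alpha> - \<theta>) * \<bar>b\<bar> powr \<theta>)"
proof -
  have \<alpha>: "\<alpha> > 0" using \<theta> by simp
  \<comment> \<open>Written as a minimum of powers, the cap is a nonexpansive map, so it can only
    shrink differences.\<close>
  have tp: "trunc_powr \<alpha> x y = min (max 0 y powr \<alpha>) (x powr \<alpha>)" for y
  proof (cases "max 0 y \<le> x")
    case True
    moreover from this have "max 0 y powr \<alpha> \<le> x powr \<alpha>" using \<alpha> by (intro powr_mono2) auto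
    ultimately show ?thesis by (simp add: trunc_powr_def min_absorb1)
  next
    case False
    then have "x powr \<alpha> \<le> max 0 y powr \<alpha>" using \<alpha> x by (intro powr_mono2) auto
    moreover have "min (max 0 y) x = x" using False by linarith
    ultimately show ?thesis by (simp add: trunc_powr_def min_absorb2)
  qed
  have main: "\<bar>trunc_powr \<alpha> x (a + b) - trunc_powr \<alpha> x a - trunc_powr \<alpha> x b\<bar>
     \<le> (max 1 \<alpha> * 2 powr \<alpha> + 1) * (\<bar>a\<bar> powr (\<alpha> - \<theta>) * \<bar>b\<bar> powr \<theta>)" if ab: "\<bar>b\<bar> \<le> \<bar>a\<bar>" for a b
  proof -
    let ?p = "(\<bar>a\<bar> powr (\<alpha> - \<theta>) * \<bar>b\<bar> powr \<theta>)"
    define u where "u = min (max 0 (a + b)) (max 0 a)"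
    define v where "v = max (max 0 (a + b)) (max 0 a)"
    have uv: "0 \<le> u" "u \<le> v" "v \<le> 2 * \<bar>a\<bar>" "v - u \<le> \<bar>b\<bar>"
      using ab by (auto simp: u_def v_def)
    have "\<bar>trunc_powr \<alpha> x (a + b) - trunc_powr \<alpha> x a\<bar> \<le> \<bar>max 0 (a + b) powr \<alpha> - max 0 a powr \<alpha>\<bar>"
      unfolding tp by linarith
    also have "\<dots> \<le> v powr \<alpha> - u powr \<alpha>"
    proof (cases "max 0 (a + b) \<le> max 0 a")
      case True
      then have "max 0 (a + b) powr \<alpha> \<le> max 0 a powr \<alpha>" using \<alpha> by (intro powr_mono2) auto
      then show ?thesis using True by (simp add: u_def v_def min_absorb1 max_absorb2)
    next
      case False
      then have "max 0 a powr \<alpha> \<le> max 0 (a + b) powr \<alpha>" using \<alpha> by (intro powr_mono2) auto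
      then show ?thesis using False by (simp add: u_def v_def min_absorb2 max_absorb1)
    qed
    also have "\<dots> \<le> max 1 \<alpha> * (v powr (\<alpha> - \<theta>) * (v - u) powr \<theta>)"
      by (rule powr_diff_le) (use uv \<theta> \<alpha> in auto)
    also have "\<dots> \<le> max 1 \<alpha> * ((2 * \<bar>a\<bar>) powr (\<alpha> - \<theta>) * \<bar>b\<bar> powr \<theta>)"
      using uv \<theta> by (intro mult_left_mono mult_mono powr_mono2) auto
    also have "\<dots> = max 1 \<alpha> * 2 powr (\<alpha> - \<theta>) * ?p"
      by (simp add: powr_mult)
    also have "\<dots> \<le> max 1 \<alpha> * 2 powr \<alpha> * ?p"
      using \<theta> by (intro mult_right_mono mult_left_mono powr_mono) auto
    finally have 1: "\<bar>trunc_powr \<alpha> x (a + b) - trunc_powr \<alpha> x a\<bar> \<le> max 1 \<alpha> * 2 powr \<alpha> * ?p" .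
    have "trunc_powr \<alpha> x b \<le> max 0 b powr \<alpha>" unfolding tp by simp
    also have "\<dots> \<le> \<bar>b\<bar> powr \<alpha>" using \<alpha> by (intro powr_mono2) auto
    also have "\<bar>b\<bar> powr \<alpha> = \<bar>b\<bar> powr (\<alpha> - \<theta>) * \<bar>b\<bar> powr \<theta>" by (simp add: powr_add[symmetric])
    also have "\<dots> \<le> \<bar>a\<bar> powr (\<alpha> - \<theta>) * \<bar>b\<bar> powr \<theta>"
      using ab \<theta> by (intro mult_right_mono powr_mono2) auto
    finally have "\<bar>trunc_powr \<alpha> x b\<bar> \<le> \<bar>a\<bar> powr (\<alpha> - \<theta>) * \<bar>b\<bar> powr \<theta>" by (simp add: trunc_powr_nonneg)
    with 1 show ?thesis unfolding distrib_right by linarith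
  qed
  have c: "max 1 \<alpha> * 2 powr \<alpha> + 1 \<ge> 0" by (intro add_nonneg_nonneg mult_nonneg_nonneg) auto
  show ?thesis
  proof (cases "\<bar>b\<bar> \<le> \<bar>a\<bar>")
    case True
    from main[OF this] show ?thesis
      by (rule order_trans) (intro mult_left_mono c, simp)
  next
    case False
    then have "\<bar>a\<bar> \<le> \<bar>b\<bar>" by simp
    from main[OF this] have "\<bar>trunc_powr \<alpha> x (a + b) - trunc_powr \<alpha> x a - trunc_powr \<alpha> x b\<bar>
       \<le> (max 1 \<alpha> * 2 powr \<alpha> + 1) * (\<bar>a\<bar> powr \<theta> * \<bar>b\<bar> powr (\<alpha> - \<theta>))"
      by (simp add: add.commute mult.commute algebra_simps)
    then show ?thesis
      by (rule order_trans) (intro mult_left_mono c, simp)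
  qed
qed

lemma (in prob_space) integrable_trunc_powr:
  assumes [measurable]: "f \<in> borel_measurable M" and "\<alpha> > 0" "x > 0"
  shows "integrable M (\<lambda>\<omega>. trunc_powr \<alpha> x (f \<omega>))"
  using trunc_powr_le[OF assms(2,3)]
  by (intro integrable_const_bound[where B="x powr \<alpha>"]) (auto simp: trunc_powr_nonneg)

lemma (in prob_space) expectation_trunc_powr_increment:
  assumes [measurable]: "f \<in> borel_measurable M" and \<alpha>: "\<alpha> > 0" and xy: "0 < x" "x \<le> y"
  defines "D \<equiv> (\<integral>\<omega>. trunc_powr \<alpha> y (f \<omega>) \<partial>M) - (\<integral>\<omega>. trunc_powr \<alpha> x (f \<omega>) \<partial>M)"
  shows "D \<le> \<P>(\<omega> in M. f \<omega> > x) * (y powr \<alpha> - x powr \<alpha>)"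
    and "\<P>(\<omega> in M. f \<omega> > y) * (y powr \<alpha> - x powr \<alpha>) \<le> D"
proof -
  have ind: "(\<integral>\<omega>. indicator {u<..} (f \<omega>) * c \<partial>M) = \<P>(\<omega> in M. f \<omega> > u) * c" and
    int: "integrable M (\<lambda>\<omega>. indicator {u<..} (f \<omega>) * c)" for u c :: real
  proof -
    have eq: "indicator {u<..} (f \<omega>) * c = indicator {\<omega>\<in>space M. f \<omega> > u} \<omega> * c" if "\<omega> \<in> space M" for \<omega>
      using that by (auto simp: indicator_def)
    have "(\<integral>\<omega>. indicator {u<..} (f \<omega>) * c \<partial>M) = (\<integral>\<omega>. indicator {\<omega>\<in>space M. f \<omega> > u} \<omega> * c \<partial>M)"
      by (intro Bochner_Integration.integral_cong refl eq)
    then show "(\<integral>\<omega>. indicator {u<..} (f \<omega>) * c \<partial>M) = \<P>(\<omega> in M. f \<omega> > u) * c" by simp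
    show "integrable M (\<lambda>\<omega>. indicator {u<..} (f \<omega>) * c)"
      by (intro integrable_mult_left integrable_const_bound[where B=1]) (auto simp: indicator_def)
  qed
  have diff: "D = (\<integral>\<omega>. trunc_powr \<alpha> y (f \<omega>) - trunc_powr \<alpha> x (f \<omega>) \<partial>M)"
    unfolding D_def using \<alpha> xy
    by (subst Bochner_Integration.integral_diff) (auto intro!: integrable_trunc_powr)
  have di: "integrable M (\<lambda>\<omega>. trunc_powr \<alpha> y (f \<omega>) - trunc_powr \<alpha> x (f \<omega>))"
    using \<alpha> xy by (intro Bochner_Integration.integrable_diff integrable_trunc_powr) auto
  show "D \<le> \<P>(\<omega> in M. f \<omega> > x) * (y powr \<alpha> - x powr \<alpha>)"
    and "\<P>(\<omega> in M. f \<omega> > y) * (y powr \<alpha> - x powr \<alpha>) \<le> D"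
    unfolding diff ind[symmetric] by (intro integral_mono di int trunc_powr_increment \<alpha> xy)+
qed

section \<open>Truncated moments of a regularly varying tail\<close>

context prob_space
begin

text \<open>Dyadic decomposition: \<open>|y| powr \<beta>\<close> is at most 1 plus the sum of
  \<open>(2 ^ Suc k) powr \<beta>\<close> over those \<open>k\<close> with
  \<open>2 ^ k < |y|\<close>. The expected terms have asymptotic ratio
  \<open>2 powr (\<beta> - \<alpha>) < 1\<close>.\<close>

lemma regularly_varying_tail_moment:
  fixes Y :: "'a \<Rightarrow> real"
  assumes [measurable]: "Y \<in> borel_measurable M"
    and tail: "((\<lambda>t. \<P>(\<omega> in M. \<bar>Y \<omega>\<bar> > 2 * t) / \<P>(\<omega> in M. \<bar>Y \<omega>\<bar> > t)) \<longlongrightarrow> 2 powr (- \<alpha>)) at_top"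
    and pos: "\<And>t. \<P>(\<omega> in M. \<bar>Y \<omega>\<bar> > t) > 0"
    and \<beta>: "0 < \<beta>" "\<beta> < \<alpha>"
  shows "integrable M (\<lambda>\<omega>. \<bar>Y \<omega>\<bar> powr \<beta>)"
proof -
  define H where "H t = \<P>(\<omega> in M. \<bar>Y \<omega>\<bar> > t)" for t
  have Hpos: "H t > 0" for t using pos by (simp add: H_def)
  \<comment> \<open>A ratio strictly between the limit ratio
    \<open>2 powr (\<beta> - \<alpha>)\<close> and 1.\<close>
  define c where "c = 2 powr ((\<beta> - \<alpha>) / 2)"
  have c: "c < 1" using \<beta> by (simp add: c_def powr_less_one)
  have "2 powr (- \<alpha>) < c * 2 powr (- \<beta>)"
    unfolding c_def powr_add[symmetric] using \<beta> by (intro powr_less_mono) (auto simp: field_simps)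
  from order_tendstoD(2)[OF tail this] have "eventually (\<lambda>t. H (2 * t) / H t < c * 2 powr (- \<beta>)) at_top"
    by (simp add: H_def)
  then obtain t0 where t0: "\<And>t. t \<ge> t0 \<Longrightarrow> H (2 * t) / H t < c * 2 powr (- \<beta>)"
    by (auto simp: eventually_at_top_linorder)
  obtain k0 :: nat where k0: "t0 < 2 ^ k0" using real_arch_pow[of 2 t0] by auto
  define f where "f k = (2 ^ Suc k) powr \<beta> * H (2 ^ k)" for k :: nat
  have f_nonneg: "0 \<le> f k" for k using Hpos[of "2 ^ k"] by (simp add: f_def)
  have summ: "summable f"
  proof (rule summable_ratio_test[OF c])
    fix n assume n: "n \<ge> k0"
    have "(2::real) ^ k0 \<le> 2 ^ n" using n by (intro power_increasing) auto
    with k0 have "t0 \<le> 2 ^ n" by linarith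
    then have "H (2 * 2 ^ n) / H (2 ^ n) < c * 2 powr (- \<beta>)" by (rule t0)
    then have "H (2 ^ Suc n) \<le> c * 2 powr (- \<beta>) * H (2 ^ n)"
      using Hpos[of "2 ^ n"] by (simp add: pos_divide_less_eq)
    then have "f (Suc n) \<le> (2 ^ Suc (Suc n)) powr \<beta> * (c * 2 powr (- \<beta>) * H (2 ^ n))"
      unfolding f_def by (intro mult_left_mono) auto
    also have "(2 ^ Suc (Suc n)) powr \<beta> = (2 ^ Suc n) powr \<beta> * (2 powr \<beta> :: real)"
      unfolding power_Suc[of 2 "Suc n"] by (subst powr_mult) (auto simp: mult.commute)
    also have "(2 ^ Suc n) powr \<beta> * 2 powr \<beta> * (c * 2 powr (- \<beta>) * H (2 ^ n)) = c * f n"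
      by (simp add: f_def powr_minus)
    finally show "norm (f (Suc n)) \<le> c * norm (f n)" using f_nonneg by simp
  qed
  let ?i = "\<lambda>k y. ennreal ((2 ^ Suc k) powr \<beta>) * indicator {y. 2 ^ k < \<bar>y\<bar>} y"
  have pw: "ennreal (\<bar>y\<bar> powr \<beta>) \<le> 1 + (\<Sum>k. ?i k y)" for y :: real
  proof (cases "\<bar>y\<bar> \<le> 1")
    case True
    then have "\<bar>y\<bar> powr \<beta> \<le> 1 powr \<beta>" using \<beta> by (intro powr_mono2) auto
    then have "ennreal (\<bar>y\<bar> powr \<beta>) \<le> 1" by simp
    then show ?thesis by (rule order_trans) simp
  next
    case False
    define k where "k = (LEAST n::nat. \<bar>y\<bar> \<le> 2 ^ Suc n)"
    have ex: "\<exists>n::nat. \<bar>y\<bar> \<le> 2 ^ Suc n"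
    proof -
      obtain n where "\<bar>y\<bar> < 2 ^ n" using real_arch_pow[of 2 "\<bar>y\<bar>"] by auto
      then have "\<bar>y\<bar> \<le> 2 ^ Suc n" by simp
      then show ?thesis ..
    qed
    have k1: "\<bar>y\<bar> \<le> 2 ^ Suc k" unfolding k_def by (rule LeastI_ex[OF ex])
    have k2: "2 ^ k < \<bar>y\<bar>"
    proof (cases k)
      case 0
      then show ?thesis using False by simp
    next
      case (Suc j)
      have "\<not> \<bar>y\<bar> \<le> 2 ^ Suc j" using not_less_Least[of j "\<lambda>n. \<bar>y\<bar> \<le> 2 ^ Suc n"] Suc by (simp add: k_def)
      then show ?thesis using Suc by simp
    qed
    have "ennreal (\<bar>y\<bar> powr \<beta>) \<le> ennreal ((2 ^ Suc k) powr \<beta>)"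
      using k1 \<beta> by (intro ennreal_leI powr_mono2) auto
    also have "\<dots> = (\<Sum>k\<in>{k}. ?i k y)"
      using k2 by simp
    also have "\<dots> \<le> (\<Sum>k. ?i k y)"
      by (rule sum_le_suminf) auto
    finally show ?thesis by (rule order_trans) simp
  qed
  have "(\<integral>\<^sup>+\<omega>. ennreal (\<bar>Y \<omega>\<bar> powr \<beta>) \<partial>M)
      \<le> (\<integral>\<^sup>+\<omega>. 1 + (\<Sum>k. ?i k (Y \<omega>)) \<partial>M)"
    by (intro nn_integral_mono pw)
  also have "\<dots> = 1 + (\<Sum>k. \<integral>\<^sup>+\<omega>. ?i k (Y \<omega>) \<partial>M)"
    by (subst nn_integral_add) (auto simp: emeasure_space_1 nn_integral_suminf)
  also have "\<dots> = 1 + (\<Sum>k. ennreal (f k))"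
  proof -
    have "(\<integral>\<^sup>+\<omega>. ?i k (Y \<omega>) \<partial>M) = ennreal (f k)" for k
    proof -
      have "(\<integral>\<^sup>+\<omega>. ?i k (Y \<omega>) \<partial>M)
        = (\<integral>\<^sup>+\<omega>. ennreal ((2 ^ Suc k) powr \<beta>) * indicator {\<omega>\<in>space M. 2 ^ k < \<bar>Y \<omega>\<bar>} \<omega> \<partial>M)"
        by (intro nn_integral_cong) (auto simp: indicator_def)
      also have "\<dots> = ennreal ((2 ^ Suc k) powr \<beta>) * emeasure M {\<omega>\<in>space M. 2 ^ k < \<bar>Y \<omega>\<bar>}"
        by (rule nn_integral_cmult_indicator) measurable
      finally show ?thesis by (simp add: f_def H_def emeasure_eq_measure ennreal_mult)
    qed
    then show ?thesis by simp
  qed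
  also have "\<dots> < \<infinity>"
    using ennreal_suminf_neq_top[OF summ f_nonneg] by (simp add: less_top[symmetric])
  finally show ?thesis by (intro integrableI_nonneg) auto
qed

end

section \<open>Slow variation of the truncated moment\<close>

text \<open>Regular variation is expressed by the doubling ratio of the tail, which suits the dyadic
  arguments and keeps the slowly varying function out of the renewal argument.\<close>

locale infinite_moment_tail = prob_space M for M :: "'a measure" +
  fixes Y :: "'a \<Rightarrow> real" and \<alpha> :: real
  assumes Y_meas [measurable]: "Y \<in> borel_measurable M"
    and \<alpha>_pos: "\<alpha> > 0"
    and reg: "((\<lambda>t. \<P>(\<omega> in M. \<bar>Y \<omega>\<bar> > 2 * t) / \<P>(\<omega> in M. \<bar>Y \<omega>\<bar> > t)) \<longlongrightarrow> 2 powr (- \<alpha>)) at_top"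
    and inf_moment: "(\<integral>\<^sup>+ \<omega>. ennreal (\<bar>Y \<omega>\<bar> powr \<alpha>) \<partial>M) = \<infinity>"
begin

definition tail :: "real \<Rightarrow> real" where "tail t = \<P>(\<omega> in M. \<bar>Y \<omega>\<bar> > t)"

definition trunc_moment :: "real \<Rightarrow> real" where
  "trunc_moment x = (\<integral>\<omega>. min \<bar>Y \<omega>\<bar> x powr \<alpha> \<partial>M)"

lemma tail_pos: "tail t > 0"
proof (rule ccontr)
  assume "\<not> ?thesis"
  then have "tail t = 0" by (simp add: tail_def not_less measure_le_0_iff)
  then have "AE \<omega> in M. \<not> \<bar>Y \<omega>\<bar> > t"
    unfolding tail_def by (subst (asm) prob_eq_0) auto
  then have "(\<integral>\<^sup>+ \<omega>. ennreal (\<bar>Y \<omega>\<bar> powr \<alpha>) \<partial>M) \<le> (\<integral>\<^sup>+ \<omega>. ennreal (max 0 t powr \<alpha>) \<partial>M)"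
    using \<alpha>_pos by (intro nn_integral_mono_AE) (auto elim!: eventually_mono intro!: ennreal_leI powr_mono2)
  also have "\<dots> < \<infinity>" by (simp add: emeasure_space_1)
  finally show False using inf_moment by simp
qed

lemma trunc_integrable: "integrable M (\<lambda>\<omega>. min \<bar>Y \<omega>\<bar> x powr \<alpha>)"
proof (cases "x \<ge> 0")
  case True
  then show ?thesis
    using \<alpha>_pos by (intro integrable_const_bound[where B="x powr \<alpha>"]) (auto intro!: AE_I2 powr_mono2)
next
  case False
  then have "min \<bar>Y \<omega>\<bar> x = x" for \<omega> by linarith
  then show ?thesis by simp
qed

lemma trunc_moment_mono: "0 \<le> x \<Longrightarrow> x \<le> y \<Longrightarrow> trunc_moment x \<le> trunc_moment y"
  unfolding trunc_moment_def using \<alpha>_pos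
  by (intro integral_mono trunc_integrable powr_mono2) auto

lemma trunc_moment_nonneg: "0 \<le> trunc_moment x"
  unfolding trunc_moment_def by simp

lemma trunc_moment_increment:
  assumes "0 < x" "x \<le> y"
  shows "trunc_moment y - trunc_moment x \<le> tail x * (y powr \<alpha> - x powr \<alpha>)"
    and "tail y * (y powr \<alpha> - x powr \<alpha>) \<le> trunc_moment y - trunc_moment x"
  using expectation_trunc_powr_increment[of "\<lambda>\<omega>. \<bar>Y \<omega>\<bar>", OF _ \<alpha>_pos assms]
  by (simp_all add: trunc_moment_def trunc_powr_def tail_def)

lemma trunc_moment_at_top: "filterlim trunc_moment at_top at_top"
  unfolding filterlim_at_top
proof
  fix Z :: real
  let ?t = "\<lambda>n \<omega>. ennreal (min \<bar>Y \<omega>\<bar> (real n) powr \<alpha>)"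
  have inc: "incseq (\<lambda>n \<omega>. ?t n \<omega>)"
    using \<alpha>_pos by (auto simp: incseq_def le_fun_def intro!: ennreal_leI powr_mono2)
  have sup: "(SUP n. ?t n \<omega>) = ennreal (\<bar>Y \<omega>\<bar> powr \<alpha>)" for \<omega>
  proof (rule antisym)
    show "(SUP n. ?t n \<omega>) \<le> ennreal (\<bar>Y \<omega>\<bar> powr \<alpha>)"
      using \<alpha>_pos by (intro SUP_least ennreal_leI powr_mono2) auto
    obtain n :: nat where "\<bar>Y \<omega>\<bar> \<le> real n" using real_arch_simple by blast
    then have "ennreal (\<bar>Y \<omega>\<bar> powr \<alpha>) = ?t n \<omega>" by (simp add: min_absorb1)
    also have "\<dots> \<le> (SUP n. ?t n \<omega>)" by (rule SUP_upper) simp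
    finally show "ennreal (\<bar>Y \<omega>\<bar> powr \<alpha>) \<le> (SUP n. ?t n \<omega>)" .
  qed
  have "(SUP n. ennreal (trunc_moment (real n))) = (SUP n. \<integral>\<^sup>+\<omega>. ?t n \<omega> \<partial>M)"
    unfolding trunc_moment_def using trunc_integrable by (subst nn_integral_eq_integral) auto
  also have "\<dots> = (\<integral>\<^sup>+\<omega>. (SUP n. ?t n \<omega>) \<partial>M)"
    by (rule nn_integral_monotone_convergence_SUP[OF inc, symmetric]) measurable
  also have "\<dots> = \<infinity>" unfolding sup inf_moment ..
  finally have "(SUP n. ennreal (trunc_moment (real n))) = \<infinity>" .
  then have "ennreal Z < (SUP n. ennreal (trunc_moment (real n)))" by (simp only: ennreal_less_top infinity_ennreal_def)
  then obtain n where "ennreal Z < ennreal (trunc_moment (real n))" unfolding less_SUP_iff by blast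
  then have "Z \<le> trunc_moment (real n)" using trunc_moment_nonneg[of "real n"]
    by (meson ennreal_leI leD linear)
  then have "Z \<le> trunc_moment x" if "x \<ge> real n" for x
    using trunc_moment_mono[of "real n" x] that by simp
  then show "eventually (\<lambda>x. Z \<le> trunc_moment x) at_top"
    unfolding eventually_at_top_linorder by blast
qed

text \<open>Karamata's relation in the critical case. The function \<open>u\<close> is almost
  unchanged by doubling, while each doubling adds at least \<open>2 * c * u (2 * t)\<close> to the
  truncated moment; over many doublings the moment exceeds any multiple of \<open>u\<close>.\<close>

lemma trunc_moment_dominates: "eventually (\<lambda>x. C * (x powr \<alpha> * tail x) \<le> trunc_moment x) at_top"
proof -
  define u where "u x = x powr \<alpha> * tail x" for x
  define c where "c = (1 - 2 powr (- \<alpha>)) / 2"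
  have c: "c > 0" using \<alpha>_pos by (simp add: c_def powr_less_one)
  have u_nonneg: "0 \<le> u x" for x by (simp add: u_def tail_def)
  have u_lim: "((\<lambda>t. u (2 * t) / u t) \<longlongrightarrow> 1) at_top"
  proof (rule Lim_transform_eventually)
    show "((\<lambda>t. 2 powr \<alpha> * (tail (2 * t) / tail t)) \<longlongrightarrow> 1) at_top"
      using tendsto_mult[OF tendsto_const[of "2 powr \<alpha>"] reg] by (simp add: tail_def powr_minus)
    show "eventually (\<lambda>t. 2 powr \<alpha> * (tail (2 * t) / tail t) = u (2 * t) / u t) at_top"
      using eventually_gt_at_top[of 0] by eventually_elim (simp add: u_def powr_mult)
  qed
  have step: "eventually (\<lambda>x. real n * c * u x \<le> trunc_moment x) at_top" for n
  proof (induction n)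
    case (Suc n)
    have inc: "trunc_moment t + 2 * c * u (2 * t) \<le> trunc_moment (2 * t)" if "t > 0" for t
    proof -
      have "tail (2 * t) * ((2 * t) powr \<alpha> - t powr \<alpha>) \<le> trunc_moment (2 * t) - trunc_moment t"
        by (rule trunc_moment_increment) (use that in auto)
      moreover have "tail (2 * t) * ((2 * t) powr \<alpha> - t powr \<alpha>) = 2 * c * u (2 * t)"
        using that by (simp add: u_def c_def powr_mult powr_minus field_simps)
      ultimately show ?thesis by simp
    qed
    \<comment> \<open>Replacing \<open>u t\<close> by \<open>u (2 * t)\<close> loses at most
      \<open>n * \<eta> \<le> 1\<close> units of \<open>c * u (2 * t)\<close>. Since doubling gains
      two such units, one remains for the induction step.\<close>
    define \<eta> where "\<eta> = 1 / (real n + 1)"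
    have \<eta>: "\<eta> > 0" "real n * \<eta> \<le> 1" by (auto simp: \<eta>_def field_simps)
    have "1 < 1 + \<eta>" using \<eta> by simp
    then have "eventually (\<lambda>t. u (2 * t) / u t < 1 + \<eta>) at_top" by (rule order_tendstoD(2)[OF u_lim])
    then have "eventually (\<lambda>t. real (Suc n) * c * u (2 * t) \<le> trunc_moment (2 * t)) at_top"
      using Suc eventually_gt_at_top[of 0]
    proof eventually_elim
      case (elim t)
      have "u t > 0" using elim(3) tail_pos[of t] by (simp add: u_def)
      then have "u (2 * t) \<le> (1 + \<eta>) * u t" using elim(1) by (simp add: pos_divide_less_eq)
      then have "u (2 * t) * (1 - \<eta>) \<le> (1 + \<eta>) * (1 - \<eta>) * u t"
        using mult_right_mono[of "u (2 * t)" "(1 + \<eta>) * u t" "1 - \<eta>"] by (simp add: \<eta>_def mult_ac)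
      also have "\<dots> \<le> 1 * u t" using u_nonneg[of t] by (intro mult_right_mono) (auto simp: algebra_simps)
      finally have "real n * c * (u (2 * t) * (1 - \<eta>)) \<le> real n * c * u t"
        using c by (intro mult_left_mono) auto
      then have "real n * c * (u (2 * t) * (1 - \<eta>)) + 2 * c * u (2 * t) \<le> trunc_moment (2 * t)"
        using elim(2) inc[OF elim(3)] by linarith
      moreover have "real n * \<eta> * (c * u (2 * t)) \<le> 1 * (c * u (2 * t))"
        using \<eta> c u_nonneg by (intro mult_right_mono) auto
      ultimately show ?case by (simp add: algebra_simps)
    qed
    then obtain t0 where "\<And>t. t \<ge> t0 \<Longrightarrow> real (Suc n) * c * u (2 * t) \<le> trunc_moment (2 * t)"
      by (auto simp: eventually_at_top_linorder)
    from this[of "x / 2" for x] have "\<And>x. x \<ge> 2 * t0 \<Longrightarrow> real (Suc n) * c * u x \<le> trunc_moment x"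
      by simp
    then show ?case by (auto simp: eventually_at_top_linorder)
  qed (simp add: trunc_moment_nonneg)
  obtain n :: nat where "C < real n * c" using ex_less_of_nat_mult[OF c] by blast
  from step[of n] show ?thesis
  proof eventually_elim
    case (elim x)
    have "C * u x \<le> real n * c * u x" using \<open>C < _\<close> u_nonneg by (intro mult_right_mono) auto
    then show ?case using elim by (simp add: u_def)
  qed
qed

text \<open>Passing from \<open>exp s\<close> to \<open>exp (s + h)\<close> adds at most
  \<open>exp (\<alpha> * h) - 1\<close> times \<open>exp s powr \<alpha> * tail (exp s)\<close>,
  which is negligible by \<open>trunc_moment_dominates\<close>.\<close>

lemma trunc_moment_slow:
  assumes "h \<ge> 0"
  shows "((\<lambda>s. (1 + trunc_moment (exp (s + h))) / (1 + trunc_moment (exp s))) \<longlongrightarrow> 1) at_top"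
proof (rule tendstoI)
  fix e :: real assume e: "e > 0"
  define C where "C = (exp (\<alpha> * h) - 1) / e + 1"
  have "exp (\<alpha> * h) - 1 \<ge> 0" using assms \<alpha>_pos by simp
  then have "C > 0" using e unfolding C_def by (intro add_nonneg_pos divide_nonneg_pos) auto
  moreover have "C * e = exp (\<alpha> * h) - 1 + e" using e by (simp add: C_def field_simps)
  ultimately have C: "(exp (\<alpha> * h) - 1) < C * e" "C > 0" using e by auto
  have "eventually (\<lambda>s. C * (exp s powr \<alpha> * tail (exp s)) \<le> trunc_moment (exp s)) at_top"
    by (rule eventually_compose_filterlim[OF trunc_moment_dominates exp_at_top])
  then show "eventually (\<lambda>s. dist ((1 + trunc_moment (exp (s + h))) / (1 + trunc_moment (exp s))) 1 < e) at_top"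
  proof eventually_elim
    case (elim s)
    define u where "u = exp s powr \<alpha> * tail (exp s)"
    have u: "u > 0" using tail_pos by (simp add: u_def)
    have pos: "1 + trunc_moment (exp s) > 0" using trunc_moment_nonneg[of "exp s"] by linarith
    have "trunc_moment (exp (s + h)) - trunc_moment (exp s) \<le> tail (exp s) * (exp (s + h) powr \<alpha> - exp s powr \<alpha>)"
      by (rule trunc_moment_increment) (use assms in auto)
    also have "\<dots> = (exp (\<alpha> * h) - 1) * u"
    proof -
      have "exp (s + h) powr \<alpha> = exp s powr \<alpha> * exp (\<alpha> * h)"
        unfolding exp_powr_real exp_add[symmetric] by (simp add: algebra_simps)
      then show ?thesis by (simp add: u_def algebra_simps)
    qed
    also have "\<dots> < C * e * u" using C u by (intro mult_strict_right_mono) auto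
    also have "\<dots> = e * (C * u)" by simp
    also have "\<dots> \<le> e * trunc_moment (exp s)" using elim e unfolding u_def by (intro mult_left_mono) auto
    also have "\<dots> \<le> e * (1 + trunc_moment (exp s))" using e by simp
    finally have up: "trunc_moment (exp (s + h)) - trunc_moment (exp s) < e * (1 + trunc_moment (exp s))" .
    have low: "0 \<le> trunc_moment (exp (s + h)) - trunc_moment (exp s)"
      using trunc_moment_mono[of "exp s" "exp (s + h)"] assms by simp
    have "(1 + trunc_moment (exp (s + h))) / (1 + trunc_moment (exp s)) - 1
        = (trunc_moment (exp (s + h)) - trunc_moment (exp s)) / (1 + trunc_moment (exp s))"
      using pos by (simp add: field_simps)
    then show ?case using up low pos by (simp add: dist_real_def pos_divide_less_eq)
  qed
qed

lemma tail_measurable [measurable]: "tail \<in> borel_measurable borel"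
proof -
  have "mono (\<lambda>t. - tail t)"
    unfolding tail_def by (intro monoI) (auto intro!: finite_measure_mono)
  then have "(\<lambda>t. - (- tail t)) \<in> borel_measurable borel"
    by (intro borel_measurable_uminus borel_measurable_mono)
  then show ?thesis by simp
qed

text \<open>Layer-cake formula, started at \<open>a > 0\<close> to stay away from the singularity of
  \<open>t powr (\<alpha> - 1)\<close> at 0 when \<open>\<alpha> < 1\<close>.\<close>

lemma min_powr_diff_eq_nn_integral:
  fixes y :: real
  assumes "0 < a" "a \<le> x"
  shows "(\<integral>\<^sup>+t. ennreal (\<alpha> * t powr (\<alpha> - 1)) * indicator {a<..<x} t * indicator {t<..} y \<partial>lborel)
    = ennreal (min y x powr \<alpha> - min y a powr \<alpha>)"
proof (cases "y \<le> a")
  let ?h = "\<lambda>t. ennreal (\<alpha> * t powr (\<alpha> - 1)) * indicator {a<..<x} t * indicator {t<..} y"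
  case True
  have "(\<integral>\<^sup>+t. ?h t \<partial>lborel)
      = (\<integral>\<^sup>+(t::real). 0 \<partial>lborel)"
    by (intro nn_integral_cong) (use True in \<open>auto simp: indicator_def\<close>)
  then show ?thesis using True assms by simp
next
  let ?h = "\<lambda>t. ennreal (\<alpha> * t powr (\<alpha> - 1)) * indicator {a<..<x} t * indicator {t<..} y"
  case False
  define b where "b = min y x"
  have b: "a \<le> b" "min y a = a" using False assms by (auto simp: b_def)
  have "(\<integral>\<^sup>+t. ?h t \<partial>lborel)
      = (\<integral>\<^sup>+t. ennreal (\<alpha> * t powr (\<alpha> - 1)) * indicator {a..b} t \<partial>lborel)"
  proof (rule nn_integral_cong_AE)
    show "AE t in lborel. ?h t
        = ennreal (\<alpha> * t powr (\<alpha> - 1)) * indicator {a..b} t"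
      using AE_lborel_singleton[of a] AE_lborel_singleton[of b]
      by eventually_elim (auto simp: indicator_def b_def min_def split: if_splits)
  qed
  also have "\<dots> = ennreal (b powr \<alpha> - a powr \<alpha>)"
  proof (rule nn_integral_FTC_Icc[where F="\<lambda>t. t powr \<alpha>"])
    fix t assume t: "t \<in> {a..b}"
    then show "0 \<le> \<alpha> * t powr (\<alpha> - 1)" using \<alpha>_pos by simp
    show "((\<lambda>t. t powr \<alpha>) has_real_derivative \<alpha> * t powr (\<alpha> - 1)) (at t)"
      using t assms by (intro has_real_derivative_powr) auto
  qed (use b in auto)
  finally show ?thesis using b by (simp add: b_def)
qed

text \<open>Tonelli applied to the layer-cake formula. The integrand
  \<open>t powr (\<alpha> - 1) * tail t\<close> is what will be compared with
  \<open>L t / t\<close>.\<close>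

lemma trunc_moment_eq_integral:
  assumes ax: "0 < a" "a \<le> x"
  shows "set_integrable lborel {a<..<x} (\<lambda>t. t powr (\<alpha> - 1) * tail t)"
    and "trunc_moment x - trunc_moment a = \<alpha> * (LINT t:{a<..<x}|lborel. t powr (\<alpha> - 1) * tail t)"
proof -
  interpret P: pair_sigma_finite M lborel ..
  let ?h = "\<lambda>t \<omega>. ennreal (\<alpha> * t powr (\<alpha> - 1)) * indicator {a<..<x} t * indicator {t<..} \<bar>Y \<omega>\<bar>"
  let ?g = "\<lambda>t. indicator {a<..<x} t * (\<alpha> * (t powr (\<alpha> - 1) * tail t))"
  have d_nonneg: "0 \<le> min \<bar>Y \<omega>\<bar> x powr \<alpha> - min \<bar>Y \<omega>\<bar> a powr \<alpha>" for \<omega>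
    using ax \<alpha>_pos by (simp add: powr_mono2)
  have "ennreal (trunc_moment x - trunc_moment a) = ennreal (\<integral>\<omega>. min \<bar>Y \<omega>\<bar> x powr \<alpha> - min \<bar>Y \<omega>\<bar> a powr \<alpha> \<partial>M)"
    unfolding trunc_moment_def by (simp add: trunc_integrable)
  also have "\<dots> = (\<integral>\<^sup>+\<omega>. ennreal (min \<bar>Y \<omega>\<bar> x powr \<alpha> - min \<bar>Y \<omega>\<bar> a powr \<alpha>) \<partial>M)"
    using d_nonneg by (intro nn_integral_eq_integral[symmetric]) (auto simp: trunc_integrable)
  also have "\<dots> = (\<integral>\<^sup>+\<omega>. \<integral>\<^sup>+t. ?h t \<omega> \<partial>lborel \<partial>M)"
    by (intro nn_integral_cong min_powr_diff_eq_nn_integral[symmetric] ax)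
  also have "\<dots> = (\<integral>\<^sup>+t. \<integral>\<^sup>+\<omega>. ?h t \<omega> \<partial>M \<partial>lborel)"
    by (rule P.Fubini'[symmetric]) (simp add: greaterThan_def case_prod_unfold)
  also have "\<dots> = (\<integral>\<^sup>+t. ennreal (?g t) \<partial>lborel)"
  proof (intro nn_integral_cong)
    fix t :: real
    have "(\<integral>\<^sup>+\<omega>. ?h t \<omega> \<partial>M)
       = (\<integral>\<^sup>+\<omega>. ennreal (\<alpha> * t powr (\<alpha> - 1)) * indicator {a<..<x} t * indicator {\<omega>\<in>space M. \<bar>Y \<omega>\<bar> > t} \<omega> \<partial>M)"
      by (intro nn_integral_cong) (auto simp: indicator_def)
    also have "\<dots> = ennreal (\<alpha> * t powr (\<alpha> - 1)) * indicator {a<..<x} t * emeasure M {\<omega>\<in>space M. \<bar>Y \<omega>\<bar> > t}"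
      by (rule nn_integral_cmult_indicator) measurable
    also have "\<dots> = ennreal (?g t)"
      using \<alpha>_pos by (auto simp: indicator_def emeasure_eq_measure tail_def ennreal_mult[symmetric] mult.assoc)
    finally show "(\<integral>\<^sup>+\<omega>. ?h t \<omega> \<partial>M) = ennreal (?g t)" .
  qed
  finally have "(\<integral>\<^sup>+t. ennreal (?g t) \<partial>lborel) = ennreal (trunc_moment x - trunc_moment a)" ..
  moreover have "trunc_moment a \<le> trunc_moment x" by (rule trunc_moment_mono) (use ax in auto)
  moreover have "AE t in lborel. 0 \<le> ?g t"
    using \<alpha>_pos by (intro AE_I2) (simp add: tail_def)
  ultimately have g: "integrable lborel ?g \<and> (\<integral>t. ?g t \<partial>lborel) = trunc_moment x - trunc_moment a"
    by (subst nn_integral_eq_integrable[symmetric]) auto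
  have eq: "?g = (\<lambda>t. \<alpha> * (indicator {a<..<x} t *\<^sub>R (t powr (\<alpha> - 1) * tail t)))" by auto
  show "set_integrable lborel {a<..<x} (\<lambda>t. t powr (\<alpha> - 1) * tail t)"
    using g \<alpha>_pos unfolding eq set_integrable_def by simp
  show "trunc_moment x - trunc_moment a = \<alpha> * (LINT t:{a<..<x}|lborel. t powr (\<alpha> - 1) * tail t)"
    using g unfolding eq set_lebesgue_integral_def by simp
qed

end

section \<open>Independence and moments of the solution\<close>

lemma indep_rvs_distr_pair:
  fixes X :: "'a \<Rightarrow> 'b::topological_space" and Y :: "'a \<Rightarrow> 'c::topological_space"
  assumes M: "prob_space M" and ind: "indep_rvs M X Y"
  shows "distr M borel X \<Otimes>\<^sub>M distr M borel Y = distr M (borel \<Otimes>\<^sub>M borel) (\<lambda>\<omega>. (X \<omega>, Y \<omega>))"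
proof -
  interpret prob_space M by fact
  have [measurable]: "X \<in> borel_measurable M" "Y \<in> borel_measurable M"
    using ind by (auto simp: indep_rvs_def)
  interpret X: prob_space "distr M borel X" by (rule prob_space_distr) simp
  interpret Y: prob_space "distr M borel Y" by (rule prob_space_distr) simp
  show ?thesis
  proof (rule pair_measure_eqI)
    fix A B assume "A \<in> sets (distr M borel X)" "B \<in> sets (distr M borel Y)"
    then have [measurable]: "A \<in> sets borel" "B \<in> sets borel" by auto
    have "prob ((X -` A \<inter> space M) \<inter> (Y -` B \<inter> space M)) = prob (X -` A \<inter> space M) * prob (Y -` B \<inter> space M)"
      using ind unfolding indep_rvs_def by (intro indep_setD[where A="{X -` S \<inter> space M |S. S \<in> sets borel}" and B="{Y -` S \<inter> space M |S. S \<in> sets borel}"]) auto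
    moreover have "(\<lambda>\<omega>. (X \<omega>, Y \<omega>)) -` (A \<times> B) \<inter> space M = (X -` A \<inter> space M) \<inter> (Y -` B \<inter> space M)" by auto
    ultimately show "emeasure (distr M borel X) A * emeasure (distr M borel Y) B
        = emeasure (distr M (borel \<Otimes>\<^sub>M borel) (\<lambda>\<omega>. (X \<omega>, Y \<omega>))) (A \<times> B)"
      by (simp add: emeasure_distr emeasure_eq_measure ennreal_mult)
  qed (auto intro: X.sigma_finite_measure_axioms Y.sigma_finite_measure_axioms)
qed

lemma indep_rvs_nn_integral:
  fixes X :: "'a \<Rightarrow> 'b::topological_space" and Y :: "'a \<Rightarrow> 'c::topological_space"
  assumes M: "prob_space M" and ind: "indep_rvs M X Y"
    and [measurable]: "(\<lambda>(x, y). f x y) \<in> borel_measurable (borel \<Otimes>\<^sub>M borel)"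
  shows "(\<integral>\<^sup>+\<omega>. f (X \<omega>) (Y \<omega>) \<partial>M) = (\<integral>\<^sup>+\<omega>. (\<integral>\<^sup>+\<omega>'. f (X \<omega>') (Y \<omega>) \<partial>M) \<partial>M)"
proof -
  interpret prob_space M by fact
  have [measurable]: "X \<in> borel_measurable M" "Y \<in> borel_measurable M"
    using ind by (auto simp: indep_rvs_def)
  interpret X: prob_space "distr M borel X" by (rule prob_space_distr) simp
  interpret Y: prob_space "distr M borel Y" by (rule prob_space_distr) simp
  interpret P: pair_sigma_finite "distr M borel X" "distr M borel Y" ..
  have "(\<integral>\<^sup>+\<omega>. f (X \<omega>) (Y \<omega>) \<partial>M) = (\<integral>\<^sup>+z. (\<lambda>(x, y). f x y) z \<partial>distr M (borel \<Otimes>\<^sub>M borel) (\<lambda>\<omega>. (X \<omega>, Y \<omega>)))"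
    by (subst nn_integral_distr) auto
  also have "\<dots> = (\<integral>\<^sup>+z. (\<lambda>(x, y). f x y) z \<partial>(distr M borel X \<Otimes>\<^sub>M distr M borel Y))"
    unfolding indep_rvs_distr_pair[OF M ind] ..
  also have "\<dots> = (\<integral>\<^sup>+y. (\<integral>\<^sup>+x. f x y \<partial>distr M borel X) \<partial>distr M borel Y)"
    by (subst P.nn_integral_snd[symmetric]) auto
  also have "\<dots> = (\<integral>\<^sup>+\<omega>. (\<integral>\<^sup>+\<omega>'. f (X \<omega>') (Y \<omega>) \<partial>M) \<partial>M)"
    by (subst nn_integral_distr, measurable) (intro nn_integral_cong, subst nn_integral_distr, auto)
  finally show ?thesis .
qed

lemma indep_rvs_integral:
  fixes X :: "'a \<Rightarrow> 'b::topological_space" and Y :: "'a \<Rightarrow> 'c::topological_space" and f :: "'b \<Rightarrow> 'c \<Rightarrow> real"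
  assumes M: "prob_space M" and ind: "indep_rvs M X Y"
    and [measurable]: "(\<lambda>(x, y). f x y) \<in> borel_measurable (borel \<Otimes>\<^sub>M borel)"
    and bound: "\<And>x y. \<bar>f x y\<bar> \<le> C"
  shows "(\<integral>\<omega>. f (X \<omega>) (Y \<omega>) \<partial>M) = (\<integral>\<omega>. (\<integral>\<omega>'. f (X \<omega>') (Y \<omega>) \<partial>M) \<partial>M)"
    and "integrable M (\<lambda>\<omega>. (\<integral>\<omega>'. f (X \<omega>') (Y \<omega>) \<partial>M))"
proof -
  interpret prob_space M by fact
  have [measurable]: "X \<in> borel_measurable M" "Y \<in> borel_measurable M"
    using ind by (auto simp: indep_rvs_def)
  interpret X: prob_space "distr M borel X" by (rule prob_space_distr) simp
  interpret Y: prob_space "distr M borel Y" by (rule prob_space_distr) simp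
  interpret P: pair_prob_space "distr M borel X" "distr M borel Y" ..
  have int: "integrable (distr M borel X \<Otimes>\<^sub>M distr M borel Y) (\<lambda>(x, y). f x y)"
    by (rule P.integrable_const_bound[where B=C]) (use bound in auto)
  have "(\<integral>\<omega>. f (X \<omega>) (Y \<omega>) \<partial>M) = (\<integral>z. (\<lambda>(x, y). f x y) z \<partial>distr M (borel \<Otimes>\<^sub>M borel) (\<lambda>\<omega>. (X \<omega>, Y \<omega>)))"
    by (subst integral_distr) auto
  also have "\<dots> = (\<integral>z. (\<lambda>(x, y). f x y) z \<partial>(distr M borel X \<Otimes>\<^sub>M distr M borel Y))"
    unfolding indep_rvs_distr_pair[OF M ind] ..
  also have "\<dots> = (\<integral>y. (\<integral>x. f x y \<partial>distr M borel X) \<partial>distr M borel Y)"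
    by (rule P.integral_snd[symmetric, OF int])
  also have "\<dots> = (\<integral>y. (\<integral>\<omega>'. f (X \<omega>') y \<partial>M) \<partial>distr M borel Y)"
    by (intro Bochner_Integration.integral_cong refl, subst integral_distr) auto
  also have "\<dots> = (\<integral>\<omega>. (\<integral>\<omega>'. f (X \<omega>') (Y \<omega>) \<partial>M) \<partial>M)"
    by (subst integral_distr) auto
  finally show "(\<integral>\<omega>. f (X \<omega>) (Y \<omega>) \<partial>M) = (\<integral>\<omega>. (\<integral>\<omega>'. f (X \<omega>') (Y \<omega>) \<partial>M) \<partial>M)" .
  have "\<bar>\<integral>\<omega>'. f (X \<omega>') (Y \<omega>) \<partial>M\<bar> \<le> C" for \<omega>
  proof -
    have [measurable]: "(\<lambda>\<omega>'. f (X \<omega>') (Y \<omega>)) \<in> borel_measurable M" by measurable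
    have i: "integrable M (\<lambda>\<omega>'. f (X \<omega>') (Y \<omega>))"
      by (rule integrable_const_bound[where B=C]) (use bound in auto)
    have "\<bar>\<integral>\<omega>'. f (X \<omega>') (Y \<omega>) \<partial>M\<bar> \<le> (\<integral>\<omega>'. \<bar>f (X \<omega>') (Y \<omega>)\<bar> \<partial>M)" by (rule integral_abs_bound)
    also have "\<dots> \<le> (\<integral>\<omega>'. C \<partial>M)" by (intro integral_mono) (use i bound in auto)
    finally show ?thesis by (simp add: prob_space)
  qed
  then show "integrable M (\<lambda>\<omega>. (\<integral>\<omega>'. f (X \<omega>') (Y \<omega>) \<partial>M))"
    by (intro integrable_const_bound[where B=C]) auto
qed

section \<open>The tilted measure\<close>

locale tilted_multiplier = prob_space M for M :: "'a measure" +
  fixes A :: "'a \<Rightarrow> real" and \<alpha> \<epsilon> :: real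
  assumes A_meas [measurable]: "A \<in> borel_measurable M"
    and \<alpha>_pos: "\<alpha> > 0" and \<epsilon>_pos: "\<epsilon> > 0"
    and A_neg: "\<P>(\<omega> in M. A \<omega> < 0) > 0"
    and moment_\<alpha>: "(\<integral>\<^sup>+ \<omega>. ennreal (\<bar>A \<omega>\<bar> powr \<alpha>) \<partial>M) = 1"
    and moment_\<epsilon>: "(\<integral>\<^sup>+ \<omega>. ennreal (\<bar>A \<omega>\<bar> powr (\<alpha> + \<epsilon>)) \<partial>M) < \<infinity>"
    and log_int: "integrable M (\<lambda>\<omega>. \<bar>A \<omega>\<bar> powr \<alpha> * ln \<bar>A \<omega>\<bar>)"
    and not_arith: "\<not> arithmetic_law
      (distr (uniform_measure M {\<omega> \<in> space M. \<bar>A \<omega>\<bar> > 0}) borel (\<lambda>\<omega>. ln \<bar>A \<omega>\<bar>))"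
begin

text \<open>Moves the condition from the conditional law given \<open>|A| > 0\<close> to
  \<open>M\<close> restricted to \<open>A \<noteq> 0\<close>, which is also the form that null sets
  of the tilted measure take in \<open>AE_tilted_iff\<close>.\<close>

lemma not_AE_lattice:
  assumes d: "d > 0"
  shows "\<not> (AE \<omega> in M. A \<omega> \<noteq> 0 \<longrightarrow> (\<exists>k::int. ln \<bar>A \<omega>\<bar> = d * of_int k))"
proof
  assume AE: "AE \<omega> in M. A \<omega> \<noteq> 0 \<longrightarrow> (\<exists>k::int. ln \<bar>A \<omega>\<bar> = d * of_int k)"
  let ?S = "{\<omega> \<in> space M. \<bar>A \<omega>\<bar> > 0}"
  have S [measurable]: "?S \<in> sets M" by measurable
  have "\<P>(\<omega> in M. A \<omega> < 0) \<le> \<P>(\<omega> in M. \<bar>A \<omega>\<bar> > 0)"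
    by (rule finite_measure_mono) auto
  then have S_pos: "emeasure M ?S \<noteq> 0" using A_neg by (simp add: emeasure_eq_measure)
  have lattice: "{x. \<exists>k::int. x = d * of_int k} \<in> sets (borel :: real measure)"
  proof -
    have "{x. \<exists>k::int. x = d * of_int k} = (\<lambda>k::int. d * of_int k) ` UNIV" by auto
    then have "countable {x. \<exists>k::int. x = d * of_int k}" by (metis countable_image countableI_type)
    then show ?thesis by (rule sets.countable[rotated]) simp
  qed
  have "AE \<omega> in uniform_measure M ?S. \<exists>k::int. ln \<bar>A \<omega>\<bar> = d * of_int k"
  proof (rule AE_uniform_measureI)
    show "AE \<omega> in M. \<omega> \<in> ?S \<longrightarrow> (\<exists>k::int. ln \<bar>A \<omega>\<bar> = d * of_int k)"
      using AE by eventually_elim auto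
  qed simp
  then have "AE x in distr (uniform_measure M ?S) borel (\<lambda>\<omega>. ln \<bar>A \<omega>\<bar>). \<exists>k::int. x = d * of_int k"
    using lattice by (subst AE_distr_iff) auto
  then show False using not_arith d unfolding arithmetic_law_def by blast
qed

text \<open>The value \<open>ln 1 = 0\<close> lies in every lattice. This excludes equality in the
  two convexity arguments below.\<close>

lemma not_AE_abs_eq_1: "\<not> (AE \<omega> in M. \<bar>A \<omega>\<bar> = 1)"
proof
  assume "AE \<omega> in M. \<bar>A \<omega>\<bar> = 1"
  then have "AE \<omega> in M. A \<omega> \<noteq> 0 \<longrightarrow> (\<exists>k::int. ln \<bar>A \<omega>\<bar> = 1 * of_int k)"
    by eventually_elim (auto intro: exI[of _ 0])
  then show False using not_AE_lattice[of 1] by simp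
qed

lemma A_moment_le: "integrable M (\<lambda>\<omega>. \<bar>A \<omega>\<bar> powr \<beta>)" if "0 < \<beta>" "\<beta> \<le> \<alpha> + \<epsilon>"
proof (rule Bochner_Integration.integrable_bound)
  have "integrable M (\<lambda>\<omega>. \<bar>A \<omega>\<bar> powr (\<alpha> + \<epsilon>))"
    using moment_\<epsilon> by (intro integrableI_nonneg) auto
  then show "integrable M (\<lambda>\<omega>. 1 + \<bar>A \<omega>\<bar> powr (\<alpha> + \<epsilon>))" by simp
  show "AE \<omega> in M. norm (\<bar>A \<omega>\<bar> powr \<beta>) \<le> norm (1 + \<bar>A \<omega>\<bar> powr (\<alpha> + \<epsilon>))"
  proof (rule AE_I2)
    fix \<omega>
    have "\<bar>A \<omega>\<bar> powr \<beta> \<le> 1 + \<bar>A \<omega>\<bar> powr (\<alpha> + \<epsilon>)"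
    proof (cases "\<bar>A \<omega>\<bar> \<le> 1")
      case True
      then have "\<bar>A \<omega>\<bar> powr \<beta> \<le> 1 powr \<beta>" using that by (intro powr_mono2) auto
      then have "\<bar>A \<omega>\<bar> powr \<beta> \<le> 1" by simp
      moreover have "0 \<le> \<bar>A \<omega>\<bar> powr (\<alpha> + \<epsilon>)" by simp
      ultimately show ?thesis by linarith
    next
      case False
      then have "\<bar>A \<omega>\<bar> powr \<beta> \<le> \<bar>A \<omega>\<bar> powr (\<alpha> + \<epsilon>)" using that by (intro powr_mono) auto
      then show ?thesis by simp
    qed
    then show "norm (\<bar>A \<omega>\<bar> powr \<beta>) \<le> norm (1 + \<bar>A \<omega>\<bar> powr (\<alpha> + \<epsilon>))" by simp
  qed
qed measurable

lemma A_moment_\<alpha>: "integrable M (\<lambda>\<omega>. \<bar>A \<omega>\<bar> powr \<alpha>)" "(\<integral>\<omega>. \<bar>A \<omega>\<bar> powr \<alpha> \<partial>M) = 1"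
proof -
  show int: "integrable M (\<lambda>\<omega>. \<bar>A \<omega>\<bar> powr \<alpha>)" using \<alpha>_pos \<epsilon>_pos by (intro A_moment_le) auto
  have "ennreal (\<integral>\<omega>. \<bar>A \<omega>\<bar> powr \<alpha> \<partial>M) = 1"
    using nn_integral_eq_integral[OF int] moment_\<alpha> by simp
  then show "(\<integral>\<omega>. \<bar>A \<omega>\<bar> powr \<alpha> \<partial>M) = 1" by simp
qed

text \<open>Strict Jensen inequality for the concave power \<open>\<beta> / \<alpha>\<close> of a
  variable of mean 1: \<open>D\<close> is the gap between the tangent at 1 and the power.\<close>

lemma A_moment_less_1:
  assumes \<beta>: "0 < \<beta>" "\<beta> < \<alpha>"
  shows "(\<integral>\<omega>. \<bar>A \<omega>\<bar> powr \<beta> \<partial>M) < 1"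
proof -
  define p where "p = \<beta> / \<alpha>"
  have p: "0 < p" "p < 1" using \<beta> by (auto simp: p_def)
  have pow: "(\<bar>A \<omega>\<bar> powr \<alpha>) powr p = \<bar>A \<omega>\<bar> powr \<beta>" for \<omega>
    using \<alpha>_pos by (simp add: powr_powr p_def)
  define D where "D \<omega> = 1 + p * (\<bar>A \<omega>\<bar> powr \<alpha> - 1) - \<bar>A \<omega>\<bar> powr \<beta>" for \<omega>
  have D0: "0 \<le> D \<omega>" for \<omega>
    using powr_le_tangent[of p "\<bar>A \<omega>\<bar> powr \<alpha>"] p unfolding pow D_def by simp
  have D_int: "integrable M D" and D_val: "(\<integral>\<omega>. D \<omega> \<partial>M) = 1 - (\<integral>\<omega>. \<bar>A \<omega>\<bar> powr \<beta> \<partial>M)"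
    unfolding D_def using A_moment_\<alpha> A_moment_le[of \<beta>] \<beta> \<epsilon>_pos by (auto simp: prob_space)
  have "(\<integral>\<omega>. D \<omega> \<partial>M) \<noteq> 0"
  proof
    assume "(\<integral>\<omega>. D \<omega> \<partial>M) = 0"
    then have "AE \<omega> in M. D \<omega> = 0" using integral_nonneg_eq_0_iff_AE[OF D_int] D0 by simp
    then have "AE \<omega> in M. \<bar>A \<omega>\<bar> = 1"
    proof eventually_elim
      case (elim \<omega>)
      have "\<bar>A \<omega>\<bar> powr \<alpha> = 1"
        by (rule powr_eq_tangent_imp[OF p]) (use elim in \<open>auto simp: pow D_def\<close>)
      then have "(\<bar>A \<omega>\<bar> powr \<alpha>) powr (1 / \<alpha>) = 1" by simp
      then show ?case using \<alpha>_pos by (simp add: powr_powr)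
    qed
    then show False using not_AE_abs_eq_1 by simp
  qed
  moreover have "0 \<le> (\<integral>\<omega>. D \<omega> \<partial>M)" using D0 by simp
  ultimately show ?thesis unfolding D_val by simp
qed

text \<open>With \<open>y = |A| powr (- \<alpha>)\<close>, \<alpha> times the drift is the mean of
  \<open>D = |A| powr \<alpha> * (y - 1 - ln y) \<ge> 0\<close>, because
  \<open>|A| powr \<alpha> - 1\<close> has mean 0. On \<open>A = 0\<close> the defining formula
  gives \<open>D = 1\<close>.\<close>

lemma drift_pos: "(\<integral>\<omega>. \<bar>A \<omega>\<bar> powr \<alpha> * ln \<bar>A \<omega>\<bar> \<partial>M) > 0"
proof -
  let ?y = "\<lambda>\<omega>. \<bar>A \<omega>\<bar> powr (- \<alpha>)"
  let ?x = "\<lambda>\<omega>. \<bar>A \<omega>\<bar> powr \<alpha> * ln \<bar>A \<omega>\<bar>"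
  define D where "D \<omega> = \<alpha> * (?x \<omega>) - (\<bar>A \<omega>\<bar> powr \<alpha> - 1)" for \<omega>
  have D_alt: "D \<omega> = \<bar>A \<omega>\<bar> powr \<alpha> * ((?y \<omega> - 1) - ln (?y \<omega>))" if "A \<omega> \<noteq> 0" for \<omega>
  proof -
    have 1: "ln (?y \<omega>) = - \<alpha> * ln \<bar>A \<omega>\<bar>" using that by (simp add: ln_powr)
    have 2: "\<bar>A \<omega>\<bar> powr \<alpha> * ?y \<omega> = 1" using that by (simp add: powr_add[symmetric])
    show ?thesis unfolding D_def 1 right_diff_distrib 2 by (simp add: algebra_simps)
  qed
  have D0: "0 \<le> D \<omega>" for \<omega>
  proof (cases "A \<omega> = 0")
    case False
    then have "ln (?y \<omega>) \<le> ?y \<omega> - 1" by (intro ln_le_minus_one) simp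
    then show ?thesis unfolding D_alt[OF False] by (intro mult_nonneg_nonneg) (simp, linarith)
  qed (simp add: D_def)
  have D_int: "integrable M D" and D_val: "(\<integral>\<omega>. D \<omega> \<partial>M) = \<alpha> * (\<integral>\<omega>. ?x \<omega> \<partial>M)"
    unfolding D_def using A_moment_\<alpha> log_int by (auto simp: prob_space)
  have "(\<integral>\<omega>. D \<omega> \<partial>M) \<noteq> 0"
  proof
    assume "(\<integral>\<omega>. D \<omega> \<partial>M) = 0"
    then have "AE \<omega> in M. D \<omega> = 0" using integral_nonneg_eq_0_iff_AE[OF D_int] D0 by simp
    then have "AE \<omega> in M. \<bar>A \<omega>\<bar> = 1"
    proof eventually_elim
      case (elim \<omega>)
      have nz: "A \<omega> \<noteq> 0"
      proof
        assume "A \<omega> = 0"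
        then show False using elim by (simp add: D_def)
      qed
      with elim have "ln (?y \<omega>) = ?y \<omega> - 1" unfolding D_alt[OF nz] by simp
      then have "?y \<omega> = 1" using nz by (intro ln_eq_minus_one) auto
      then have "ln (?y \<omega>) = 0" by simp
      then show ?case using nz \<alpha>_pos by (simp add: ln_powr)
    qed
    then show False using not_AE_abs_eq_1 by simp
  qed
  moreover have "0 \<le> (\<integral>\<omega>. D \<omega> \<partial>M)" using D0 by simp
  ultimately have "\<alpha> * (\<integral>\<omega>. ?x \<omega> \<partial>M) > 0" unfolding D_val by linarith
  then show ?thesis using \<alpha>_pos by (simp add: zero_less_mult_iff)
qed

text \<open>The event \<open>A = 0\<close> gets mass 0, so the default value \<open>ln 0 = 0\<close>
  is invisible under this measure.\<close>

definition tilted :: "'a measure" where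
  "tilted = density M (\<lambda>\<omega>. ennreal (\<bar>A \<omega>\<bar> powr \<alpha>))"

lemma sets_tilted [simp, measurable_cong]: "sets tilted = sets M"
  by (simp add: tilted_def)

lemma prob_space_tilted: "prob_space tilted"
proof
  show "emeasure tilted (space tilted) = 1"
    using moment_\<alpha> by (simp add: tilted_def emeasure_density cong: nn_integral_cong)
qed

lemma AE_tilted_iff: "(AE \<omega> in tilted. P \<omega>) \<longleftrightarrow> (AE \<omega> in M. A \<omega> \<noteq> 0 \<longrightarrow> P \<omega>)"
proof -
  have "(AE \<omega> in tilted. P \<omega>) \<longleftrightarrow> (AE \<omega> in M. 0 < ennreal (\<bar>A \<omega>\<bar> powr \<alpha>) \<longrightarrow> P \<omega>)"
    unfolding tilted_def by (rule AE_density) measurable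
  also have "\<dots> \<longleftrightarrow> (AE \<omega> in M. A \<omega> \<noteq> 0 \<longrightarrow> P \<omega>)" by simp
  finally show ?thesis .
qed

lemma integral_tilted:
  fixes f :: "'a \<Rightarrow> real"
  assumes [measurable]: "f \<in> borel_measurable M"
  shows "(\<integral>\<omega>. f \<omega> \<partial>tilted) = (\<integral>\<omega>. \<bar>A \<omega>\<bar> powr \<alpha> * f \<omega> \<partial>M)"
    and "integrable tilted f \<longleftrightarrow> integrable M (\<lambda>\<omega>. \<bar>A \<omega>\<bar> powr \<alpha> * f \<omega>)"
  unfolding tilted_def by (subst integral_density integrable_density; simp)+

text \<open>The density turns \<open>exp (\<delta> * ln |A|)\<close> and
  \<open>exp (- \<delta> * ln |A|)\<close> into the powers \<open>\<alpha> + \<delta>\<close> and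
  \<open>\<alpha> - \<delta>\<close> of \<open>|A|\<close>, both of which are integrable
  orders.\<close>

lemma exp_moment_tilted:
  assumes "\<delta> > 0" "\<delta> < \<alpha>" "\<delta> \<le> \<epsilon>"
  shows "integrable tilted (\<lambda>\<omega>. exp (\<delta> * \<bar>ln \<bar>A \<omega>\<bar>\<bar>))"
proof -
  let ?s = "\<lambda>\<omega>. \<bar>A \<omega>\<bar> powr (\<alpha> + \<delta>) + \<bar>A \<omega>\<bar> powr (\<alpha> - \<delta>)"
  let ?e = "\<lambda>\<omega>. \<bar>A \<omega>\<bar> powr \<alpha> * exp (\<delta> * \<bar>ln \<bar>A \<omega>\<bar>\<bar>)"
  have "integrable M (\<lambda>\<omega>. ?e \<omega>)"
  proof (rule Bochner_Integration.integrable_bound)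
    show "integrable M (\<lambda>\<omega>. ?s \<omega>)"
      using assms by (intro Bochner_Integration.integrable_add A_moment_le) auto
    have "?e \<omega> \<le> ?s \<omega>" for \<omega>
    proof (cases "A \<omega> = 0")
      case False
      have "exp (\<delta> * \<bar>ln \<bar>A \<omega>\<bar>\<bar>) \<le> exp (\<delta> * ln \<bar>A \<omega>\<bar>) + exp ((- \<delta>) * ln \<bar>A \<omega>\<bar>)"
        by (cases "ln \<bar>A \<omega>\<bar> \<ge> 0") (auto simp: abs_if)
      also have "\<dots> = \<bar>A \<omega>\<bar> powr \<delta> + \<bar>A \<omega>\<bar> powr (- \<delta>)" using False by (simp add: powr_def)
      finally have "?e \<omega> \<le> \<bar>A \<omega>\<bar> powr \<alpha> * (\<bar>A \<omega>\<bar> powr \<delta> + \<bar>A \<omega>\<bar> powr (- \<delta>))"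
        by (intro mult_left_mono) auto
      also have "\<dots> = ?s \<omega>"
        by (simp add: distrib_left powr_add[symmetric])
      finally show ?thesis .
    qed simp
    then show "AE \<omega> in M. norm (?e \<omega>) \<le> norm (?s \<omega>)"
      by (intro AE_I2) simp
  qed measurable
  then show ?thesis by (subst integral_tilted) auto
qed

end

section \<open>Moments of the solution below order \<alpha>\<close>

text \<open>The coefficient of \<open>x\<close> can be taken arbitrarily close to 1 at the expense
  of \<open>y\<close>, so that it does not spoil a contraction factor below 1. The two terms cover
  \<open>|y| \<le> \<eta> * |x|\<close> and its complement.\<close>

lemma powr_add_le_near:
  fixes x y \<beta> \<eta> :: real
  assumes "\<beta> > 0" "\<eta> > 0"
  shows "\<bar>x + y\<bar> powr \<beta> \<le> (1 + \<eta>) powr \<beta> * \<bar>x\<bar> powr \<beta> + (1 / \<eta> + 1) powr \<beta> * \<bar>y\<bar> powr \<beta>"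
proof (cases "\<bar>y\<bar> \<le> \<eta> * \<bar>x\<bar>")
  case True
  have "\<bar>x + y\<bar> powr \<beta> \<le> ((1 + \<eta>) * \<bar>x\<bar>) powr \<beta>"
  proof (rule powr_mono2)
    show "\<bar>x + y\<bar> \<le> (1 + \<eta>) * \<bar>x\<bar>" using True abs_triangle_ineq[of x y] by (simp add: algebra_simps)
  qed (use assms in auto)
  also have "\<dots> = (1 + \<eta>) powr \<beta> * \<bar>x\<bar> powr \<beta>" using assms by (simp add: powr_mult)
  finally show ?thesis by (simp add: add_increasing2)
next
  case False
  then have "\<bar>x\<bar> \<le> 1 / \<eta> * \<bar>y\<bar>" using assms by (simp add: field_simps)
  have "\<bar>x + y\<bar> powr \<beta> \<le> ((1 / \<eta> + 1) * \<bar>y\<bar>) powr \<beta>"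
  proof (rule powr_mono2)
    show "\<bar>x + y\<bar> \<le> (1 / \<eta> + 1) * \<bar>y\<bar>"
      using \<open>\<bar>x\<bar> \<le> 1 / \<eta> * \<bar>y\<bar>\<close> abs_triangle_ineq[of x y] unfolding distrib_right by linarith
  qed (use assms in auto)
  also have "\<dots> = (1 / \<eta> + 1) powr \<beta> * \<bar>y\<bar> powr \<beta>" using assms by (simp add: powr_mult add_nonneg_nonneg)
  finally show ?thesis by (simp add: add_increasing)
qed

text \<open>Formally the equation gives
  \<open>E |R| powr \<beta> \<le> g * E |R| powr \<beta> + e\<close> with \<open>g < 1\<close>. As
  the moment might be infinite, this cannot be rearranged directly; bounds on truncations, uniform
  in the level, and Fatou's lemma replace it.\<close>

lemma (in prob_space) affine_solution_moment:
  fixes A B R :: "'a \<Rightarrow> real"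
  assumes [measurable]: "A \<in> borel_measurable M" "B \<in> borel_measurable M"
    and sol: "solves_affine_equation M A B R"
    and \<beta>: "\<beta> > 0"
    and A_int: "integrable M (\<lambda>\<omega>. \<bar>A \<omega>\<bar> powr \<beta>)" and A_less: "(\<integral>\<omega>. \<bar>A \<omega>\<bar> powr \<beta> \<partial>M) < 1"
    and B_int: "integrable M (\<lambda>\<omega>. \<bar>B \<omega>\<bar> powr \<beta>)"
  shows "integrable M (\<lambda>\<omega>. \<bar>R \<omega>\<bar> powr \<beta>)"
proof -
  interpret PP: pair_prob_space M M ..
  have ind: "indep_rvs M R (\<lambda>\<omega>. (A \<omega>, B \<omega>))"
    and law: "distr M borel R = distr M borel (\<lambda>\<omega>. A \<omega> * R \<omega> + B \<omega>)"
    using sol by (auto simp: solves_affine_equation_def)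
  have [measurable]: "R \<in> borel_measurable M" using ind by (simp add: indep_rvs_def)
  define c where "c = (\<integral>\<omega>. \<bar>A \<omega>\<bar> powr \<beta> \<partial>M)"
  have c: "0 \<le> c" "c < 1" using A_less by (auto simp: c_def)
  obtain \<eta> where \<eta>: "\<eta> > 0" "(1 + \<eta>) powr \<beta> * c < 1"
  proof -
    have "((\<lambda>\<eta>. (1 + \<eta>) powr \<beta> * c) \<longlongrightarrow> (1 + 0) powr \<beta> * c) (at_right 0)"
      by (intro tendsto_intros) auto
    then have "eventually (\<lambda>\<eta>. (1 + \<eta>) powr \<beta> * c < 1) (at_right 0)"
      by (rule order_tendstoD) (use c in simp)
    then obtain b where "b > 0" "\<And>\<eta>. 0 < \<eta> \<Longrightarrow> \<eta> < b \<Longrightarrow> (1 + \<eta>) powr \<beta> * c < 1"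
      by (auto simp: eventually_at_right_field)
    from this(1) this(2)[of "b / 2"] show thesis by (intro that[of "b / 2"]) auto
  qed
  define a where "a = (1 + \<eta>) powr \<beta>"
  define d where "d = (1 / \<eta> + 1) powr \<beta>"
  define g where "g = a * c"
  have g: "0 \<le> g" "g < 1" using \<eta> c by (auto simp: g_def a_def)
  have a: "a \<ge> 0" and d: "d \<ge> 0" by (auto simp: a_def d_def)
  define e where "e = d * (\<integral>\<omega>. \<bar>B \<omega>\<bar> powr \<beta> \<partial>M)"
  let ?r = "\<lambda>K \<omega>. \<bar>R \<omega>\<bar> powr \<beta> * indicator {..K} (\<bar>R \<omega>\<bar> powr \<beta>)"
  have min_int: "integrable M (\<lambda>\<omega>. min (f \<omega>) K)" if "\<And>\<omega>. 0 \<le> f \<omega>" "K \<ge> 0" and [measurable]: "f \<in> borel_measurable M" for f :: "'a \<Rightarrow> real" and K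
    by (rule integrable_const_bound[where B=K]) (use that in auto)
  \<comment> \<open>Truncation at \<open>K\<close> makes both sides of the equation finite. The terms with \<open>\<bar>R\<bar> powr \<beta> > K\<close> have the
    right sign and are dropped.\<close>
  have bound: "(\<integral>\<omega>. ?r K \<omega> \<partial>M) \<le> e / (1 - g)"
    and bint: "integrable M (\<lambda>\<omega>. ?r K \<omega>)" if K: "K \<ge> 0" for K
  proof -
    have ineq: "min (\<bar>A \<omega> * R \<omega> + B \<omega>\<bar> powr \<beta>) K \<le> min (a * \<bar>A \<omega>\<bar> powr \<beta> * \<bar>R \<omega>\<bar> powr \<beta>) K + d * \<bar>B \<omega>\<bar> powr \<beta>" for \<omega>
    proof -
      have "\<bar>A \<omega> * R \<omega> + B \<omega>\<bar> powr \<beta> \<le> a * \<bar>A \<omega> * R \<omega>\<bar> powr \<beta> + d * \<bar>B \<omega>\<bar> powr \<beta>"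
        unfolding a_def d_def by (rule powr_add_le_near[OF \<beta> \<eta>(1)])
      moreover have "a * \<bar>A \<omega> * R \<omega>\<bar> powr \<beta> = a * \<bar>A \<omega>\<bar> powr \<beta> * \<bar>R \<omega>\<bar> powr \<beta>"
        by (simp add: abs_mult powr_mult)
      moreover have "0 \<le> d * \<bar>B \<omega>\<bar> powr \<beta>" using d by simp
      ultimately show ?thesis by linarith
    qed
    have i1: "integrable M (\<lambda>\<omega>. min (\<bar>A \<omega> * R \<omega> + B \<omega>\<bar> powr \<beta>) K)"
      by (rule min_int) (use K in auto)
    have i2: "integrable M (\<lambda>\<omega>. min (a * \<bar>A \<omega>\<bar> powr \<beta> * \<bar>R \<omega>\<bar> powr \<beta>) K)"
      by (rule min_int) (use K a in auto)
    have i3: "integrable M (\<lambda>\<omega>. min (\<bar>R \<omega>\<bar> powr \<beta>) K)"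
      by (rule min_int) (use K in auto)
    have i4: "integrable M (\<lambda>\<omega>. min (g * \<bar>R \<omega>\<bar> powr \<beta>) K)"
      by (rule min_int) (use K g in auto)
    have "(\<integral>\<omega>. min (\<bar>R \<omega>\<bar> powr \<beta>) K \<partial>M) = (\<integral>x. min (\<bar>x\<bar> powr \<beta>) K \<partial>distr M borel R)"
      by (subst integral_distr) auto
    also have "\<dots> = (\<integral>\<omega>. min (\<bar>A \<omega> * R \<omega> + B \<omega>\<bar> powr \<beta>) K \<partial>M)"
      unfolding law by (subst integral_distr) auto
    also have "\<dots> \<le> (\<integral>\<omega>. min (a * \<bar>A \<omega>\<bar> powr \<beta> * \<bar>R \<omega>\<bar> powr \<beta>) K + d * \<bar>B \<omega>\<bar> powr \<beta> \<partial>M)"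
      using i1 i2 B_int ineq by (intro integral_mono) auto
    also have "\<dots> = (\<integral>\<omega>. min (a * \<bar>A \<omega>\<bar> powr \<beta> * \<bar>R \<omega>\<bar> powr \<beta>) K \<partial>M) + e"
      unfolding e_def using i2 B_int by simp
    \<comment> \<open>By independence \<open>A\<close> is averaged with \<open>R\<close> held fixed,
      and the mean of a minimum is at most the minimum of the means.\<close>
    also have "(\<integral>\<omega>. min (a * \<bar>A \<omega>\<bar> powr \<beta> * \<bar>R \<omega>\<bar> powr \<beta>) K \<partial>M) \<le> (\<integral>\<omega>. min (g * \<bar>R \<omega>\<bar> powr \<beta>) K \<partial>M)"
    proof -
      let ?f = "\<lambda>\<omega> \<omega>'. min (a * \<bar>A \<omega>\<bar> powr \<beta> * \<bar>R \<omega>'\<bar> powr \<beta>) K"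
      have K': "\<bar>min (a * s powr \<beta> * t powr \<beta>) K\<bar> \<le> K" for s t :: real
        using K a by (auto simp: min_def)
      have "(\<integral>\<omega>. min (a * \<bar>A \<omega>\<bar> powr \<beta> * \<bar>R \<omega>\<bar> powr \<beta>) K \<partial>M)
          = (\<integral>\<omega>. (\<integral>\<omega>'. ?f \<omega> \<omega>' \<partial>M) \<partial>M)"
        using indep_rvs_integral(1)[OF prob_space_axioms ind, of "\<lambda>r z. min (a * \<bar>fst z\<bar> powr \<beta> * \<bar>r\<bar> powr \<beta>) K" K] K'
        by (simp add: borel_prod[symmetric] case_prod_unfold)
      also have "\<dots> = (\<integral>\<omega>'. (\<integral>\<omega>. ?f \<omega> \<omega>' \<partial>M) \<partial>M)"
        by (rule PP.Fubini_integral, rule PP.integrable_const_bound[where B=K])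
          (use K' in \<open>auto simp: case_prod_unfold\<close>)
      also have "\<dots> \<le> (\<integral>\<omega>'. min (g * \<bar>R \<omega>'\<bar> powr \<beta>) K \<partial>M)"
      proof (intro integral_mono i4)
        show "integrable M (\<lambda>\<omega>'. (\<integral>\<omega>. ?f \<omega> \<omega>' \<partial>M))"
          by (rule PP.integrable_snd[of ?f], rule PP.integrable_const_bound[where B=K])
            (use K' in \<open>auto simp: case_prod_unfold\<close>)
        fix \<omega>'
        have j: "integrable M (\<lambda>\<omega>. ?f \<omega> \<omega>')"
          by (rule min_int) (use K a in auto)
        have "(\<integral>\<omega>. ?f \<omega> \<omega>' \<partial>M) \<le> (\<integral>\<omega>. a * \<bar>A \<omega>\<bar> powr \<beta> * \<bar>R \<omega>'\<bar> powr \<beta> \<partial>M)"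
          using j A_int by (intro integral_mono) auto
        moreover have "(\<integral>\<omega>. a * \<bar>A \<omega>\<bar> powr \<beta> * \<bar>R \<omega>'\<bar> powr \<beta> \<partial>M) = g * \<bar>R \<omega>'\<bar> powr \<beta>"
          using A_int by (simp add: g_def c_def)
        moreover have "(\<integral>\<omega>. ?f \<omega> \<omega>' \<partial>M) \<le> (\<integral>\<omega>. K \<partial>M)"
          using j by (intro integral_mono) auto
        moreover have "(\<integral>\<omega>. K \<partial>M) = K" by (simp add: prob_space)
        ultimately show "(\<integral>\<omega>. ?f \<omega> \<omega>' \<partial>M) \<le> min (g * \<bar>R \<omega>'\<bar> powr \<beta>) K"
          by linarith
      qed
      finally show ?thesis .
    qed
    finally have "(\<integral>\<omega>. min (\<bar>R \<omega>\<bar> powr \<beta>) K - min (g * \<bar>R \<omega>\<bar> powr \<beta>) K \<partial>M) \<le> e"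
      using i3 i4 by simp
    show bint: "integrable M (\<lambda>\<omega>. ?r K \<omega>)"
      by (rule integrable_const_bound[where B=K]) (use K in \<open>auto simp: indicator_def\<close>)
    have "(\<integral>\<omega>. (1 - g) * (?r K \<omega>) \<partial>M)
      \<le> (\<integral>\<omega>. min (\<bar>R \<omega>\<bar> powr \<beta>) K - min (g * \<bar>R \<omega>\<bar> powr \<beta>) K \<partial>M)"
    proof (intro integral_mono Bochner_Integration.integrable_mult_right bint Bochner_Integration.integrable_diff i3 i4)
      fix \<omega>
      have "g * \<bar>R \<omega>\<bar> powr \<beta> \<le> 1 * \<bar>R \<omega>\<bar> powr \<beta>" using g by (intro mult_right_mono) auto
      then show "(1 - g) * (?r K \<omega>) \<le> min (\<bar>R \<omega>\<bar> powr \<beta>) K - min (g * \<bar>R \<omega>\<bar> powr \<beta>) K"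
        by (cases "\<bar>R \<omega>\<bar> powr \<beta> \<le> K") (auto simp: algebra_simps)
    qed
    also have "\<dots> \<le> e" by fact
    finally have "(1 - g) * (\<integral>\<omega>. ?r K \<omega> \<partial>M) \<le> e"
      by (simp only: integral_mult_right_zero)
    then show "(\<integral>\<omega>. ?r K \<omega> \<partial>M) \<le> e / (1 - g)"
      using g by (simp add: pos_le_divide_eq mult.commute)
  qed
  have "(\<integral>\<^sup>+\<omega>. ennreal (\<bar>R \<omega>\<bar> powr \<beta>) \<partial>M)
      = (\<integral>\<^sup>+\<omega>. liminf (\<lambda>n. ennreal (?r (real n) \<omega>)) \<partial>M)"
  proof (intro nn_integral_cong lim_imp_Liminf[symmetric])
    fix \<omega>
    obtain N :: nat where "\<bar>R \<omega>\<bar> powr \<beta> \<le> real N" using real_arch_simple by blast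
    then have "eventually (\<lambda>n. ennreal (\<bar>R \<omega>\<bar> powr \<beta>) = ennreal (?r (real n) \<omega>)) sequentially"
      unfolding eventually_sequentially by (intro exI[of _ N]) auto
    then show "(\<lambda>n. ennreal (?r (real n) \<omega>)) \<longlonglongrightarrow> ennreal (\<bar>R \<omega>\<bar> powr \<beta>)"
      by (rule Lim_transform_eventually[OF tendsto_const])
  qed simp
  also have "\<dots> \<le> liminf (\<lambda>n. \<integral>\<^sup>+\<omega>. ennreal (?r (real n) \<omega>) \<partial>M)"
    by (rule nn_integral_liminf) measurable
  also have "\<dots> \<le> liminf (\<lambda>n. ennreal (e / (1 - g)))"
  proof (intro Liminf_mono always_eventually allI)
    fix n
    have "(\<integral>\<^sup>+\<omega>. ennreal (?r (real n) \<omega>) \<partial>M)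
      = ennreal (\<integral>\<omega>. ?r (real n) \<omega> \<partial>M)"
      by (rule nn_integral_eq_integral[OF bint]) auto
    also have "\<dots> \<le> ennreal (e / (1 - g))" by (intro ennreal_leI bound) simp
    finally show "(\<integral>\<^sup>+\<omega>. ennreal (?r (real n) \<omega>) \<partial>M) \<le> ennreal (e / (1 - g))" .
  qed
  also have "\<dots> < \<infinity>" by (simp add: Liminf_const)
  finally show ?thesis by (intro integrableI_nonneg) auto
qed

section \<open>The tail of the solution\<close>

lemma powr_mult_powr_le_add:
  fixes x y p :: real
  assumes "0 \<le> x" "0 \<le> y" "0 \<le> p" "p \<le> 1"
  shows "x powr p * y powr (1 - p) \<le> x + y"
proof -
  have "x powr p * y powr (1 - p) \<le> max x y powr p * max x y powr (1 - p)"
    using assms by (intro mult_mono powr_mono2) auto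
  also have "\<dots> = max x y" using assms by (simp add: powr_add[symmetric])
  also have "\<dots> \<le> x + y" using assms by simp
  finally show ?thesis .
qed

text \<open>The index \<open>True\<close> stands for the negative sign, so that \<open>sg (b \<noteq> c) = sg b * sg c\<close>.\<close>

definition sg :: "bool \<Rightarrow> real" where "sg b = (if b then -1 else 1)"

lemma abs_sg [simp]: "\<bar>sg b * x\<bar> = \<bar>x\<bar>" by (simp add: sg_def)

locale affine_heavy_tail = tilted_multiplier M A \<alpha> \<epsilon> + infinite_moment_tail M B \<alpha>
  for M :: "'a measure" and A B :: "'a \<Rightarrow> real" and \<alpha> \<epsilon> :: real +
  fixes R :: "'a \<Rightarrow> real"
  assumes sol: "solves_affine_equation M A B R"
begin

lemma indep: "indep_rvs M R (\<lambda>\<omega>. (A \<omega>, B \<omega>))"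
  using sol by (simp add: solves_affine_equation_def)

lemma law: "distr M borel R = distr M borel (\<lambda>\<omega>. A \<omega> * R \<omega> + B \<omega>)"
  using sol by (simp add: solves_affine_equation_def)

lemma R_meas [measurable]: "R \<in> borel_measurable M"
  using indep by (simp add: indep_rvs_def)

lemma B_moment: "0 < \<beta> \<Longrightarrow> \<beta> < \<alpha> \<Longrightarrow> integrable M (\<lambda>\<omega>. \<bar>B \<omega>\<bar> powr \<beta>)"
  using regularly_varying_tail_moment[OF Y_meas reg] tail_pos unfolding tail_def by blast

lemma R_moment: "0 < \<beta> \<Longrightarrow> \<beta> < \<alpha> \<Longrightarrow> integrable M (\<lambda>\<omega>. \<bar>R \<omega>\<bar> powr \<beta>)"
  using \<epsilon>_pos by (intro affine_solution_moment[OF A_meas Y_meas sol] A_moment_le A_moment_less_1 B_moment) auto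

text \<open>\<open>R\<close> is independent of \<open>(A, B)\<close> and has a moment of order
  \<theta>. \<open>A\<close> and \<open>B\<close> may be dependent, and their product has total
  degree \<alpha>, the order at which the moment of \<open>B\<close> is infinite; the moment of
  \<open>A\<close> of order \<open>\<alpha> + \<epsilon>\<close> leaves for \<open>B\<close> an
  order below \<alpha>.\<close>

lemma cross_moment:
  assumes \<theta>: "0 < \<theta>" "\<theta> < \<alpha>"
  shows "integrable M (\<lambda>\<omega>. \<bar>A \<omega> * R \<omega>\<bar> powr \<theta> * \<bar>B \<omega>\<bar> powr (\<alpha> - \<theta>))"
proof (rule integrableI_nonneg)
  \<comment> \<open>Young exponents: \<open>p\<close> turns
    \<open>|A| powr (\<alpha> + \<epsilon>)\<close> into \<open>|A| powr \<theta>\<close>, and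
    \<open>1 - p\<close> turns \<open>|B| powr \<gamma>\<close> into
    \<open>|B| powr (\<alpha> - \<theta>)\<close>. Since \<open>\<epsilon> > 0\<close>,
    \<open>\<alpha> * p < \<theta>\<close>, which says \<open>\<gamma> < \<alpha>\<close>.\<close>
  define p where "p = \<theta> / (\<alpha> + \<epsilon>)"
  define \<gamma> where "\<gamma> = (\<alpha> - \<theta>) / (1 - p)"
  have ae: "\<alpha> + \<epsilon> > 0" using \<alpha>_pos \<epsilon>_pos by simp
  have p: "0 \<le> p" "p < 1" using \<theta> \<epsilon>_pos ae by (auto simp: p_def field_simps)
  have "\<alpha> * p < \<theta>" using \<theta> \<epsilon>_pos ae by (simp add: p_def field_simps)
  then have \<gamma>: "0 < \<gamma>" "\<gamma> < \<alpha>" using p \<theta> by (auto simp: \<gamma>_def field_simps)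
  let ?ab = "\<lambda>\<omega>. \<bar>A \<omega>\<bar> powr \<theta> * \<bar>B \<omega>\<bar> powr (\<alpha> - \<theta>)"
  let ?s = "\<lambda>\<omega>. \<bar>A \<omega>\<bar> powr (\<alpha> + \<epsilon>) + \<bar>B \<omega>\<bar> powr \<gamma>"
  have le: "?ab \<omega> \<le> ?s \<omega>" for \<omega>
    using powr_mult_powr_le_add[of "\<bar>A \<omega>\<bar> powr (\<alpha> + \<epsilon>)" "\<bar>B \<omega>\<bar> powr \<gamma>" p] p ae
    by (simp add: powr_powr p_def[symmetric] \<gamma>_def) (simp add: p_def)
  have int: "integrable M (\<lambda>\<omega>. ?ab \<omega>)"
  proof (rule Bochner_Integration.integrable_bound)
    show "integrable M (\<lambda>\<omega>. ?s \<omega>)"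
      using ae \<gamma> by (intro Bochner_Integration.integrable_add A_moment_le B_moment) auto
    show "AE \<omega> in M. norm (?ab \<omega>) \<le> norm (?s \<omega>)"
      using le by (intro AE_I2) (simp add: abs_mult)
  qed measurable
  have "(\<integral>\<^sup>+\<omega>. ennreal (\<bar>A \<omega> * R \<omega>\<bar> powr \<theta> * \<bar>B \<omega>\<bar> powr (\<alpha> - \<theta>)) \<partial>M)
      = (\<integral>\<^sup>+\<omega>. ennreal (\<bar>R \<omega>\<bar> powr \<theta>) * ennreal (?ab \<omega>) \<partial>M)"
    by (intro nn_integral_cong) (simp add: abs_mult powr_mult ennreal_mult[symmetric] mult_ac)
  also have "\<dots> = (\<integral>\<^sup>+\<omega>. (\<integral>\<^sup>+\<omega>'. ennreal (\<bar>R \<omega>'\<bar> powr \<theta>) * ennreal (?ab \<omega>) \<partial>M) \<partial>M)"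
    using indep_rvs_nn_integral[OF prob_space_axioms indep, of "\<lambda>r z. ennreal (\<bar>r\<bar> powr \<theta>) * ennreal (\<bar>fst z\<bar> powr \<theta> * \<bar>snd z\<bar> powr (\<alpha> - \<theta>))"]
    by (simp add: borel_prod[symmetric] case_prod_unfold)
  also have "\<dots> = (\<integral>\<^sup>+\<omega>'. ennreal (\<bar>R \<omega>'\<bar> powr \<theta>) \<partial>M) * (\<integral>\<^sup>+\<omega>. ennreal (?ab \<omega>) \<partial>M)"
    by (subst nn_integral_multc; simp add: nn_integral_cmult)
  also have "\<dots> < \<infinity>"
    using R_moment[OF \<theta>] int
    by (subst nn_integral_eq_integral, simp, simp)+ (simp add: ennreal_mult_less_top)
  finally show "(\<integral>\<^sup>+\<omega>. ennreal (\<bar>A \<omega> * R \<omega>\<bar> powr \<theta> * \<bar>B \<omega>\<bar> powr (\<alpha> - \<theta>)) \<partial>M) < \<infinity>" .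
qed auto

abbreviation \<phi> :: "real \<Rightarrow> real \<Rightarrow> real" where "\<phi> s \<equiv> trunc_powr \<alpha> (exp s)"

definition V :: "bool \<Rightarrow> real \<Rightarrow> real" where
  "V b s = (\<integral>\<omega>. \<phi> s (sg b * R \<omega>) \<partial>M)"

definition w :: "bool \<Rightarrow> real \<Rightarrow> real" where
  "w b s = exp (\<alpha> * s) * \<P>(\<omega> in M. sg b * R \<omega> > exp s)"

definition m :: "bool \<Rightarrow> real \<Rightarrow> real" where
  "m b s = (\<integral>\<omega>. \<phi> s (sg b * B \<omega>) \<partial>M)"

text \<open>Chosen so that the renewal equation is exact: by the equality of laws the first term is
  \<open>V b s\<close>, and by independence the second is the tilted transition operator applied to
  \<open>V\<close>.\<close>

definition G :: "bool \<Rightarrow> real \<Rightarrow> real" where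
  "G b s = (\<integral>\<omega>. \<phi> s (sg b * (A \<omega> * R \<omega> + B \<omega>)) \<partial>M)
    - (\<integral>\<omega>. \<phi> s (sg b * (A \<omega> * R \<omega>)) \<partial>M)"

lemma V_mono: "mono (V b)"
  unfolding V_def using \<alpha>_pos
  by (intro monoI integral_mono integrable_trunc_powr trunc_powr_increment(3)) auto

lemma m_mono: "mono (m b)"
  unfolding m_def using \<alpha>_pos
  by (intro monoI integral_mono integrable_trunc_powr trunc_powr_increment(3)) auto

lemma m_sum: "m True s + m False s = trunc_moment (exp s)"
proof -
  have "m True s + m False s = (\<integral>\<omega>. \<phi> s (B \<omega>) + \<phi> s (- B \<omega>) \<partial>M)"
    unfolding m_def sg_def by (subst Bochner_Integration.integral_add) (auto intro!: integrable_trunc_powr \<alpha>_pos)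
  also have "\<dots> = trunc_moment (exp s)"
    unfolding trunc_moment_def by (simp add: trunc_powr_abs[OF \<alpha>_pos])
  finally show ?thesis .
qed

lemma V_increments:
  assumes "s \<le> t"
  shows "w b t * (1 - exp (- (\<alpha> * (t - s)))) \<le> V b t - V b s"
    and "V b t - V b s \<le> w b s * (exp (\<alpha> * (t - s)) - 1)"
proof -
  define d where "d = exp t powr \<alpha> - exp s powr \<alpha>"
  have d: "d = exp (\<alpha> * t) * (1 - exp (- (\<alpha> * (t - s))))" "d = exp (\<alpha> * s) * (exp (\<alpha> * (t - s)) - 1)"
    unfolding d_def exp_powr_real right_diff_distrib exp_add[symmetric] mult_1_right by (simp_all add: algebra_simps)
  have st: "0 < exp s" "exp s \<le> exp t" using assms by auto
  note inc = expectation_trunc_powr_increment[of "\<lambda>\<omega>. sg b * R \<omega>", OF _ \<alpha>_pos st, folded V_def d_def]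
  have "\<P>(\<omega> in M. sg b * R \<omega> > exp t) * d \<le> V b t - V b s" by (rule inc) measurable
  then show "w b t * (1 - exp (- (\<alpha> * (t - s)))) \<le> V b t - V b s"
    unfolding d(1) w_def by (simp add: mult_ac)
  have "V b t - V b s \<le> \<P>(\<omega> in M. sg b * R \<omega> > exp s) * d" by (rule inc) measurable
  then show "V b t - V b s \<le> w b s * (exp (\<alpha> * (t - s)) - 1)"
    unfolding d(2) w_def by (simp add: mult_ac)
qed

text \<open>Multiplication by \<open>a\<close> rescales the cap by homogeneity and flips the sign
  index when \<open>a < 0\<close>. At \<open>a = 0\<close> both sides vanish, whatever the value of
  \<open>ln 0\<close>.\<close>

lemma inner_integral:
  "(\<integral>\<omega>'. \<phi> s (sg b * (a * R \<omega>')) \<partial>M) = \<bar>a\<bar> powr \<alpha> * V (b \<noteq> (a < 0)) (s - ln \<bar>a\<bar>)"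
proof (cases "a = 0")
  case True
  then show ?thesis using \<alpha>_pos by (simp add: trunc_powr_def)
next
  case False
  have "\<phi> s (sg b * (a * R \<omega>'))
      = \<bar>a\<bar> powr \<alpha> * trunc_powr \<alpha> (exp (s - ln \<bar>a\<bar>)) (sg (b \<noteq> (a < 0)) * R \<omega>')" for \<omega>'
  proof -
    have e1: "sg b * (a * R \<omega>') = \<bar>a\<bar> * (sg (b \<noteq> (a < 0)) * R \<omega>')"
      by (auto simp: sg_def abs_if)
    have e2: "exp (s - ln \<bar>a\<bar>) = exp s / \<bar>a\<bar>" using False by (simp add: exp_diff)
    show ?thesis unfolding e1 e2 by (rule trunc_powr_scale) (use False in auto)
  qed
  then show ?thesis unfolding V_def by simp
qed

lemma renewal_equation:
  shows "integrable tilted (\<lambda>\<omega>. V (b \<noteq> (A \<omega> < 0)) (s - ln \<bar>A \<omega>\<bar>))"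
    and "V b s = (\<integral>\<omega>. V (b \<noteq> (A \<omega> < 0)) (s - ln \<bar>A \<omega>\<bar>) \<partial>tilted) + G b s"
proof -
  have meas: "(\<lambda>\<omega>. V (b \<noteq> (A \<omega> < 0)) (s - ln \<bar>A \<omega>\<bar>)) \<in> borel_measurable M"
    by (rule measurable_shift_flip[of V, OF borel_measurable_mono[OF V_mono]]; measurable)
  have bound: "\<bar>\<phi> s (sg b * (fst z * r))\<bar> \<le> exp s powr \<alpha>" for r z
    using trunc_powr_le[OF \<alpha>_pos, of "exp s"] by (simp add: trunc_powr_nonneg)
  have fm: "(\<lambda>(r, z). \<phi> s (sg b * (fst z * r))) \<in> borel_measurable (borel \<Otimes>\<^sub>M (borel :: (real \<times> real) measure))"
    unfolding borel_prod[symmetric] case_prod_unfold by measurable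
  note ii = indep_rvs_integral[OF prob_space_axioms indep fm bound, unfolded fst_conv inner_integral]
  show "integrable tilted (\<lambda>\<omega>. V (b \<noteq> (A \<omega> < 0)) (s - ln \<bar>A \<omega>\<bar>))"
    unfolding integral_tilted(2)[OF meas] by (rule ii(2))
  have "V b s = (\<integral>x. \<phi> s (sg b * x) \<partial>distr M borel R)"
    unfolding V_def by (subst integral_distr) auto
  also have "\<dots> = (\<integral>\<omega>. \<phi> s (sg b * (A \<omega> * R \<omega> + B \<omega>)) \<partial>M)"
    unfolding law by (subst integral_distr) auto
  finally show "V b s = (\<integral>\<omega>. V (b \<noteq> (A \<omega> < 0)) (s - ln \<bar>A \<omega>\<bar>) \<partial>tilted) + G b s"
    unfolding integral_tilted(1)[OF meas] G_def ii(1) by simp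
qed

lemma G_close: "\<exists>K. \<forall>b s. \<bar>G b s - m b s\<bar> \<le> K"
proof -
  \<comment> \<open>Both \<theta> and \<open>\<alpha> - \<theta>\<close> must lie strictly between 0
    and \<alpha> for \<open>cross_moment\<close>, and \<open>trunc_powr_add\<close> asks for
    \<open>\<theta> \<le> 1\<close>.\<close>
  define \<theta> where "\<theta> = min 1 \<alpha> / 2"
  have \<theta>: "0 < \<theta>" "\<theta> \<le> 1" "\<theta> < \<alpha>" using \<alpha>_pos by (auto simp: \<theta>_def)
  define k where "k \<omega> = (max 1 \<alpha> * 2 powr \<alpha> + 1) * (\<bar>A \<omega> * R \<omega>\<bar> powr \<theta> * \<bar>B \<omega>\<bar> powr (\<alpha> - \<theta>) + \<bar>A \<omega> * R \<omega>\<bar> powr (\<alpha> - \<theta>) * \<bar>B \<omega>\<bar> powr \<theta>)" for \<omega>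
  have int: "integrable M k"
    unfolding k_def using cross_moment[of \<theta>] cross_moment[of "\<alpha> - \<theta>"] \<theta>
    by (intro Bochner_Integration.integrable_mult_right Bochner_Integration.integrable_add) auto
  have "\<bar>G b s - m b s\<bar> \<le> (\<integral>\<omega>. k \<omega> \<partial>M)" for b s
  proof -
    let ?t = "\<lambda>\<omega>. \<phi> s (sg b * (A \<omega> * R \<omega> + B \<omega>)) - \<phi> s (sg b * (A \<omega> * R \<omega>))
        - \<phi> s (sg b * B \<omega>)"
    have ti: "integrable M ?t"
      by (intro Bochner_Integration.integrable_diff integrable_trunc_powr \<alpha>_pos) auto
    have "G b s - m b s = (\<integral>\<omega>. ?t \<omega> \<partial>M)"
      unfolding G_def m_def by (simp add: integrable_trunc_powr \<alpha>_pos)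
    then have "\<bar>G b s - m b s\<bar> = \<bar>\<integral>\<omega>. ?t \<omega> \<partial>M\<bar>" by (rule arg_cong)
    also have "\<dots> \<le> (\<integral>\<omega>. \<bar>?t \<omega>\<bar> \<partial>M)" by (rule integral_abs_bound)
    also have "\<dots> \<le> (\<integral>\<omega>. k \<omega> \<partial>M)"
    proof (intro integral_mono int integrable_abs ti)
      fix \<omega>
      show "\<bar>?t \<omega>\<bar> \<le> k \<omega>"
        using trunc_powr_add[OF \<theta>, of "exp s" "sg b * (A \<omega> * R \<omega>)" "sg b * B \<omega>"]
        by (simp add: k_def distrib_left)
    qed
    finally show ?thesis .
  qed
  then show ?thesis by blast
qed

text \<open>Markov's inequality with the moment of \<open>R\<close> of order
  \<open>\<alpha> - \<beta>\<close>.\<close>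

lemma w_le_powr:
  assumes \<beta>: "0 < \<beta>" "\<beta> < \<alpha>"
  shows "\<exists>C. \<forall>b s. w b s \<le> C * exp (\<beta> * s)"
proof (intro exI allI)
  fix b s
  define \<gamma> where "\<gamma> = \<alpha> - \<beta>"
  have \<gamma>: "0 < \<gamma>" "\<gamma> < \<alpha>" using \<beta> by (auto simp: \<gamma>_def)
  have "\<P>(\<omega> in M. sg b * R \<omega> > exp s) * exp (\<gamma> * s) = (\<integral>\<omega>. indicator {\<omega>\<in>space M. sg b * R \<omega> > exp s} \<omega> * exp (\<gamma> * s) \<partial>M)"
    by simp
  also have "\<dots> \<le> (\<integral>\<omega>. \<bar>R \<omega>\<bar> powr \<gamma> \<partial>M)"
  proof (intro integral_mono R_moment \<gamma>)
    fix \<omega>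
    show "indicator {\<omega>\<in>space M. sg b * R \<omega> > exp s} \<omega> * exp (\<gamma> * s) \<le> \<bar>R \<omega>\<bar> powr \<gamma>"
    proof (cases "sg b * R \<omega> > exp s")
      case True
      have "sg b * R \<omega> \<le> \<bar>sg b * R \<omega>\<bar>" by (rule abs_ge_self)
      then have "exp s \<le> \<bar>R \<omega>\<bar>" using True unfolding abs_sg by linarith
      then have "exp s powr \<gamma> \<le> \<bar>R \<omega>\<bar> powr \<gamma>" using \<gamma> by (intro powr_mono2) auto
      then show ?thesis by (auto simp: indicator_def exp_powr_real mult.commute)
    qed (simp add: indicator_def)
  qed (intro integrable_mult_left integrable_const_bound[where B=1]; auto simp: indicator_def)
  finally have le: "\<P>(\<omega> in M. sg b * R \<omega> > exp s) * exp (\<gamma> * s) \<le> (\<integral>\<omega>. \<bar>R \<omega>\<bar> powr \<gamma> \<partial>M)" .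
  have "w b s = \<P>(\<omega> in M. sg b * R \<omega> > exp s) * exp (\<gamma> * s) * exp (\<beta> * s)"
    unfolding w_def \<gamma>_def by (simp add: exp_add[symmetric] algebra_simps)
  also have "\<dots> \<le> (\<integral>\<omega>. \<bar>R \<omega>\<bar> powr \<gamma> \<partial>M) * exp (\<beta> * s)" by (intro mult_right_mono le) simp
  finally show "w b s \<le> (\<integral>\<omega>. \<bar>R \<omega>\<bar> powr (\<alpha> - \<beta>) \<partial>M) * exp (\<beta> * s)" unfolding \<gamma>_def .
qed

theorem solution_tail:
  "((\<lambda>s. w b s / (1 + trunc_moment (exp s))) \<longlongrightarrow>
     1 / (2 * \<alpha> * (\<integral>\<omega>. \<bar>A \<omega>\<bar> powr \<alpha> * ln \<bar>A \<omega>\<bar> \<partial>M))) at_top"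
proof -
  obtain K where K: "\<And>b s. \<bar>G b s - m b s\<bar> \<le> K" using G_close by blast
  define \<delta> where "\<delta> = min \<epsilon> (\<alpha> / 2)"
  have \<delta>: "\<delta> > 0" "\<delta> < \<alpha>" "\<delta> \<le> \<epsilon>" using \<alpha>_pos \<epsilon>_pos by (auto simp: \<delta>_def)
  have ms: "1 + m True s + m False s = 1 + trunc_moment (exp s)" for s
    using m_sum[of s] by simp
  interpret T: signed_renewal_slow tilted "\<lambda>\<omega>. ln \<bar>A \<omega>\<bar>" "\<lambda>\<omega>. A \<omega> < 0" V w G \<alpha> \<delta>
    "\<integral>\<omega>. \<bar>A \<omega>\<bar> powr \<alpha> * ln \<bar>A \<omega>\<bar> \<partial>M" m K
  proof (intro signed_renewal_slow.intro signed_renewal.intro prob_space_tilted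
      signed_renewal_axioms.intro signed_renewal_slow_axioms.intro)
    show "(\<lambda>\<omega>. ln \<bar>A \<omega>\<bar>) \<in> borel_measurable tilted" "Measurable.pred tilted (\<lambda>\<omega>. A \<omega> < 0)"
      by measurable
    show "\<not> (AE \<omega> in tilted. \<exists>k::int. ln \<bar>A \<omega>\<bar> = d * of_int k)" if "d > 0" for d
      unfolding AE_tilted_iff by (rule not_AE_lattice[OF that])
    show "\<not> (AE \<omega> in tilted. \<not> A \<omega> < 0)"
      unfolding AE_tilted_iff
    proof
      assume "AE \<omega> in M. A \<omega> \<noteq> 0 \<longrightarrow> \<not> A \<omega> < 0"
      then have "AE \<omega> in M. \<not> A \<omega> < 0" by eventually_elim auto
      then have "\<P>(\<omega> in M. A \<omega> < 0) = 0" by (subst prob_eq_0) auto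
      then show False using A_neg by simp
    qed
    show "integrable tilted (\<lambda>\<omega>. exp (\<delta> * \<bar>ln \<bar>A \<omega>\<bar>\<bar>))" by (rule exp_moment_tilted[OF \<delta>])
    show "(\<integral>\<omega>. ln \<bar>A \<omega>\<bar> \<partial>tilted) = (\<integral>\<omega>. \<bar>A \<omega>\<bar> powr \<alpha> * ln \<bar>A \<omega>\<bar> \<partial>M)"
      by (rule integral_tilted(1)) measurable
    show "integrable tilted (\<lambda>\<omega>. V (b \<noteq> (A \<omega> < 0)) (s - ln \<bar>A \<omega>\<bar>))" for b s
      by (rule renewal_equation)
    show "V b s = (\<integral>\<omega>. V (b \<noteq> (A \<omega> < 0)) (s - ln \<bar>A \<omega>\<bar>) \<partial>tilted) + G b s" for b s
      by (rule renewal_equation)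
    show "0 \<le> w b s" for b s by (simp add: w_def)
    show "0 \<le> m b s" for b s by (simp add: m_def trunc_powr_nonneg)
    show "w b s \<le> exp (\<alpha> * s)" for b s by (simp add: w_def mult_left_le)
    show "((\<lambda>s. (1 + m True (s + h) + m False (s + h)) / (1 + m True s + m False s)) \<longlongrightarrow> 1) at_top"
      if "h \<ge> 0" for h unfolding ms by (rule trunc_moment_slow[OF that])
    show "filterlim (\<lambda>s. 1 + m True s + m False s) at_top at_top"
      unfolding ms
      by (intro filterlim_tendsto_add_at_top[OF tendsto_const] filterlim_compose[OF trunc_moment_at_top exp_at_top])
  qed (use \<alpha>_pos \<delta>(1) drift_pos K m_mono w_le_powr in \<open>auto intro: V_increments\<close>)
  show ?thesis using T.w_asymp[of b] unfolding T.l_def ms .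
qed

end

section \<open>From truncated moments to \<open>Ltilde\<close>, and the conclusion\<close>

text \<open>Merges the cases \<open>c = 0\<close> and \<open>c \<noteq> 0\<close> into one limit.
  Asymptotic equivalence counts \<open>0 / 0\<close> as 1, so \<open>g\<close> must not vanish
  eventually.\<close>

lemma asymp_equiv_const_ratio:
  assumes "asymp_equiv_const f c g" and "eventually (\<lambda>x. g x \<noteq> 0) at_top"
  shows "((\<lambda>x. f x / g x) \<longlongrightarrow> c) at_top"
proof (cases "c = 0")
  case True
  then show ?thesis using assms by (simp add: asymp_equiv_const_def)
next
  case False
  then have "f \<sim>[at_top] (\<lambda>x. c * g x)" using assms(1) by (simp add: asymp_equiv_const_def)
  moreover have "eventually (\<lambda>x. f x \<noteq> 0 \<or> c * g x \<noteq> 0) at_top"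
    using assms(2) by eventually_elim (use False in simp)
  ultimately have "((\<lambda>x. f x / (c * g x)) \<longlongrightarrow> 1) at_top" by (rule asymp_equivD_strong)
  from tendsto_mult[OF tendsto_const[of c] this] show ?thesis using False by simp
qed

lemma Ltilde_split:
  assumes int: "\<And>x. x > 0 \<Longrightarrow> set_integrable lborel {0<..<x} (\<lambda>t. L t / t)" and "0 < a" "a < x"
  shows "set_integrable lborel {a<..<x} (\<lambda>t. L t / t)"
    and "Ltilde L x = Ltilde L a + (LINT t:{a<..<x}|lborel. L t / t)"
proof -
  show i: "set_integrable lborel {a<..<x} (\<lambda>t. L t / t)"
    by (rule set_integrable_subset[OF int[of x]]) (use assms in auto)
  have "(LINT t:{0<..<x}|lborel. L t / t) = (LINT t:{0<..<a} \<union> {a<..<x}|lborel. L t / t)"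
    unfolding set_lebesgue_integral_def
  proof (rule integral_cong_AE)
    show "AE t in lborel. indicat_real {0<..<x} t *\<^sub>R (L t / t) = indicat_real ({0<..<a} \<union> {a<..<x}) t *\<^sub>R (L t / t)"
      using AE_lborel_singleton[of a] by eventually_elim (use assms in \<open>auto simp: indicator_def\<close>)
    show "(\<lambda>t. indicat_real {0<..<x} t *\<^sub>R (L t / t)) \<in> borel_measurable lborel"
      using int[of x] assms unfolding set_integrable_def by (auto intro: borel_measurable_integrable)
    have "set_integrable lborel ({0<..<a} \<union> {a<..<x}) (\<lambda>t. L t / t)"
      by (rule set_integrable_subset[OF int[of x]]) (use assms in auto)
    then show "(\<lambda>t. indicat_real ({0<..<a} \<union> {a<..<x}) t *\<^sub>R (L t / t)) \<in> borel_measurable lborel"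
      unfolding set_integrable_def by (rule borel_measurable_integrable)
  qed
  also have "\<dots> = (LINT t:{0<..<a}|lborel. L t / t) + (LINT t:{a<..<x}|lborel. L t / t)"
    by (rule set_integral_Un[OF _ int i]) (use assms in auto)
  finally show "Ltilde L x = Ltilde L a + (LINT t:{a<..<x}|lborel. L t / t)" by (simp add: Ltilde_def)
qed

text \<open>Beyond some \<open>a\<close> the integrands of \<open>trunc_moment / \<alpha>\<close>
  and \<open>Ltilde\<close> agree up to factors \<open>1 - e\<close> and \<open>1 + e\<close>. The
  contributions below \<open>a\<close> are constants, which are negligible because the infinite
  moment drives both functions to infinity.\<close>

lemma (in infinite_moment_tail) trunc_moment_asymp_Ltilde:
  assumes L_pos: "\<And>x. x > 0 \<Longrightarrow> L x > 0"
    and int: "\<And>x. x > 0 \<Longrightarrow> set_integrable lborel {0<..<x} (\<lambda>t. L t / t)"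
    and ratio: "((\<lambda>t. t powr \<alpha> * tail t / L t) \<longlongrightarrow> 1) at_top"
  shows "((\<lambda>x. (1 + trunc_moment x) / Ltilde L x) \<longlongrightarrow> \<alpha>) at_top"
    and "eventually (\<lambda>x. Ltilde L x > 0) at_top"
proof -
  have close: "\<exists>C. eventually (\<lambda>x. \<bar>trunc_moment x / \<alpha> - Ltilde L x\<bar> \<le> C + e * Ltilde L x) at_top"
    if e: "0 < e" "e < 1" for e
  proof -
    have "eventually (\<lambda>t. 1 - e < t powr \<alpha> * tail t / L t \<and> t powr \<alpha> * tail t / L t < 1 + e) at_top"
      using order_tendstoD[OF ratio] e by (intro eventually_conj) auto
    then obtain t0 where t0: "\<And>t. t \<ge> t0 \<Longrightarrow> 1 - e < t powr \<alpha> * tail t / L t \<and> t powr \<alpha> * tail t / L t < 1 + e"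
      by (auto simp: eventually_at_top_linorder)
    define a where "a = max 1 t0"
    have a: "a > 0" "a \<ge> t0" by (auto simp: a_def)
    have pw: "(1 - e) * (L t / t) \<le> t powr (\<alpha> - 1) * tail t" "t powr (\<alpha> - 1) * tail t \<le> (1 + e) * (L t / t)" if "t > a" for t
    proof -
      have t: "t > 0" "t \<ge> t0" using that a by auto
      have eq: "t powr (\<alpha> - 1) * tail t = t powr \<alpha> * tail t / t" using t by (simp add: powr_diff)
      have "(1 - e) * L t \<le> t powr \<alpha> * tail t" "t powr \<alpha> * tail t \<le> (1 + e) * L t"
        using t0[OF t(2)] L_pos[OF t(1)] by (auto simp: field_simps)
      then show "(1 - e) * (L t / t) \<le> t powr (\<alpha> - 1) * tail t" "t powr (\<alpha> - 1) * tail t \<le> (1 + e) * (L t / t)"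
        unfolding eq using t by (auto simp: divide_right_mono)
    qed
    define J where "J x = (LINT t:{a<..<x}|lborel. L t / t)" for x
    have Jle: "(1 - e) * J x \<le> (trunc_moment x - trunc_moment a) / \<alpha>" "(trunc_moment x - trunc_moment a) / \<alpha> \<le> (1 + e) * J x"
      if x: "x > a" for x
    proof -
      have i1: "set_integrable lborel {a<..<x} (\<lambda>t. L t / t)" by (rule Ltilde_split(1)[OF int a(1) x])
      have i2: "set_integrable lborel {a<..<x} (\<lambda>t. t powr (\<alpha> - 1) * tail t)"
        by (rule trunc_moment_eq_integral(1)) (use a x in auto)
      have i3: "set_integrable lborel {a<..<x} (\<lambda>t. c * (L t / t))" for c
        using i1 by (rule set_integrable_mult_right)
      have eq: "(trunc_moment x - trunc_moment a) / \<alpha> = (LINT t:{a<..<x}|lborel. t powr (\<alpha> - 1) * tail t)"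
        using trunc_moment_eq_integral(2)[of a x] a x \<alpha>_pos by simp
      have J: "c * J x = (LINT t:{a<..<x}|lborel. c * (L t / t))" for c
        unfolding J_def by (rule set_integral_mult_right[symmetric])
      show "(1 - e) * J x \<le> (trunc_moment x - trunc_moment a) / \<alpha>"
        unfolding eq J by (rule set_integral_mono[OF i3 i2]) (use pw in auto)
      show "(trunc_moment x - trunc_moment a) / \<alpha> \<le> (1 + e) * J x"
        unfolding eq J by (rule set_integral_mono[OF i2 i3]) (use pw in auto)
    qed
    have La: "Ltilde L a \<ge> 0"
      unfolding Ltilde_def set_lebesgue_integral_def
      using L_pos by (intro integral_nonneg_AE AE_I2) (auto simp: indicator_def less_imp_le)
    have ta: "trunc_moment a / \<alpha> \<ge> 0" using trunc_moment_nonneg[of a] \<alpha>_pos by simp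
    have "\<bar>trunc_moment x / \<alpha> - Ltilde L x\<bar> \<le> (trunc_moment a / \<alpha> + Ltilde L a) + e * Ltilde L x" if x: "x > a" for x
    proof -
      have Lx: "Ltilde L x = Ltilde L a + J x" unfolding J_def by (rule Ltilde_split(2)[OF int a(1) x])
      have "0 \<le> e * Ltilde L a" using e La by simp
      then show ?thesis
        using Jle[OF x] La ta unfolding Lx diff_divide_distrib by (simp add: algebra_simps abs_le_iff)
    qed
    then show ?thesis
      by (intro exI[of _ "trunc_moment a / \<alpha> + Ltilde L a"] eventually_mono[OF eventually_gt_at_top[of a]])
  qed
  have tm_inf: "filterlim (\<lambda>x. trunc_moment x / \<alpha>) at_top at_top"
    using filterlim_tendsto_pos_mult_at_top[OF tendsto_const[of "1 / \<alpha>"] _ trunc_moment_at_top] \<alpha>_pos by simp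
  have L_inf: "filterlim (Ltilde L) at_top at_top"
    unfolding filterlim_at_top
  proof
    fix Z :: real
    obtain C where C: "eventually (\<lambda>x. \<bar>trunc_moment x / \<alpha> - Ltilde L x\<bar> \<le> C + 1/2 * Ltilde L x) at_top"
      using close[of "1/2"] by auto
    \<comment> \<open>From \<open>C\<close> one gets
      \<open>trunc_moment x / \<alpha> \<le> C + 3/2 * Ltilde L x\<close>, whence this
      threshold.\<close>
    have "eventually (\<lambda>x. 3/2 * Z + C \<le> trunc_moment x / \<alpha>) at_top"
      using tm_inf unfolding filterlim_at_top by blast
    with C show "eventually (\<lambda>x. Z \<le> Ltilde L x) at_top" by eventually_elim linarith
  qed
  then show pos: "eventually (\<lambda>x. Ltilde L x > 0) at_top" unfolding filterlim_at_top_dense by blast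
  have "((\<lambda>x. trunc_moment x / \<alpha> / Ltilde L x) \<longlongrightarrow> 1) at_top"
  proof (rule tendstoI)
    fix \<epsilon> :: real assume \<epsilon>: "\<epsilon> > 0"
    \<comment> \<open>One \<open>e\<close> is the relative error in \<open>close\<close>, another
      absorbs the constant \<open>C\<close> once \<open>Ltilde L x > C / e\<close>; together they
      stay within \<epsilon>.\<close>
    define e where "e = min (1/2) (\<epsilon> / 2)"
    have e: "0 < e" "e < 1" "e \<le> \<epsilon> / 2" using \<epsilon> by (auto simp: e_def)
    obtain C where C: "eventually (\<lambda>x. \<bar>trunc_moment x / \<alpha> - Ltilde L x\<bar> \<le> C + e * Ltilde L x) at_top"
      using close[OF e(1,2)] by blast
    have "eventually (\<lambda>x. C / e < Ltilde L x) at_top" using L_inf unfolding filterlim_at_top_dense by blast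
    with C pos show "eventually (\<lambda>x. dist (trunc_moment x / \<alpha> / Ltilde L x) 1 < \<epsilon>) at_top"
    proof eventually_elim
      case (elim x)
      have "C < e * Ltilde L x" using elim(3) e by (simp add: field_simps)
      then have "\<bar>trunc_moment x / \<alpha> - Ltilde L x\<bar> < 2 * e * Ltilde L x" using elim(1) by linarith
      also have "\<dots> \<le> \<epsilon> * Ltilde L x" using e elim(2) by (intro mult_right_mono) auto
      finally have "\<bar>trunc_moment x / \<alpha> - Ltilde L x\<bar> / Ltilde L x < \<epsilon>"
        using elim(2) by (simp add: pos_divide_less_eq)
      moreover have "trunc_moment x / \<alpha> / Ltilde L x - 1 = (trunc_moment x / \<alpha> - Ltilde L x) / Ltilde L x"
        using elim(2) by (simp add: field_simps)
      ultimately show ?case using elim(2) by (simp add: dist_real_def abs_divide)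
    qed
  qed
  from tendsto_mult[OF tendsto_const[of \<alpha>] this]
  have 1: "((\<lambda>x. trunc_moment x / Ltilde L x) \<longlongrightarrow> \<alpha>) at_top" using \<alpha>_pos by simp
  have 2: "((\<lambda>x. 1 / Ltilde L x) \<longlongrightarrow> 0) at_top"
    by (intro tendsto_divide_0[OF tendsto_const] filterlim_at_top_imp_at_infinity L_inf)
  from tendsto_add[OF 2 1] show "((\<lambda>x. (1 + trunc_moment x) / Ltilde L x) \<longlongrightarrow> \<alpha>) at_top"
    by (simp add: add_divide_distrib)
qed

theorem theorem5p2:
  fixes M :: "'a measure" and A B R :: "'a \<Rightarrow> real"
    and L :: "real \<Rightarrow> real" and \<alpha> \<rho> p q :: real
  assumes "prob_space M"
    and "A \<in> borel_measurable M" and "B \<in> borel_measurable M"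
    and "\<alpha> > 0"
    and "\<P>(\<omega> in M. A \<omega> < 0) > 0"
    and "ext_expectation M (\<lambda>\<omega>. elog \<bar>A \<omega>\<bar>) < 0"
    and "(\<integral>\<^sup>+ \<omega>. ennreal (\<bar>A \<omega>\<bar> powr \<alpha>) \<partial>M) = 1"
    and "integrable M (\<lambda>\<omega>. \<bar>A \<omega>\<bar> powr \<alpha> * ln \<bar>A \<omega>\<bar>)"
    and "\<rho> = (\<integral>\<omega>. \<bar>A \<omega>\<bar> powr \<alpha> * ln \<bar>A \<omega>\<bar> \<partial>M)"
    and "\<not> arithmetic_law
           (distr (uniform_measure M {\<omega> \<in> space M. \<bar>A \<omega>\<bar> > 0}) borel (\<lambda>\<omega>. ln \<bar>A \<omega>\<bar>))"
    and "\<exists>\<epsilon>>0. (\<integral>\<^sup>+ \<omega>. ennreal (\<bar>A \<omega>\<bar> powr (\<alpha> + \<epsilon>)) \<partial>M) < \<infinity>"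
    and "slowly_varying L"
    and "\<forall>x>0. set_integrable lborel {0<..<x} (\<lambda>t. L t / t)"
    and "p \<ge> 0" and "q \<ge> 0" and "p + q = 1"
    and "asymp_equiv_const (\<lambda>t. \<P>(\<omega> in M. B \<omega> > t)) p (\<lambda>t. t powr (-\<alpha>) * L t)"
    and "asymp_equiv_const (\<lambda>t. \<P>(\<omega> in M. B \<omega> < -t)) q (\<lambda>t. t powr (-\<alpha>) * L t)"
    and "(\<integral>\<^sup>+ \<omega>. ennreal (\<bar>B \<omega>\<bar> powr \<alpha>) \<partial>M) = \<infinity>"
    and "solves_affine_equation M A B R"
  shows "(\<lambda>x. x powr \<alpha> * \<P>(\<omega> in M. R \<omega> > x)) \<sim>[at_top] (\<lambda>x. Ltilde L x / (2 * \<rho>)) \<and>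
         (\<lambda>x. x powr \<alpha> * \<P>(\<omega> in M. R \<omega> < -x)) \<sim>[at_top] (\<lambda>x. Ltilde L x / (2 * \<rho>))"
proof -
  interpret prob_space M by fact
  note [measurable] = assms(2,3)
  obtain \<epsilon> where \<epsilon>: "\<epsilon> > 0" "(\<integral>\<^sup>+ \<omega>. ennreal (\<bar>A \<omega>\<bar> powr (\<alpha> + \<epsilon>)) \<partial>M) < \<infinity>"
    using assms(11) by blast
  have L_pos: "\<And>x. x > 0 \<Longrightarrow> L x > 0" and L_slow: "\<And>l. l > 0 \<Longrightarrow> ((\<lambda>x. L (l * x) / L x) \<longlongrightarrow> 1) at_top"
    using assms(12) by (auto simp: slowly_varying_def)
  define H where "H t = \<P>(\<omega> in M. \<bar>B \<omega>\<bar> > t)" for t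
  define u where "u t = t powr \<alpha> * H t / L t" for t
  have gpos: "eventually (\<lambda>t. t powr (- \<alpha>) * L t \<noteq> 0) at_top"
    using eventually_gt_at_top[of 0] by eventually_elim (use L_pos in force)
  have u_lim: "(u \<longlongrightarrow> 1) at_top"
  proof (rule Lim_transform_eventually)
    show "((\<lambda>t. \<P>(\<omega> in M. B \<omega> > t) / (t powr (- \<alpha>) * L t) + \<P>(\<omega> in M. B \<omega> < - t) / (t powr (- \<alpha>) * L t)) \<longlongrightarrow> 1) at_top"
      using tendsto_add[OF asymp_equiv_const_ratio[OF assms(17) gpos] asymp_equiv_const_ratio[OF assms(18) gpos]]
      unfolding assms(16) .
    show "eventually (\<lambda>t. \<P>(\<omega> in M. B \<omega> > t) / (t powr (- \<alpha>) * L t) + \<P>(\<omega> in M. B \<omega> < - t) / (t powr (- \<alpha>) * L t) = u t) at_top"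
      using eventually_gt_at_top[of 0]
    proof eventually_elim
      case (elim t)
      have "{\<omega> \<in> space M. \<bar>B \<omega>\<bar> > t} = {\<omega> \<in> space M. B \<omega> > t} \<union> {\<omega> \<in> space M. B \<omega> < - t}"
        using elim by auto
      then have "H t = \<P>(\<omega> in M. B \<omega> > t) + \<P>(\<omega> in M. B \<omega> < - t)"
        unfolding H_def using elim by (subst finite_measure_Union[symmetric]) auto
      then show ?case
        using elim L_pos[OF elim] by (simp add: u_def powr_minus field_simps)
    qed
  qed
  have H_reg: "((\<lambda>t. H (2 * t) / H t) \<longlongrightarrow> 2 powr (- \<alpha>)) at_top"
  proof (rule Lim_transform_eventually)
    have "filterlim (\<lambda>t::real. 2 * t) at_top at_top"
      by (rule filterlim_tendsto_pos_mult_at_top[OF tendsto_const _ filterlim_ident]) simp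
    then have u2: "((\<lambda>t. u (2 * t)) \<longlongrightarrow> 1) at_top" by (rule filterlim_compose[OF u_lim])
    have "((\<lambda>t. 2 powr (- \<alpha>) * (u (2 * t) / u t) * (L (2 * t) / L t)) \<longlongrightarrow> 2 powr (- \<alpha>) * (1 / 1) * 1) at_top"
      by (intro tendsto_intros u2 u_lim L_slow) auto
    then show "((\<lambda>t. 2 powr (- \<alpha>) * (u (2 * t) / u t) * (L (2 * t) / L t)) \<longlongrightarrow> 2 powr (- \<alpha>)) at_top" by simp
    have "eventually (\<lambda>t. u t > 0) at_top" by (rule order_tendstoD(1)[OF u_lim]) simp
    then show "eventually (\<lambda>t. 2 powr (- \<alpha>) * (u (2 * t) / u t) * (L (2 * t) / L t) = H (2 * t) / H t) at_top"
      using eventually_gt_at_top[of 0]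
    proof eventually_elim
      case (elim t)
      have "H t \<noteq> 0" "L t \<noteq> 0" "L (2 * t) \<noteq> 0" "t powr \<alpha> \<noteq> 0"
        using elim L_pos[of t] L_pos[of "2 * t"] by (auto simp: u_def)
      then show ?case using elim by (simp add: u_def powr_mult powr_minus field_simps)
    qed
  qed
  interpret affine_heavy_tail M A B \<alpha> \<epsilon> R
    by unfold_locales (use assms \<epsilon> H_reg[unfolded H_def] in auto)
  have tail_H: "tail = H" by (auto simp: tail_def H_def)
  note Lt = trunc_moment_asymp_Ltilde[OF L_pos assms(13)[rule_format] u_lim[unfolded u_def, folded tail_H]]
  have \<rho>: "\<rho> > 0" using drift_pos unfolding assms(9) .
  have main: "(\<lambda>x. x powr \<alpha> * \<P>(\<omega> in M. sg b * R \<omega> > x)) \<sim>[at_top] (\<lambda>x. Ltilde L x / (2 * \<rho>))" for b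
  proof (rule asymp_equivI')
    \<comment> \<open>The limit \<open>1 / (2 * \<alpha> * \<rho>)\<close> relative to the truncated
      moment and the limit \<alpha> of that moment relative to \<open>Ltilde\<close> multiply to
      \<open>1 / (2 * \<rho>)\<close>.\<close>
    have "((\<lambda>x. w b (ln x) / (1 + trunc_moment (exp (ln x)))) \<longlongrightarrow> 1 / (2 * \<alpha> * \<rho>)) at_top"
      using filterlim_compose[OF solution_tail[of b] ln_at_top] unfolding assms(9) .
    from tendsto_mult[OF tendsto_mult[OF this Lt(1)] tendsto_const[of "2 * \<rho>"]]
    have lim: "((\<lambda>x. w b (ln x) / (1 + trunc_moment (exp (ln x))) * ((1 + trunc_moment x) / Ltilde L x) * (2 * \<rho>)) \<longlongrightarrow> 1) at_top"
      using \<rho> \<alpha>_pos by simp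
    show "((\<lambda>x. x powr \<alpha> * \<P>(\<omega> in M. sg b * R \<omega> > x) / (Ltilde L x / (2 * \<rho>))) \<longlongrightarrow> 1) at_top"
    proof (rule Lim_transform_eventually[OF lim])
      show "eventually (\<lambda>x. w b (ln x) / (1 + trunc_moment (exp (ln x))) * ((1 + trunc_moment x) / Ltilde L x) * (2 * \<rho>)
          = x powr \<alpha> * \<P>(\<omega> in M. sg b * R \<omega> > x) / (Ltilde L x / (2 * \<rho>))) at_top"
        using eventually_gt_at_top[of 0]
      proof eventually_elim
        case (elim x)
        have "1 + trunc_moment x \<noteq> 0" using trunc_moment_nonneg[of x] by linarith
        moreover have "w b (ln x) = x powr \<alpha> * \<P>(\<omega> in M. sg b * R \<omega> > x)"
          using elim by (simp add: w_def powr_def)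
        ultimately show ?case using elim by simp
      qed
    qed
  qed
  have "(\<lambda>x. x powr \<alpha> * \<P>(\<omega> in M. R \<omega> > x)) \<sim>[at_top] (\<lambda>x. Ltilde L x / (2 * \<rho>))"
    using main[of False] by (simp add: sg_def)
  moreover have "(\<lambda>x. x powr \<alpha> * \<P>(\<omega> in M. R \<omega> < -x)) \<sim>[at_top] (\<lambda>x. Ltilde L x / (2 * \<rho>))"
    using main[of True] by (simp add: sg_def less_minus_iff)
  ultimately show ?thesis by blast
qed

end
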